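(* Let $n_x\ge 1$, $A\in\mathbb{R}^{n_x\times n_x}$, $B\in\mathbb{R}^{n_x\times 1}$, $C\in\mathbb{R}^{1\times n_x}$, $\lambda\in\mathbb{R}$, $\nu>0$, $\theta_i>0$, $\theta_o=\theta_i$, and consider the system $$\dot x(t)=Ax(t)+B\,\partial_\theta z(t,\theta_o),\qquad \partial_t z(t,\theta)=(\nu\partial_{\theta\theta}+\lambda)z(t,\theta)\ \ (\theta\in(0,\theta_i)),\qquad z(t,0)=Cx(t),\quad z(t,\theta_i)=0,\qquad t\ge0.$$ Let $w>0$ and let $(P,Q,T)$, with $P\in\mathbb{R}^{n_x\times n_x}$ symmetric, $Q:[0,\theta_i]\to\mathbb{R}^{n_x}$ and $T:[0,\theta_i]^2\to\mathbb{R}$ bounded, and $T(\theta_1,\theta_2)=T(\theta_2,\theta_1)$, satisfy $$\begin{aligned} &\mathrm{He}(PA+\nu Q'(0)C)=-I_{n_x},\\ &\nu Q''(\theta)+(A^\top+\lambda I_{n_x})Q(\theta)+\nu C^\top\partial_{\theta_1}T(0,\theta)=0,\\ &Q(0)=0,\qquad PB+\nu Q(\theta_i)=0,\\ &(\nu\partial_{\theta_1\theta_1}+\nu\partial_{\theta_2\theta_2}+2\lambda)T(\theta_1,\theta_2)=0,\\ &T(\theta,0)=0,\qquad \nu T(\theta_i,\theta)+B^\top Q(\theta)=0,\\ &(\partial_{\theta_1}-\partial_{\theta_2})T(\theta,\theta)=-\tfrac{w}{2}. \end{aligned}$$ For a given $n\in\mathbb{N}$, let $\{\varphi_k\}_{k\in\{0,\dots,n-1\}}\subset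 L^2(0,\theta_i)$ be linearly independent functions, orthonormal for the usual $L^2(0,\theta_i)$ scalar product and closed under differentiation, $\Phi_n=(\varphi_0,\dots,\varphi_{n-1})^\top$, and define $$\Psi_n^+=\begin{bmatrix}P&Q_n\\Q_n^\top&T_n\end{bmatrix},\qquad Q_n=\int_0^{\theta_i}Q(\theta)\Phi_n^\top(\theta)\,d\theta,\qquad T_n=\int_0^{\theta_i}\int_0^{\theta_i}\Phi_n(\theta_1)T(\theta_1,\theta_2)\Phi_n^\top(\theta_2)\,d\theta_1d\theta_2.$$ If $\Psi_n^+$ is not positive definite, then the system is unstable.
   Context: $\mathrm{He}(M)=M+M^\top$. The function $T$ is symmetric and its first derivatives may jump across the diagonal; the equation $(\nu\partial_{\theta_1\theta_1}+\nu\partial_{\theta_2\theta_2}+2\lambda)T=0$ holds off the diagonal and the diagonal condition $(\partial_{\theta_1}-\partial_{\theta_2})T(\theta,\theta)=-w/2$ is taken with derivatives from within the triangle $\{\theta_1\ge\theta_2\}$. "Closed under differentiation" means there is $\Delta_n\in\mathbb{R}^{n\times n}$ with $\Phi_n'(\theta)=\Delta_n\Phi_n(\theta)$ for all $\theta\in[0,\theta_i]$. For $n=0$, $\Psi_0^+=P$. State space: $\mathcal{H}=\mathbb{R}^{n_x}\times L^2(0,\theta_i)$ with norm $\|(x,z)\|^2=|x|^2+\int_0^{\theta_i}|z(\theta)|^2\,d\theta$. The operator associated with the system is $\mathcal{A}(x,z)=(Ax+B\,\partial_\theta z(\theta_o),\ \nu\partial_{\theta\theta}z+\lambda z)$ on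 the domain $\mathcal{D}=\{(x,z)\in\mathbb{R}^{n_x}\times H^2(0,\theta_i): z(0)=Cx,\ z(\theta_i)=0\}$. The solution with initial condition $(x_0,z_0)\in\mathcal{H}$ is $(x(t),z(t))=\mathcal{T}(t)(x_0,z_0)$, where $\mathcal{T}$ is the semigroup on $\mathcal{H}$ generated by $\mathcal{A}$. Global asymptotic stability means: (i) for all $\varepsilon>0$ there exists $\delta>0$ such that for any $(x_0,z_0)$ with $\|(x_0,z_0)\|\le\delta$ one has $\|(x(t),z(t))\|\le\varepsilon$ for all $t\ge 0$; and (ii) for any $(x_0,z_0)\in\mathcal{H}$ the solution $(x(t),z(t))\in\mathcal{H}$ converges to the origin as $t\to\infty$. "Unstable" means not globally asymptotically stable. *)

theory Defs
  imports "HOL-Analysis.Analysis"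
begin

section \<open>The state space\<close>

text \<open>
  \<open>L\<^sup>2(0,b)\<close> is represented by Borel square-integrable functions, identified when they agree
  almost everywhere. Functions are only looked at on the interval; their values elsewhere are
  irrelevant. The state space \<open>\<real>\<^sup>n \<times> L\<^sup>2(0,b)\<close> is accordingly a set of representatives carrying
  a seminorm; equality in it is \<open>state_eq\<close>.
\<close>

definition interval_measure :: "real \<Rightarrow> real measure" where
  "interval_measure b = restrict_space lborel {0<..<b}"

definition L2 :: "real \<Rightarrow> (real \<Rightarrow> real) set" where
  "L2 b = {z. z \<in> borel_measurable (interval_measure b) \<and>
              integrable (interval_measure b) (\<lambda>\<theta>. (z \<theta>)\<^sup>2)}"

type_synonym 'n state = "(real ^ 'n) \<times> (real \<Rightarrow> real)"

definition state_space :: "real \<Rightarrow> ('n::finite) state set" where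
  "state_space b = UNIV \<times> L2 b"

definition state_eq :: "real \<Rightarrow> ('n::finite) state \<Rightarrow> 'n state \<Rightarrow> bool" where
  "state_eq b h g \<longleftrightarrow> fst h = fst g \<and> (AE \<theta> in interval_measure b. snd h \<theta> = snd g \<theta>)"

definition state_norm :: "real \<Rightarrow> ('n::finite) state \<Rightarrow> real" where
  "state_norm b h = sqrt ((norm (fst h))\<^sup>2 + (LINT \<theta>|interval_measure b. (snd h \<theta>)\<^sup>2))"

definition lin_comb :: "real \<Rightarrow> ('n::finite) state \<Rightarrow> real \<Rightarrow> 'n state \<Rightarrow> 'n state" where
  "lin_comb r h s g = (r *\<^sub>R fst h + s *\<^sub>R fst g, \<lambda>\<theta>. r * snd h \<theta> + s * snd g \<theta>)"


section \<open>The system operator and its semigroup\<close>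

text \<open>
  \<open>H2_with_derivs b z z1 z2\<close>: \<open>z\<close> is the continuously differentiable representative of an element
  of \<open>H\<^sup>2(0,b)\<close>, \<open>z1\<close> is its first derivative, which is absolutely continuous on \<open>[0,b]\<close>, and
  \<open>z2 \<in> L\<^sup>2(0,b)\<close> is its second derivative (determined up to null sets).
\<close>

definition H2_with_derivs ::
  "real \<Rightarrow> (real \<Rightarrow> real) \<Rightarrow> (real \<Rightarrow> real) \<Rightarrow> (real \<Rightarrow> real) \<Rightarrow> bool" where
  "H2_with_derivs b z z1 z2 \<longleftrightarrow>
     (\<forall>\<theta>\<in>{0..b}. (z has_real_derivative z1 \<theta>) (at \<theta> within {0..b})) \<and>
     z2 \<in> L2 b \<and>
     (\<forall>\<theta>\<in>{0..b}. z1 \<theta> = z1 0 + (LINT s:{0<..<\<theta>}|lborel. z2 s))"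

text \<open>The graph of the unbounded operator, on the representatives for which the boundary values
  make sense.\<close>

definition system_operator ::
  "real^'n^'n \<Rightarrow> real^1^'n \<Rightarrow> real^'n^1 \<Rightarrow> real \<Rightarrow> real \<Rightarrow> real \<Rightarrow> real \<Rightarrow>
   (('n::finite) state \<times> 'n state) set" where
  "system_operator A B C lam nu theta_i theta_o =
     {((x, z), (A *v x + B *v vec (z1 theta_o), \<lambda>\<theta>. nu * z2 \<theta> + lam * z \<theta>)) | x z z1 z2.
        H2_with_derivs theta_i z z1 z2 \<and> vec (z 0) = C *v x \<and> z theta_i = 0}"

definition C0_semigroup :: "real \<Rightarrow> (real \<Rightarrow> ('n::finite) state \<Rightarrow> 'n state) \<Rightarrow> bool" where
  "C0_semigroup b S \<longleftrightarrow>
     (\<forall>t\<ge>0. \<forall>h\<in>state_space b. S t h \<in> state_space b) \<and>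
     (\<forall>t\<ge>0. \<forall>h\<in>state_space b. \<forall>g\<in>state_space b. \<forall>r s.
        state_eq b (S t (lin_comb r h s g)) (lin_comb r (S t h) s (S t g))) \<and>
     (\<forall>t\<ge>0. \<exists>K. \<forall>h\<in>state_space b. state_norm b (S t h) \<le> K * state_norm b h) \<and>
     (\<forall>h\<in>state_space b. state_eq b (S 0 h) h) \<and>
     (\<forall>s\<ge>0. \<forall>t\<ge>0. \<forall>h\<in>state_space b. state_eq b (S (s + t) h) (S s (S t h))) \<and>
     (\<forall>h\<in>state_space b.
        ((\<lambda>t. state_norm b (lin_comb 1 (S t h) (-1) h)) \<longlongrightarrow> 0) (at_right 0))"

text \<open>\<open>S\<close> is a \<open>C\<^sub>0\<close>-semigroup whose infinitesimal generator is the operator with graph \<open>G\<close>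
  (saturated under \<open>state_eq\<close>).\<close>

definition semigroup_generated_by ::
  "real \<Rightarrow> (('n::finite) state \<times> 'n state) set \<Rightarrow> (real \<Rightarrow> 'n state \<Rightarrow> 'n state) \<Rightarrow> bool" where
  "semigroup_generated_by b G S \<longleftrightarrow> C0_semigroup b S \<and>
     (\<forall>h\<in>state_space b. \<forall>g\<in>state_space b.
        ((\<lambda>t. state_norm b (lin_comb 1 (lin_comb (1/t) (S t h) (-1/t) h) (-1) g)) \<longlongrightarrow> 0) (at_right 0)
        \<longleftrightarrow> (\<exists>h0 g0. (h0, g0) \<in> G \<and> state_eq b h h0 \<and> state_eq b g g0))"

definition globally_asymptotically_stable ::
  "real \<Rightarrow> (real \<Rightarrow> ('n::finite) state \<Rightarrow> 'n state) \<Rightarrow> bool" where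
  "globally_asymptotically_stable b S \<longleftrightarrow>
     (\<forall>\<epsilon>>0. \<exists>\<delta>>0. \<forall>h\<in>state_space b. state_norm b h \<le> \<delta> \<longrightarrow>
        (\<forall>t\<ge>0. state_norm b (S t h) \<le> \<epsilon>)) \<and>
     (\<forall>h\<in>state_space b. ((\<lambda>t. state_norm b (S t h)) \<longlongrightarrow> 0) at_top)"

definition unstable :: "real \<Rightarrow> (real \<Rightarrow> ('n::finite) state \<Rightarrow> 'n state) \<Rightarrow> bool" where
  "unstable b S \<longleftrightarrow> \<not> globally_asymptotically_stable b S"


section \<open>The equations for \<open>(P, Q, T)\<close>\<close>

definition He :: "real^'n^'n \<Rightarrow> real^'n^('n::finite)" where
  "He M = M + transpose M"

definition lower_triangle :: "real \<Rightarrow> (real \<times> real) set" where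
  "lower_triangle b = {(\<theta>1, \<theta>2). 0 \<le> \<theta>2 \<and> \<theta>2 \<le> \<theta>1 \<and> \<theta>1 \<le> b}"

definition upper_triangle :: "real \<Rightarrow> (real \<times> real) set" where
  "upper_triangle b = {(\<theta>1, \<theta>2). 0 \<le> \<theta>1 \<and> \<theta>1 \<le> \<theta>2 \<and> \<theta>2 \<le> b}"

text \<open>Partial derivatives taken from within a set \<open>S\<close>; for the two triangles and their interiors the
  derivative within the set is unique, also at edges and corners.\<close>

definition partial1 :: "(real \<times> real) set \<Rightarrow> (real \<times> real \<Rightarrow> real) \<Rightarrow> real \<times> real \<Rightarrow> real" where
  "partial1 S F p = frechet_derivative F (at p within S) (1, 0)"

definition partial2 :: "(real \<times> real) set \<Rightarrow> (real \<times> real \<Rightarrow> real) \<Rightarrow> real \<times> real \<Rightarrow> real" where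
  "partial2 S F p = frechet_derivative F (at p within S) (0, 1)"

definition C1_on :: "(real \<times> real) set \<Rightarrow> (real \<times> real \<Rightarrow> real) \<Rightarrow> bool" where
  "C1_on S F \<longleftrightarrow> F differentiable_on S \<and>
     continuous_on S (partial1 S F) \<and> continuous_on S (partial2 S F)"

text \<open>
  Classical regularity of \<open>T\<close>: \<open>C\<^sup>1\<close> up to the boundary on each closed triangle (so that the
  boundary and diagonal conditions make sense) and \<open>C\<^sup>2\<close> inside. \<open>C\<^sup>2\<close> up to the boundary would be
  too much: at the corner \<open>(\<theta>\<^sub>i, 0)\<close> the conditions of \<open>lyapunov_equations\<close> allow it only if \<open>CB = 0\<close>.
\<close>

definition piecewise_regular :: "real \<Rightarrow> (real \<times> real \<Rightarrow> real) \<Rightarrow> bool" where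
  "piecewise_regular b T \<longleftrightarrow>
     (\<forall>S\<in>{lower_triangle b, upper_triangle b}. C1_on S T \<and>
        C1_on (interior S) (partial1 S T) \<and> C1_on (interior S) (partial2 S T))"

definition deriv_on :: "real \<Rightarrow> (real \<Rightarrow> 'a) \<Rightarrow> real \<Rightarrow> 'a::real_normed_vector" where
  "deriv_on b f \<theta> = vector_derivative f (at \<theta> within {0..b})"

definition lyapunov_equations ::
  "real^'n^'n \<Rightarrow> real^1^'n \<Rightarrow> real^'n^1 \<Rightarrow> real \<Rightarrow> real \<Rightarrow> real \<Rightarrow> real \<Rightarrow>
   real^'n^'n \<Rightarrow> (real \<Rightarrow> real^'n) \<Rightarrow> (real \<times> real \<Rightarrow> real) \<Rightarrow> bool" where
  "lyapunov_equations A B C lam nu theta_i w P Q T \<longleftrightarrow>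
     He (P ** A + nu *\<^sub>R (columnvector (deriv_on theta_i Q 0) ** C)) = - mat 1 \<and>
     (\<forall>\<theta>\<in>{0..theta_i}.
        nu *\<^sub>R deriv_on theta_i (deriv_on theta_i Q) \<theta> + (transpose A + lam *\<^sub>R mat 1) *v Q \<theta>
        + nu *\<^sub>R (transpose C *v vec (partial1 (upper_triangle theta_i) T (0, \<theta>))) = 0) \<and>
     Q 0 = 0 \<and>
     P ** B + nu *\<^sub>R columnvector (Q theta_i) = 0 \<and>
     (\<forall>S\<in>{lower_triangle theta_i, upper_triangle theta_i}. \<forall>p\<in>interior S.
        nu * partial1 S (partial1 S T) p + nu * partial2 S (partial2 S T) p + 2 * lam * T p = 0) \<and>
     (\<forall>\<theta>\<in>{0..theta_i}. T (\<theta>, 0) = 0) \<and>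
     (\<forall>\<theta>\<in>{0..theta_i}. vec (nu * T (theta_i, \<theta>)) + transpose B *v Q \<theta> = 0) \<and>
     (\<forall>\<theta>\<in>{0..theta_i}. partial1 (lower_triangle theta_i) T (\<theta>, \<theta>)
        - partial2 (lower_triangle theta_i) T (\<theta>, \<theta>) = - (w / 2))"


section \<open>The matrix built from finitely many basis functions\<close>

text \<open>The family \<open>(\<phi>\<^sub>k)\<^sub>k\<^sub><\<^sub>n\<close> is given by the values of \<open>\<phi> :: nat \<Rightarrow> real \<Rightarrow> real\<close> at the indices
  below \<open>n\<close>.\<close>

definition lin_indep_L2 :: "real \<Rightarrow> nat \<Rightarrow> (nat \<Rightarrow> real \<Rightarrow> real) \<Rightarrow> bool" where
  "lin_indep_L2 b n \<phi> \<longleftrightarrow>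
     (\<forall>c. (AE \<theta> in interval_measure b. (\<Sum>k<n. c k * \<phi> k \<theta>) = 0) \<longrightarrow> (\<forall>k<n. c k = 0))"

definition orthonormal_L2 :: "real \<Rightarrow> nat \<Rightarrow> (nat \<Rightarrow> real \<Rightarrow> real) \<Rightarrow> bool" where
  "orthonormal_L2 b n \<phi> \<longleftrightarrow>
     (\<forall>k<n. \<forall>l<n. (LINT \<theta>|interval_measure b. \<phi> k \<theta> * \<phi> l \<theta>) = (if k = l then 1 else 0))"

definition closed_under_differentiation :: "real \<Rightarrow> nat \<Rightarrow> (nat \<Rightarrow> real \<Rightarrow> real) \<Rightarrow> bool" where
  "closed_under_differentiation b n \<phi> \<longleftrightarrow>
     (\<exists>\<Delta> :: nat \<Rightarrow> nat \<Rightarrow> real. \<forall>k<n. \<forall>\<theta>\<in>{0..b}.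
        (\<phi> k has_real_derivative (\<Sum>l<n. \<Delta> k l * \<phi> l \<theta>)) (at \<theta> within {0..b}))"

definition Q_coeff ::
  "real \<Rightarrow> (real \<Rightarrow> real^'n) \<Rightarrow> (nat \<Rightarrow> real \<Rightarrow> real) \<Rightarrow> 'n::finite \<Rightarrow> nat \<Rightarrow> real" where
  "Q_coeff b Q \<phi> i k = (LINT \<theta>|interval_measure b. Q \<theta> $ i * \<phi> k \<theta>)"

definition T_coeff ::
  "real \<Rightarrow> (real \<times> real \<Rightarrow> real) \<Rightarrow> (nat \<Rightarrow> real \<Rightarrow> real) \<Rightarrow> nat \<Rightarrow> nat \<Rightarrow> real" where
  "T_coeff b T \<phi> k l =
     (LINT \<theta>1|interval_measure b. LINT \<theta>2|interval_measure b. \<phi> k \<theta>1 * T (\<theta>1, \<theta>2) * \<phi> l \<theta>2)"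

text \<open>Rows and columns of the block matrix are indexed by \<open>Inl i\<close> for the first block and by
  \<open>Inr k\<close>, \<open>k < n\<close>, for the second.\<close>

fun Psi_plus ::
  "real \<Rightarrow> real^'n^'n \<Rightarrow> (real \<Rightarrow> real^'n) \<Rightarrow> (real \<times> real \<Rightarrow> real) \<Rightarrow> (nat \<Rightarrow> real \<Rightarrow> real) \<Rightarrow>
   ('n::finite) + nat \<Rightarrow> 'n + nat \<Rightarrow> real" where
  "Psi_plus b P Q T \<phi> (Inl i) (Inl j) = P $ i $ j"
| "Psi_plus b P Q T \<phi> (Inl i) (Inr l) = Q_coeff b Q \<phi> i l"
| "Psi_plus b P Q T \<phi> (Inr k) (Inl j) = Q_coeff b Q \<phi> j k"
| "Psi_plus b P Q T \<phi> (Inr k) (Inr l) = T_coeff b T \<phi> k l"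

definition positive_definite_on :: "'i set \<Rightarrow> ('i \<Rightarrow> 'i \<Rightarrow> real) \<Rightarrow> bool" where
  "positive_definite_on I M \<longleftrightarrow>
     (\<forall>v. (\<exists>i\<in>I. v i \<noteq> 0) \<longrightarrow> (\<Sum>i\<in>I. \<Sum>j\<in>I. v i * M i j * v j) > 0)"

end

theory Submission
  imports Defs
begin

text \<open>
  Why the theorem holds. The triple \<open>(P, Q, T)\<close> is the kernel of a Lyapunov functional
  \<open>V(x, z) = x \<bullet> P x + 2 \<integral> x \<bullet> Q z + \<integral>\<integral> z T z\<close>, a bounded quadratic form on the state space. The
  equations for \<open>(P, Q, T)\<close> say exactly that along solutions that stay in the domain of the operator
  \<open>dV/dt = - |x|\<^sup>2 - \<nu> w \<parallel>z\<parallel>\<^sup>2\<close> (\<open>lyapunov_form_dissipation\<close>). Hence if all solutions tend to the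
  origin, then \<open>V\<close> is the total dissipation along the orbit and is positive at every nonzero state. But
  the quadratic form of \<open>\<Psi>\<^sub>n\<^sup>+\<close> is the restriction of \<open>V\<close> to the states \<open>(x, \<Sum> \<xi>\<^sub>k \<phi>\<^sub>k)\<close>
  (\<open>Psi_plus_eq_lyapunov_form\<close>), which are nonzero for nonzero \<open>(x, \<xi>)\<close> by linear independence; so a
  matrix that is not positive definite excludes asymptotic stability.

  Three points need care. First, \<open>T\<close> is twice differentiable only inside the two triangles, with second
  derivatives that need not be bounded. One integration by parts (\<open>kernel_by_parts\<close>) leaves only first
  derivatives of \<open>T\<close>. The resulting pairing of \<open>\<nabla>T\<close> with \<open>\<nabla>(z \<otimes> z)\<close> is evaluated by the divergence
  theorem on one triangle (\<open>Dirichlet_pairing\<close>), for a field that is smooth only inside but has a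
  divergence that extends continuously, because \<open>T\<close> solves a Helmholtz equation
  (\<open>divergence_triangle\<close>).

  Second, the states built from the basis functions violate the boundary conditions and so lie outside
  the domain. Functions closed under differentiation are smooth, and adding polynomials concentrated near
  the end points repairs the boundary values at arbitrarily small cost (\<open>domain_approximation\<close>).

  Third, to keep strict positivity in this limit, one uses that orbits issuing from a neighbourhood of a
  nonzero state stay away from the origin for a fixed time and dissipate a fixed amount meanwhile
  (\<open>lyapunov_form_decreasing\<close>, \<open>lyapunov_form_positive\<close>); stability makes the semigroup bounded
  uniformly in time.
\<close>

section \<open>Square-integrable functions on an interval\<close>

lemma space_interval_measure [simp]: "space (interval_measure b) = {0<..<b}"
  by (simp add: interval_measure_def space_restrict_space)

lemma finite_interval_measure: "finite_measure (interval_measure b)"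
  unfolding interval_measure_def by (rule finite_measureI)
     (cases "0 \<le> b", auto simp: space_restrict_space emeasure_restrict_space)

interpretation iv: finite_measure "interval_measure b" for b
  by (rule finite_interval_measure)

interpretation sq: pair_sigma_finite "interval_measure b" "interval_measure b" for b
  by unfold_locales

text \<open>Lebesgue measure on the open square. Diagonals and edges are null sets, so the half-open
  variants of intervals and triangles used below are interchangeable.\<close>

abbreviation square_measure :: "real \<Rightarrow> (real \<times> real) measure" where
  "square_measure b \<equiv> interval_measure b \<Otimes>\<^sub>M interval_measure b"

lemma finite_square_measure: "finite_measure (square_measure b)"
  by (intro finite_measure_pair_measure finite_interval_measure)

interpretation sqf: finite_measure "square_measure b" for b
  by (rule finite_square_measure)

lemma measurable_id_interval: "(\<lambda>x. x) \<in> interval_measure b \<rightarrow>\<^sub>M borel"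
  unfolding interval_measure_def by (rule measurable_restrict_space1) simp

lemma AE_interval_neq: "AE y in interval_measure b. y \<noteq> x"
  unfolding interval_measure_def by (subst AE_restrict_space_iff) (auto intro: AE_mp[OF AE_lborel_singleton[of x]])

lemma integral_interval_measure:
  fixes f :: "real \<Rightarrow> real"
  shows "(LINT x|interval_measure b. f x) = (LINT x:{0<..<b}|lborel. f x)"
  by (simp add: interval_measure_def set_lebesgue_integral_def integral_restrict_space)

lemma integrable_interval_measure:
  fixes f :: "real \<Rightarrow> real"
  shows "integrable (interval_measure b) f \<longleftrightarrow> set_integrable lborel {0<..<b} f"
  by (simp add: interval_measure_def set_integrable_def integrable_restrict_space)

lemma borel_measurable_interval_continuous:
  fixes f :: "real \<Rightarrow> 'a::real_normed_vector"
  assumes "continuous_on {0..b} f"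
  shows "f \<in> borel_measurable (interval_measure b)"
proof -
  have "continuous_on {0<..<b} f"
    using assms by (rule continuous_on_subset) auto
  then have "f \<in> borel_measurable (restrict_space borel {0<..<b})"
    by (rule borel_measurable_continuous_on_restrict)
  then show ?thesis
    by (metis interval_measure_def measurable_cong_sets sets_lborel sets_restrict_space_cong)
qed

lemma integrable_interval_bounded:
  fixes f :: "real \<Rightarrow> 'a::{banach, second_countable_topology}"
  assumes "f \<in> borel_measurable (interval_measure b)" "\<And>x. 0 < x \<Longrightarrow> x < b \<Longrightarrow> norm (f x) \<le> K"
  shows "integrable (interval_measure b) f"
  by (rule iv.integrable_const_bound[where B=K]) (use assms in \<open>auto intro!: AE_I2\<close>)

lemma continuous_bounded_on_interval:
  fixes f :: "real \<Rightarrow> 'a::real_normed_vector"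
  assumes "continuous_on {0..b} f"
  obtains K where "K \<ge> 0" "\<And>x. x \<in> {0..b} \<Longrightarrow> norm (f x) \<le> K"
proof -
  have "bounded (f ` {0..b})"
    using assms by (intro compact_imp_bounded compact_continuous_image) auto
  then obtain K where "\<forall>x\<in>{0..b}. norm (f x) \<le> K"
    by (auto simp: bounded_iff)
  then have "norm (f x) \<le> max K 0" if "x \<in> {0..b}" for x
    using that by (meson max.coboundedI1)
  with that[of "max K 0"] show ?thesis by auto
qed

lemma integrable_interval_continuous:
  fixes f :: "real \<Rightarrow> 'a::{banach, second_countable_topology}"
  assumes "continuous_on {0..b} f"
  shows "integrable (interval_measure b) f"
proof -
  obtain K where "\<And>x. x \<in> {0..b} \<Longrightarrow> norm (f x) \<le> K"
    using continuous_bounded_on_interval[OF assms] by blast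
  then show ?thesis
    by (intro integrable_interval_bounded[where K=K] borel_measurable_interval_continuous assms) auto
qed

lemma L2_measurable [measurable_dest]: "z \<in> L2 b \<Longrightarrow> z \<in> borel_measurable (interval_measure b)"
  by (simp add: L2_def)

lemma L2_mult_integrable:
  assumes "z \<in> L2 b" "y \<in> L2 b"
  shows "integrable (interval_measure b) (\<lambda>\<theta>. z \<theta> * y \<theta>)"
proof (rule Bochner_Integration.integrable_bound)
  show "integrable (interval_measure b) (\<lambda>\<theta>. (z \<theta>)\<^sup>2 + (y \<theta>)\<^sup>2)"
    using assms by (simp add: L2_def)
  show "(\<lambda>\<theta>. z \<theta> * y \<theta>) \<in> borel_measurable (interval_measure b)"
    using assms by (auto simp: L2_def)
  have "\<bar>u * v\<bar> \<le> u\<^sup>2 + v\<^sup>2" for u v :: real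
  proof -
    have "2 * (\<bar>u\<bar> * \<bar>v\<bar>) \<le> u\<^sup>2 + v\<^sup>2"
      using sum_squares_bound[of "\<bar>u\<bar>" "\<bar>v\<bar>"] by (simp add: mult.assoc)
    moreover have "0 \<le> \<bar>u\<bar> * \<bar>v\<bar>" by simp
    ultimately show ?thesis unfolding abs_mult by linarith
  qed
  then show "AE \<theta> in interval_measure b. norm (z \<theta> * y \<theta>) \<le> norm ((z \<theta>)\<^sup>2 + (y \<theta>)\<^sup>2)"
    by auto
qed

lemma L2_bounded:
  assumes "f \<in> borel_measurable (interval_measure b)" "\<And>x. 0 < x \<Longrightarrow> x < b \<Longrightarrow> \<bar>f x\<bar> \<le> K"
  shows "f \<in> L2 b"
proof -
  have "integrable (interval_measure b) (\<lambda>\<theta>. (f \<theta>)\<^sup>2)"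
  proof (rule integrable_interval_bounded[where K="K\<^sup>2"])
    show "(\<lambda>\<theta>. (f \<theta>)\<^sup>2) \<in> borel_measurable (interval_measure b)" using assms(1) by simp
    show "norm ((f x)\<^sup>2) \<le> K\<^sup>2" if "0 < x" "x < b" for x
      using assms(2)[OF that] by (simp add: abs_le_square_iff[symmetric])
  qed
  with assms show ?thesis by (simp add: L2_def)
qed

lemma L2_continuous:
  assumes "continuous_on {0..b} f"
  shows "f \<in> L2 b"
proof -
  obtain K where "\<And>x. x \<in> {0..b} \<Longrightarrow> norm (f x) \<le> K"
    using continuous_bounded_on_interval[OF assms] by blast
  then show ?thesis
    by (intro L2_bounded[where K=K] borel_measurable_interval_continuous assms) auto
qed

lemma L2_integrable: "z \<in> L2 b \<Longrightarrow> integrable (interval_measure b) z"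
  using L2_mult_integrable[of z b "\<lambda>_. 1"] L2_continuous[of b "\<lambda>_. 1"] by simp

lemma L2_lin_comb:
  assumes "z \<in> L2 b" "y \<in> L2 b"
  shows "(\<lambda>\<theta>. r * z \<theta> + s * y \<theta>) \<in> L2 b"
proof -
  note [measurable] = assms[THEN L2_measurable]
  have "integrable (interval_measure b) (\<lambda>\<theta>. r\<^sup>2 * (z \<theta> * z \<theta>) + 2 * r * s * (z \<theta> * y \<theta>) + s\<^sup>2 * (y \<theta> * y \<theta>))"
    by (intro Bochner_Integration.integrable_add integrable_mult_right L2_mult_integrable assms)
  moreover have "(\<lambda>\<theta>. r\<^sup>2 * (z \<theta> * z \<theta>) + 2 * r * s * (z \<theta> * y \<theta>) + s\<^sup>2 * (y \<theta> * y \<theta>)) = (\<lambda>\<theta>. (r * z \<theta> + s * y \<theta>)\<^sup>2)"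
    by (auto simp: power2_eq_square algebra_simps)
  ultimately show ?thesis by (simp add: L2_def)
qed

section \<open>The state space as a semi-inner-product space\<close>

text \<open>The semi-inner product whose seminorm is \<^const>\<open>state_norm\<close>.\<close>

definition state_inner :: "real \<Rightarrow> ('n::finite) state \<Rightarrow> 'n state \<Rightarrow> real" where
  "state_inner b h g = fst h \<bullet> fst g + (LINT \<theta>|interval_measure b. snd h \<theta> * snd g \<theta>)"

lemma state_spaceD: "h \<in> state_space b \<Longrightarrow> snd h \<in> L2 b"
  by (auto simp: state_space_def)

lemma state_spaceI: "snd h \<in> L2 b \<Longrightarrow> h \<in> state_space b"
  by (cases h) (auto simp: state_space_def)

lemma lin_comb_state_space [intro]:
  "h \<in> state_space b \<Longrightarrow> g \<in> state_space b \<Longrightarrow> lin_comb r h s g \<in> state_space b"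
  by (auto simp: state_space_def lin_comb_def intro!: L2_lin_comb)

lemma state_inner_self_nonneg: "0 \<le> state_inner b h h"
  unfolding state_inner_def by (intro add_nonneg_nonneg integral_nonneg_AE) auto

lemma state_norm_power2: "(state_norm b h)\<^sup>2 = state_inner b h h"
  using state_inner_self_nonneg[of b h]
  unfolding state_norm_def state_inner_def
  by (simp add: power2_norm_eq_inner flip: power2_eq_square)

lemma state_norm_nonneg [simp]: "0 \<le> state_norm b h"
  by (simp add: state_norm_def)

lemma state_inner_lin_comb_left:
  assumes "h \<in> state_space b" "g \<in> state_space b" "k \<in> state_space b"
  shows "state_inner b (lin_comb r h s g) k = r * state_inner b h k + s * state_inner b g k"
proof -
  note [simp] = L2_mult_integrable[OF assms(1,3)[THEN state_spaceD]] L2_mult_integrable[OF assms(2,3)[THEN state_spaceD]]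
  have "(LINT \<theta>|interval_measure b. (r * snd h \<theta> + s * snd g \<theta>) * snd k \<theta>) =
        (LINT \<theta>|interval_measure b. r * (snd h \<theta> * snd k \<theta>) + s * (snd g \<theta> * snd k \<theta>))"
    by (simp add: algebra_simps)
  also have "\<dots> = r * (LINT \<theta>|interval_measure b. snd h \<theta> * snd k \<theta>) + s * (LINT \<theta>|interval_measure b. snd g \<theta> * snd k \<theta>)"
    by simp
  finally show ?thesis
    by (simp add: state_inner_def lin_comb_def inner_add_left algebra_simps)
qed

lemma state_inner_commute: "state_inner b h g = state_inner b g h"
  by (simp add: state_inner_def inner_commute mult.commute)

lemma state_norm_lin_comb_power2:
  assumes "h \<in> state_space b" "g \<in> state_space b"
  shows "(state_norm b (lin_comb r h s g))\<^sup>2 =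
    r\<^sup>2 * (state_norm b h)\<^sup>2 + 2 * r * s * state_inner b h g + s\<^sup>2 * (state_norm b g)\<^sup>2"
proof -
  have "lin_comb r h s g \<in> state_space b" using assms by auto
  then have "(state_norm b (lin_comb r h s g))\<^sup>2 =
      r * state_inner b (lin_comb r h s g) h + s * state_inner b (lin_comb r h s g) g"
    using assms by (simp add: state_norm_power2 state_inner_lin_comb_left) (simp add: state_inner_lin_comb_left state_inner_commute[of b _ "lin_comb r h s g"])
  then show ?thesis
    using assms by (simp add: state_inner_lin_comb_left state_norm_power2 state_inner_commute[of b g h])
       (simp add: power2_eq_square algebra_simps)
qed

lemma state_Cauchy_Schwarz:
  assumes "h \<in> state_space b" "g \<in> state_space b"
  shows "\<bar>state_inner b h g\<bar> \<le> state_norm b h * state_norm b g"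
proof -
  define a c d where "a = (state_norm b h)\<^sup>2" and "c = state_inner b h g" and "d = (state_norm b g)\<^sup>2"
  have pos: "0 \<le> r\<^sup>2 * a + 2 * r * s * c + s\<^sup>2 * d" for r s
    using state_norm_lin_comb_power2[OF assms, of r s] unfolding a_def c_def d_def
    by (metis zero_le_power2)
  have "c\<^sup>2 \<le> a * d"
  proof (cases "d = 0")
    case True
    have "c = 0"
    proof (rule ccontr)
      assume "c \<noteq> 0"
      \<comment> \<open>these coefficients give the quadratic form the value \<open>-1\<close>\<close>
      with pos[of 1 "-(a + 1) / (2 * c)"] True show False by (simp add: field_simps)
    qed
    then show ?thesis using True by simp
  next
    case False
    then have "d > 0" unfolding d_def by (simp add: less_le)
    from pos[of d "- c"] have "0 \<le> d * (a * d - c\<^sup>2)"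
      by (simp add: power2_eq_square algebra_simps)
    with \<open>d > 0\<close> show ?thesis by (simp add: zero_le_mult_iff)
  qed
  then have "c\<^sup>2 \<le> (state_norm b h * state_norm b g)\<^sup>2"
    by (simp add: a_def d_def power_mult_distrib)
  then show ?thesis unfolding c_def
    by (metis abs_le_square_iff abs_of_nonneg mult_nonneg_nonneg state_norm_nonneg)
qed

lemma state_norm_lin_comb_le:
  assumes "h \<in> state_space b" "g \<in> state_space b"
  shows "state_norm b (lin_comb r h s g) \<le> \<bar>r\<bar> * state_norm b h + \<bar>s\<bar> * state_norm b g"
proof (rule power2_le_imp_le)
  have "\<bar>r * s * state_inner b h g\<bar> \<le> \<bar>r\<bar> * \<bar>s\<bar> * (state_norm b h * state_norm b g)"
    unfolding abs_mult by (intro mult_left_mono state_Cauchy_Schwarz[OF assms]) auto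
  then have "r * s * state_inner b h g \<le> \<bar>r\<bar> * \<bar>s\<bar> * (state_norm b h * state_norm b g)"
    by linarith
  then show "(state_norm b (lin_comb r h s g))\<^sup>2 \<le> (\<bar>r\<bar> * state_norm b h + \<bar>s\<bar> * state_norm b g)\<^sup>2"
    unfolding state_norm_lin_comb_power2[OF assms] power2_sum by (simp add: power_mult_distrib mult.assoc mult.left_commute)
qed simp

lemma state_norm_scale:
  assumes "h \<in> state_space b"
  shows "state_norm b (lin_comb r h 0 h) = \<bar>r\<bar> * state_norm b h"
proof -
  have "(state_norm b (lin_comb r h 0 h))\<^sup>2 = (\<bar>r\<bar> * state_norm b h)\<^sup>2"
    using state_norm_lin_comb_power2[OF assms assms, of r 0] by (simp add: power_mult_distrib)
  then show ?thesis by (metis abs_ge_zero mult_nonneg_nonneg power2_eq_imp_eq state_norm_nonneg)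
qed

lemma state_eq_refl [simp]: "state_eq b h h" by (simp add: state_eq_def)
lemma state_eq_sym: "state_eq b h g \<Longrightarrow> state_eq b g h"
  by (auto simp: state_eq_def elim: eventually_mono)
lemma state_eq_trans [trans]: "state_eq b h g \<Longrightarrow> state_eq b g k \<Longrightarrow> state_eq b h k"
  by (auto simp: state_eq_def elim: eventually_elim2)
lemma state_eq_lin_comb:
  "state_eq b h h' \<Longrightarrow> state_eq b g g' \<Longrightarrow> state_eq b (lin_comb r h s g) (lin_comb r h' s g')"
  by (auto simp: state_eq_def lin_comb_def elim: eventually_elim2)

lemma state_norm_cong_eq:
  assumes "state_eq b h g" "h \<in> state_space b" "g \<in> state_space b"
  shows "state_norm b h = state_norm b g"
proof -
  have "(LINT \<theta>|interval_measure b. (snd h \<theta>)\<^sup>2) = (LINT \<theta>|interval_measure b. (snd g \<theta>)\<^sup>2)"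
    using assms by (intro integral_cong_AE) (auto simp: state_eq_def state_space_def L2_def elim: eventually_mono)
  then show ?thesis using assms by (simp add: state_norm_def state_eq_def)
qed

lemma L1_le_state_norm:
  assumes "z \<in> L2 b" "b \<ge> 0"
  shows "(LINT \<theta>|interval_measure b. \<bar>z \<theta>\<bar>) \<le> sqrt b * state_norm b ((x, z) :: ('n::finite) state)"
proof -
  note [measurable] = assms(1)[THEN L2_measurable]
  define h g :: "'n state" where "h = (0, \<lambda>\<theta>. \<bar>z \<theta>\<bar>)" and "g = (0, \<lambda>_. 1)"
  have *: "h \<in> state_space b" "g \<in> state_space b"
    using assms L2_continuous[of b "\<lambda>_. 1"] by (auto simp: h_def g_def state_space_def L2_def)
  have "measure (interval_measure b) {0<..<b} = b"
    using assms(2) by (simp add: interval_measure_def measure_restrict_space)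
  then have "state_norm b g = sqrt b" by (simp add: g_def state_norm_def)
  moreover have "state_inner b h g = (LINT \<theta>|interval_measure b. \<bar>z \<theta>\<bar>)"
    by (simp add: h_def g_def state_inner_def)
  moreover have "state_norm b h \<le> state_norm b (x, z)"
    by (simp add: state_norm_def h_def)
  ultimately show ?thesis
    using state_Cauchy_Schwarz[OF *] assms(2)
    by (smt (verit) mult.commute mult_right_mono real_sqrt_ge_zero)
qed

section \<open>Functions on the square\<close>

lemma borel_measurable_square_continuous:
  fixes f :: "real \<times> real \<Rightarrow> real"
  assumes "continuous_on A f" "A \<in> sets borel"
  shows "(\<lambda>p. indicator A p * f p) \<in> borel_measurable (square_measure b)"
proof -
  have "(\<lambda>p. indicator A p *\<^sub>R f p) \<in> borel_measurable borel"
    by (rule borel_measurable_continuous_on_indicator) (use assms in auto)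
  moreover have "(\<lambda>p. p) \<in> square_measure b \<rightarrow>\<^sub>M borel"
  proof -
    have "(\<lambda>p. (fst p, snd p)) \<in> square_measure b \<rightarrow>\<^sub>M borel"
      by (intro borel_measurable_Pair) (auto intro!: measurable_compose[OF _ measurable_id_interval])
    then show ?thesis by simp
  qed
  ultimately show ?thesis
    by (auto dest: measurable_compose)
qed

lemma integrable_square_bounded:
  fixes f :: "real \<times> real \<Rightarrow> real"
  assumes "f \<in> borel_measurable (square_measure b)"
    and "\<And>x y. 0 < x \<Longrightarrow> x < b \<Longrightarrow> 0 < y \<Longrightarrow> y < b \<Longrightarrow> \<bar>f (x, y)\<bar> \<le> K"
  shows "integrable (square_measure b) f"
  by (rule sqf.integrable_const_bound[where B=K])
     (use assms in \<open>auto intro!: AE_I2 simp: space_pair_measure\<close>)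

lemma integrable_square_tensor:
  fixes f g :: "real \<Rightarrow> real"
  assumes f: "integrable (interval_measure b) f" and g: "integrable (interval_measure b) g"
  shows "integrable (square_measure b) (\<lambda>p. f (fst p) * g (snd p))"
proof -
  have [measurable]: "f \<in> borel_measurable (interval_measure b)" "g \<in> borel_measurable (interval_measure b)"
    using f g by auto
  have "integrable (square_measure b) (\<lambda>(x, y). f x * g y)"
    by (rule sq.Fubini_integrable) (use f g in \<open>auto simp: abs_mult\<close>)
  then show ?thesis by (simp add: case_prod_unfold)
qed

lemma integrable_square_kernel:
  fixes k :: "real \<times> real \<Rightarrow> real"
  assumes f: "integrable (interval_measure b) f" and g: "integrable (interval_measure b) g"
    and k: "k \<in> borel_measurable (square_measure b)"
    and K: "\<And>x y. 0 < x \<Longrightarrow> x < b \<Longrightarrow> 0 < y \<Longrightarrow> y < b \<Longrightarrow> \<bar>k (x, y)\<bar> \<le> K"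
  shows "integrable (square_measure b) (\<lambda>p. f (fst p) * k p * g (snd p))"
proof (rule Bochner_Integration.integrable_bound)
  show "integrable (square_measure b) (\<lambda>p. K * (f (fst p) * g (snd p)))"
    by (intro integrable_mult_right integrable_square_tensor f g)
  have [measurable]: "f \<in> borel_measurable (interval_measure b)" "g \<in> borel_measurable (interval_measure b)"
    using f g by auto
  note [measurable] = k
  show "(\<lambda>p. f (fst p) * k p * g (snd p)) \<in> borel_measurable (square_measure b)"
    by measurable
  show "AE p in square_measure b.
      norm (f (fst p) * k p * g (snd p)) \<le> norm (K * (f (fst p) * g (snd p)))"
  proof (rule AE_I2)
    fix p assume "p \<in> space (square_measure b)"
    then have "\<bar>k p\<bar> \<le> \<bar>K\<bar>" using K[of "fst p" "snd p"] by (auto simp: space_pair_measure)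
    then have "\<bar>k p\<bar> * (\<bar>f (fst p)\<bar> * \<bar>g (snd p)\<bar>) \<le> \<bar>K\<bar> * (\<bar>f (fst p)\<bar> * \<bar>g (snd p)\<bar>)"
      by (intro mult_right_mono) auto
    then show "norm (f (fst p) * k p * g (snd p)) \<le> norm (K * (f (fst p) * g (snd p)))"
      by (simp add: abs_mult algebra_simps)
  qed
qed

lemma integral_square_fst:
  fixes f :: "real \<times> real \<Rightarrow> real"
  assumes "integrable (square_measure b) f"
  shows "(LINT x|interval_measure b. LINT y|interval_measure b. f (x, y)) =
    (LINT p|square_measure b. f p)"
  using sq.integral_fst'[OF assms] .

lemma integral_square_snd:
  fixes f :: "real \<times> real \<Rightarrow> real"
  assumes "integrable (square_measure b) f"
  shows "(LINT y|interval_measure b. LINT x|interval_measure b. f (x, y)) =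
    (LINT p|square_measure b. f p)"
  using sq.integral_snd[of b "\<lambda>x y. f (x, y)"] assms by (simp add: case_prod_unfold)

lemma measurable_square_swap:
  assumes "f \<in> borel_measurable (square_measure b)"
  shows "(\<lambda>s. f (prod.swap s)) \<in> borel_measurable (square_measure b)"
  using measurable_compose[OF measurable_pair_swap' assms] by (simp add: case_prod_unfold prod.swap_def)

lemma integral_square_swap:
  fixes f :: "real \<times> real \<Rightarrow> real"
  assumes "f \<in> borel_measurable (square_measure b)"
  shows "(LINT p|square_measure b. f (prod.swap p)) =
    (LINT p|square_measure b. f p)"
  using sq.integral_product_swap[OF assms] by (simp add: prod.swap_def case_prod_unfold)

section \<open>Integration by parts and the divergence theorem on a triangle\<close>

text \<open>\<open>u'\<close> is an integrable derivative of the absolutely continuous function \<open>u\<close> on \<open>[0,b]\<close>.\<close>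

definition primitive_on :: "real \<Rightarrow> (real \<Rightarrow> real) \<Rightarrow> (real \<Rightarrow> real) \<Rightarrow> bool" where
  "primitive_on b u u' \<longleftrightarrow> integrable (interval_measure b) u' \<and>
     (\<forall>y\<in>{0..b}. u y = u 0 + (LINT s:{0<..<y}|lborel. u' s))"

lemma fundamental_theorem_Lebesgue:
  fixes u u' :: "real \<Rightarrow> real"
  assumes "finite E" "a \<le> c" "continuous_on {a..c} u"
    and "\<And>x. a < x \<Longrightarrow> x < c \<Longrightarrow> x \<notin> E \<Longrightarrow> (u has_real_derivative u' x) (at x)"
    and J: "{a<..<c} \<subseteq> J" "J \<subseteq> {a..c}" and int: "set_integrable lborel J u'"
  shows "(LINT s:J|lborel. u' s) = u c - u a"
proof -
  have hi: "(u' has_integral (u c - u a)) {a..c}"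
    using assms(1-4) by (intro fundamental_theorem_of_calculus_interior_strong[where S=E])
      (auto simp: has_real_derivative_iff_has_vector_derivative)
  have "{x \<in> {a..c} - J. u' x \<noteq> 0} \<subseteq> {a, c}" "{x \<in> J - {a..c}. u' x \<noteq> 0} \<subseteq> {a, c}"
  proof -
    have "x = a \<or> x = c" if "x \<in> {a..c} - J" for x
    proof (rule ccontr)
      assume "\<not> (x = a \<or> x = c)"
      with that have "x \<in> {a<..<c}" by auto
      with J(1) that show False by auto
    qed
    then show "{x \<in> {a..c} - J. u' x \<noteq> 0} \<subseteq> {a, c}" by auto
    show "{x \<in> J - {a..c}. u' x \<noteq> 0} \<subseteq> {a, c}" using J(2) by auto
  qed
  then have neg: "negligible {x \<in> {a..c} - J. u' x \<noteq> 0}" "negligible {x \<in> J - {a..c}. u' x \<noteq> 0}"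
    by (meson negligible_finite negligible_subset finite.intros)+
  have "(u' has_integral (u c - u a)) J"
    by (rule iffD1[OF has_integral_spike_set_eq[OF neg] hi])
  then show ?thesis
    using set_borel_integral_eq_integral(2)[OF int] by (simp add: integral_unique)
qed

lemma primitive_onI:
  assumes "finite E" "continuous_on {0..b} u"
    and der: "\<And>x. 0 < x \<Longrightarrow> x < b \<Longrightarrow> x \<notin> E \<Longrightarrow> (u has_real_derivative u' x) (at x)"
    and int: "integrable (interval_measure b) u'"
  shows "primitive_on b u u'"
  unfolding primitive_on_def
proof (intro conjI ballI int)
  fix y assume y: "y \<in> {0..b}"
  have "(LINT s:{0<..<y}|lborel. u' s) = u y - u 0"
  proof (rule fundamental_theorem_Lebesgue[OF \<open>finite E\<close>, where u=u])
    show "continuous_on {0..y} u"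
      using assms(2) by (rule continuous_on_subset) (use y in auto)
    show "set_integrable lborel {0<..<y} u'"
      using int[unfolded integrable_interval_measure] by (rule set_integrable_subset) (use y in auto)
  qed (use y der in auto)
  then show "u y = u 0 + (LINT s:{0<..<y}|lborel. u' s)" by simp
qed

lemma set_integral_initial_segment:
  fixes f :: "real \<Rightarrow> real"
  assumes "y \<le> b"
  shows "(LINT s:{0<..<y}|lborel. f s) = (LINT s|interval_measure b. indicator {..<y} s * f s)"
  unfolding integral_interval_measure set_lebesgue_integral_def
  by (rule Bochner_Integration.integral_cong) (use assms in \<open>auto simp: indicator_def\<close>)

lemma set_integral_initial_segment_closed:
  fixes f :: "real \<Rightarrow> real"
  assumes "f \<in> borel_measurable (interval_measure b)"
  shows "(LINT s|interval_measure b. indicator {..<y} s * f s) = (LINT s|interval_measure b. indicator {..y} s * f s)"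
proof -
  have "(\<lambda>s. indicator {..<y} s * f s) \<in> borel_measurable (interval_measure b)"
    "(\<lambda>s. indicator {..y} s * f s) \<in> borel_measurable (interval_measure b)"
    using assms measurable_id_interval[of b] by measurable
  then show ?thesis
    using AE_interval_neq[of y b]
    by (intro integral_cong_AE) (auto elim!: eventually_mono simp: indicator_def)
qed

text \<open>Integration by parts for absolutely continuous functions: both sides are sums of integrals
  of \<open>u'(s) v'(t)\<close>, over the parts \<open>s < t\<close> and \<open>t \<le> s\<close> of the square.\<close>

lemma primitive_by_parts:
  assumes "b \<ge> 0" "primitive_on b u u'" "primitive_on b v v'"
  shows "(LINT y|interval_measure b. u y * v' y) =
    u b * v b - u 0 * v 0 - (LINT s|interval_measure b. u' s * v s)"
proof -
  have u': "integrable (interval_measure b) u'" and v': "integrable (interval_measure b) v'"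
    using assms by (auto simp: primitive_on_def)
  have meas: "Measurable.pred (square_measure b) (\<lambda>p. fst p < snd p)"
    by (rule borel_measurable_pred_less; rule measurable_compose[OF _ measurable_id_interval]) auto
  define I where "I k = (LINT p|square_measure b. u' (fst p) * k p * v' (snd p))" for k :: "real \<times> real \<Rightarrow> real"
  let ?k = "\<lambda>p::real \<times> real. if fst p < snd p then 1 else 0 :: real"
  let ?l = "\<lambda>p::real \<times> real. if fst p < snd p then 0 else 1 :: real"
  have int: "integrable (square_measure b) (\<lambda>p. u' (fst p) * ?k p * v' (snd p))"
            "integrable (square_measure b) (\<lambda>p. u' (fst p) * ?l p * v' (snd p))"
    using meas by (auto intro!: integrable_square_kernel[OF u' v', where K=1])
  have ub: "(LINT s|interval_measure b. u' s) = u b - u 0" and vb: "(LINT s|interval_measure b. v' s) = v b - v 0"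
    using assms unfolding primitive_on_def integral_interval_measure
    by (metis add_diff_cancel_left' atLeastAtMost_iff order_refl)+
  have u_eq: "u y = u 0 + (LINT s|interval_measure b. indicator {..<y} s * u' s)" if "0 < y" "y < b" for y
  proof -
    have "u y = u 0 + (LINT s:{0<..<y}|lborel. u' s)"
      using assms(2) that by (simp only: primitive_on_def atLeastAtMost_iff less_imp_le)
    then show ?thesis
      using that set_integral_initial_segment[of y b u'] by simp
  qed
  have v_eq: "v s = v 0 + (LINT y|interval_measure b. indicator {..s} y * v' y)" if "0 < s" "s < b" for s
  proof -
    have "v s = v 0 + (LINT y:{0<..<s}|lborel. v' y)"
      using assms(3) that by (simp only: primitive_on_def atLeastAtMost_iff less_imp_le)
    then show ?thesis
      using that set_integral_initial_segment[of s b v']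
        set_integral_initial_segment_closed[OF borel_measurable_integrable[OF v'], of s] by simp
  qed
  have "(LINT y|interval_measure b. u y * v' y) =
        (LINT y|interval_measure b. u 0 * v' y + (LINT s|interval_measure b. u' s * ?k (s, y) * v' y))"
  proof (rule Bochner_Integration.integral_cong)
    fix y assume "y \<in> space (interval_measure b)"
    then have y: "0 < y" "y < b" by auto
    have "(LINT s|interval_measure b. u' s * ?k (s, y) * v' y) =
          (LINT s|interval_measure b. indicator {..<y} s * u' s) * v' y"
      by (subst integral_mult_left_zero[symmetric]) (rule Bochner_Integration.integral_cong, auto simp: indicator_def)
    then show "u y * v' y = u 0 * v' y + (LINT s|interval_measure b. u' s * ?k (s, y) * v' y)"
      by (subst u_eq[OF y]) (simp add: algebra_simps)
  qed simp
  also have "\<dots> = u 0 * (v b - v 0) + I ?k"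
    using sq.integrable_snd[of b "\<lambda>x y. u' x * ?k (x, y) * v' y"] int(1) integral_square_snd[OF int(1)] v'
    by (simp add: I_def case_prod_unfold vb)
  finally have 1: "(LINT y|interval_measure b. u y * v' y) = u 0 * (v b - v 0) + I ?k" .
  have "(LINT s|interval_measure b. u' s * v s) =
        (LINT s|interval_measure b. v 0 * u' s + (LINT y|interval_measure b. u' s * ?l (s, y) * v' y))"
  proof (rule Bochner_Integration.integral_cong)
    fix s assume "s \<in> space (interval_measure b)"
    then have s: "0 < s" "s < b" by auto
    have *: "(LINT y|interval_measure b. u' s * ?l (s, y) * v' y) =
          u' s * (LINT y|interval_measure b. indicator {..s} y * v' y)"
      by (subst integral_mult_right_zero[symmetric]) (rule Bochner_Integration.integral_cong, auto simp: indicator_def)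
    show "u' s * v s = v 0 * u' s + (LINT y|interval_measure b. u' s * ?l (s, y) * v' y)"
      unfolding * by (subst v_eq[OF s]) (simp add: algebra_simps)
  qed simp
  also have "\<dots> = v 0 * (u b - u 0) + I ?l"
    using sq.integrable_fst'[OF int(2)] integral_square_fst[OF int(2)] u'
    by (simp add: I_def ub)
  finally have 2: "(LINT s|interval_measure b. u' s * v s) = v 0 * (u b - u 0) + I ?l" .
  have "I ?k + I ?l = (LINT p|square_measure b. u' (fst p) * ?k p * v' (snd p) + u' (fst p) * ?l p * v' (snd p))"
    unfolding I_def using int by simp
  also have "\<dots> = (LINT p|square_measure b. u' (fst p) * v' (snd p))"
    by (rule Bochner_Integration.integral_cong) auto
  also have "\<dots> = (LINT x|interval_measure b. LINT y|interval_measure b. u' x * v' y)"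
    using integral_square_fst[OF integrable_square_tensor[OF u' v']] by simp
  also have "\<dots> = (u b - u 0) * (v b - v 0)"
    by (simp add: ub vb)
  finally show ?thesis using 1 2 by (simp add: algebra_simps)
qed

text \<open>The open triangle below the diagonal.\<close>

definition open_triangle :: "real \<Rightarrow> (real \<times> real) set" where
  "open_triangle b = {(x, y). 0 < y \<and> y < x \<and> x < b}"

lemma compact_lower_triangle: "compact (lower_triangle b)"
proof -
  have "lower_triangle b = ({0..b} \<times> {0..b}) \<inter> {p. snd p \<le> fst p}"
    by (auto simp: lower_triangle_def)
  moreover have "closed {p::real\<times>real. snd p \<le> fst p}"
    by (intro closed_Collect_le continuous_intros)
  ultimately show ?thesis by (simp add: compact_Int_closed compact_Times)
qed

lemma lower_triangle_borel: "lower_triangle b \<in> sets borel"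
  using compact_imp_closed[OF compact_lower_triangle] by simp

lemma open_open_triangle: "open (open_triangle b)"
proof -
  have "open_triangle b = {p. 0 < snd p} \<inter> {p. snd p < fst p} \<inter> {p. fst p < b}"
    by (auto simp: open_triangle_def)
  moreover have "open \<dots>"
    by (intro open_Int open_Collect_less continuous_intros)
  ultimately show ?thesis by simp
qed

lemma open_triangle_subset: "open_triangle b \<subseteq> interior (lower_triangle b)"
  by (rule interior_maximal[OF _ open_open_triangle]) (auto simp: open_triangle_def lower_triangle_def)

lemma continuous_bounded_on_triangle:
  fixes f :: "real \<times> real \<Rightarrow> real"
  assumes "continuous_on (lower_triangle b) f"
  obtains K where "K \<ge> 0" "\<And>p. p \<in> lower_triangle b \<Longrightarrow> \<bar>f p\<bar> \<le> K"
proof -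
  have "bounded (f ` lower_triangle b)"
    using assms by (intro compact_imp_bounded compact_continuous_image compact_lower_triangle)
  then obtain K where "\<forall>p\<in>lower_triangle b. norm (f p) \<le> K"
    by (auto simp: bounded_iff)
  with that[of "max K 0"] show ?thesis by fastforce
qed

lemma triangle_indicator_measurable:
  fixes f :: "real \<times> real \<Rightarrow> real"
  assumes "continuous_on (lower_triangle b) f"
  shows "(\<lambda>p. indicator (lower_triangle b) p * f p) \<in> borel_measurable (square_measure b)"
  by (rule borel_measurable_square_continuous[OF assms lower_triangle_borel])

lemma triangle_indicator_integrable:
  fixes f :: "real \<times> real \<Rightarrow> real"
  assumes "continuous_on (lower_triangle b) f"
  shows "integrable (square_measure b) (\<lambda>p. indicator (lower_triangle b) p * f p)"
proof -
  obtain K where "K \<ge> 0" "\<And>p. p \<in> lower_triangle b \<Longrightarrow> \<bar>f p\<bar> \<le> K"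
    using continuous_bounded_on_triangle[OF assms] by blast
  then show ?thesis
    by (intro integrable_square_bounded[where K=K] triangle_indicator_measurable assms)
       (auto simp: indicator_def)
qed

lemma divergence_triangle_closed:
  fixes F G f g :: "real \<times> real \<Rightarrow> real"
  assumes F: "continuous_on (lower_triangle b) F" and G: "continuous_on (lower_triangle b) G"
    and f: "continuous_on (lower_triangle b) f" and g: "continuous_on (lower_triangle b) g"
    and dF: "\<And>x y. (x, y) \<in> open_triangle b \<Longrightarrow> ((\<lambda>s. F (s, y)) has_real_derivative f (x, y)) (at x)"
    and dG: "\<And>x y. (x, y) \<in> open_triangle b \<Longrightarrow> ((\<lambda>s. G (x, s)) has_real_derivative g (x, y)) (at y)"
  shows "(LINT p|square_measure b. indicator (lower_triangle b) p * (f p + g p)) =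
    (LINT y|interval_measure b. F (b, y) - F (y, y)) + (LINT x|interval_measure b. G (x, x) - G (x, 0))"
proof -
  note int_f = triangle_indicator_integrable[OF f] and int_g = triangle_indicator_integrable[OF g]
  have slice_f: "(LINT x|interval_measure b. indicator (lower_triangle b) (x, y) * f (x, y)) = F (b, y) - F (y, y)"
    if y: "0 < y" "y < b" for y
  proof -
    have cont: "continuous_on {y..b} (\<lambda>x. h (x, y))" if "continuous_on (lower_triangle b) h" for h :: "real \<times> real \<Rightarrow> real"
      by (rule continuous_on_compose2[OF that]) (use y in \<open>auto intro!: continuous_intros simp: lower_triangle_def\<close>)
    have "(LINT x|interval_measure b. indicator (lower_triangle b) (x, y) * f (x, y)) = (LINT x:{y..<b}|lborel. f (x, y))"
      unfolding integral_interval_measure set_lebesgue_integral_def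
      by (rule Bochner_Integration.integral_cong) (use y in \<open>auto simp: indicator_def lower_triangle_def\<close>)
    also have "\<dots> = F (b, y) - F (y, y)"
    proof (rule fundamental_theorem_Lebesgue[where E="{}" and u="\<lambda>x. F (x, y)"])
      show "set_integrable lborel {y..<b} (\<lambda>x. f (x, y))"
        by (rule set_integrable_subset[OF borel_integrable_atLeastAtMost'[OF cont[OF f]]]) auto
      show "((\<lambda>x. F (x, y)) has_real_derivative f (x, y)) (at x)" if "y < x" "x < b" for x
        using dF[of x y] that y by (auto simp: open_triangle_def)
    qed (use y cont[OF F] in auto)
    finally show ?thesis .
  qed
  have slice_g: "(LINT y|interval_measure b. indicator (lower_triangle b) (x, y) * g (x, y)) = G (x, x) - G (x, 0)"
    if x: "0 < x" "x < b" for x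
  proof -
    have cont: "continuous_on {0..x} (\<lambda>y. h (x, y))" if "continuous_on (lower_triangle b) h" for h :: "real \<times> real \<Rightarrow> real"
      by (rule continuous_on_compose2[OF that]) (use x in \<open>auto intro!: continuous_intros simp: lower_triangle_def\<close>)
    have "(LINT y|interval_measure b. indicator (lower_triangle b) (x, y) * g (x, y)) = (LINT y:{0<..x}|lborel. g (x, y))"
      unfolding integral_interval_measure set_lebesgue_integral_def
      by (rule Bochner_Integration.integral_cong) (use x in \<open>auto simp: indicator_def lower_triangle_def\<close>)
    also have "\<dots> = G (x, x) - G (x, 0)"
    proof (rule fundamental_theorem_Lebesgue[where E="{}" and u="\<lambda>y. G (x, y)"])
      show "set_integrable lborel {0<..x} (\<lambda>y. g (x, y))"
        by (rule set_integrable_subset[OF borel_integrable_atLeastAtMost'[OF cont[OF g]]]) auto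
      show "((\<lambda>y. G (x, y)) has_real_derivative g (x, y)) (at y)" if "0 < y" "y < x" for y
        using dG[of x y] that x by (auto simp: open_triangle_def)
    qed (use x cont[OF G] in auto)
    finally show ?thesis .
  qed
  have "(LINT p|square_measure b. indicator (lower_triangle b) p * (f p + g p)) =
    (LINT p|square_measure b. indicator (lower_triangle b) p * f p) + (LINT p|square_measure b. indicator (lower_triangle b) p * g p)"
    using int_f int_g by (simp add: algebra_simps)
  also have "(LINT p|square_measure b. indicator (lower_triangle b) p * f p) = (LINT y|interval_measure b. F (b, y) - F (y, y))"
    unfolding integral_square_snd[OF int_f, symmetric]
    by (rule Bochner_Integration.integral_cong) (auto simp: slice_f)
  also have "(LINT p|square_measure b. indicator (lower_triangle b) p * g p) = (LINT x|interval_measure b. G (x, x) - G (x, 0))"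
    unfolding integral_square_fst[OF int_g, symmetric]
    by (rule Bochner_Integration.integral_cong) (auto simp: slice_g)
  finally show ?thesis .
qed

text \<open>Contraction with factor \<open>r\<close> towards the centroid of the triangle.\<close>

definition shrink :: "real \<Rightarrow> real \<Rightarrow> real \<times> real \<Rightarrow> real \<times> real" where
  "shrink b r p = ((1 - r) * (2 * b / 3) + r * fst p, (1 - r) * (b / 3) + r * snd p)"

lemma shrink_in_open_triangle:
  assumes "0 < b" "0 \<le> r" "r < 1" "p \<in> lower_triangle b"
  shows "shrink b r p \<in> open_triangle b"
proof -
  obtain x y where p: "p = (x, y)" "0 \<le> y" "y \<le> x" "x \<le> b"
    using assms(4) by (auto simp: lower_triangle_def)
  have "0 < (1 - r) * b" using assms by simp
  moreover have "0 \<le> r * y" "r * y \<le> r * x" "r * x \<le> r * b"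
    using assms p by (auto intro: mult_left_mono)
  moreover have "r * b < b" using assms by simp
  ultimately show ?thesis
    by (simp add: shrink_def open_triangle_def p(1) field_simps)
qed

lemma open_triangle_subset_lower: "open_triangle b \<subseteq> lower_triangle b"
  by (auto simp: open_triangle_def lower_triangle_def)

lemma continuous_shrink: "continuous_on S (shrink b r)"
  unfolding shrink_def by (intro continuous_intros)

text \<open>The divergence theorem on the triangle for a field that is continuous up to the boundary but
  continuously differentiable only inside, with a divergence that extends continuously. The field is
  first shrunk towards the centroid, which makes it smooth up to the boundary.\<close>

lemma divergence_triangle:
  fixes F G H f g :: "real \<times> real \<Rightarrow> real"
  assumes b: "0 < b"
    and F: "continuous_on (lower_triangle b) F" and G: "continuous_on (lower_triangle b) G"
    and H: "continuous_on (lower_triangle b) H"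
    and f: "continuous_on (open_triangle b) f" and g: "continuous_on (open_triangle b) g"
    and dF: "\<And>x y. (x, y) \<in> open_triangle b \<Longrightarrow> ((\<lambda>s. F (s, y)) has_real_derivative f (x, y)) (at x)"
    and dG: "\<And>x y. (x, y) \<in> open_triangle b \<Longrightarrow> ((\<lambda>s. G (x, s)) has_real_derivative g (x, y)) (at y)"
    and div: "\<And>p. p \<in> open_triangle b \<Longrightarrow> f p + g p = H p"
  shows "(LINT p|square_measure b. indicator (lower_triangle b) p * H p) =
    (LINT y|interval_measure b. F (b, y) - F (y, y)) + (LINT x|interval_measure b. G (x, x) - G (x, 0))"
proof -
  \<comment> \<open>contraction factors below \<open>1\<close> that tend to \<open>1\<close>\<close>
  define r :: "nat \<Rightarrow> real" where "r k = 1 - inverse (real (Suc k))" for k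
  have r01: "0 \<le> r k" "r k < 1" for k
    by (auto simp: r_def inverse_le_1_iff)
  have r_lim: "r \<longlonglongrightarrow> 1"
    unfolding r_def using tendsto_diff[OF tendsto_const LIMSEQ_inverse_real_of_nat, of 1] by simp
  define \<sigma> where "\<sigma> k = shrink b (r k)" for k
  have \<sigma>_mem: "\<sigma> k p \<in> open_triangle b" "\<sigma> k p \<in> lower_triangle b" if "p \<in> lower_triangle b" for k p
    using shrink_in_open_triangle[OF b r01 that] open_triangle_subset_lower by (auto simp: \<sigma>_def)
  have \<sigma>_lim: "(\<lambda>k. \<sigma> k p) \<longlonglongrightarrow> p" for p
  proof -
    have "(\<lambda>k. shrink b (r k) p) \<longlonglongrightarrow> ((1 - 1) * (2 * b / 3) + 1 * fst p, (1 - 1) * (b / 3) + 1 * snd p)"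
      unfolding shrink_def by (intro tendsto_intros r_lim)
    then show ?thesis by (simp add: \<sigma>_def)
  qed
  have comp: "continuous_on (lower_triangle b) (\<lambda>p. h (\<sigma> k p))"
    if "continuous_on (lower_triangle b) h \<or> continuous_on (open_triangle b) h" for h :: "real \<times> real \<Rightarrow> real" and k
    using that
  proof
    assume "continuous_on (lower_triangle b) h"
    then show ?thesis
      by (rule continuous_on_compose2) (use \<sigma>_mem in \<open>auto simp: \<sigma>_def intro: continuous_shrink\<close>)
  next
    assume "continuous_on (open_triangle b) h"
    then show ?thesis
      by (rule continuous_on_compose2) (use \<sigma>_mem in \<open>auto simp: \<sigma>_def intro: continuous_shrink\<close>)
  qed
  have lim: "(\<lambda>k. h (\<sigma> k p)) \<longlonglongrightarrow> h p"
    if "continuous_on (lower_triangle b) h" "p \<in> lower_triangle b" for h :: "real \<times> real \<Rightarrow> real" and p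
    by (rule continuous_on_tendsto_compose[OF that(1) \<sigma>_lim that(2)]) (simp add: \<sigma>_mem that)
  have smooth: "(LINT p|square_measure b. indicator (lower_triangle b) p * (r k * H (\<sigma> k p))) =
      (LINT y|interval_measure b. F (\<sigma> k (b, y)) - F (\<sigma> k (y, y))) + (LINT x|interval_measure b. G (\<sigma> k (x, x)) - G (\<sigma> k (x, 0)))" for k
  proof -
    have "(LINT p|square_measure b. indicator (lower_triangle b) p * (r k * H (\<sigma> k p))) =
      (LINT p|square_measure b. indicator (lower_triangle b) p * (r k * f (\<sigma> k p) + r k * g (\<sigma> k p)))"
      by (rule Bochner_Integration.integral_cong)
         (auto simp: indicator_def div[OF \<sigma>_mem(1), symmetric] distrib_left)
    also have "\<dots> = (LINT y|interval_measure b. F (\<sigma> k (b, y)) - F (\<sigma> k (y, y))) + (LINT x|interval_measure b. G (\<sigma> k (x, x)) - G (\<sigma> k (x, 0)))"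
    proof (rule divergence_triangle_closed[where F="\<lambda>p. F (\<sigma> k p)" and G="\<lambda>p. G (\<sigma> k p)"])
      fix x y assume "(x, y) \<in> open_triangle b"
      then have mem: "\<sigma> k (x, y) \<in> open_triangle b"
        using \<sigma>_mem open_triangle_subset_lower by blast
      define X Y where "X s = (1 - r k) * (2 * b / 3) + r k * s" and "Y s = (1 - r k) * (b / 3) + r k * s" for s
      have \<sigma>_eq: "\<sigma> k (s, t) = (X s, Y t)" for s t
        by (simp add: \<sigma>_def shrink_def X_def Y_def)
      have dX: "(X has_real_derivative r k) (at x)" and dY: "(Y has_real_derivative r k) (at y)"
        unfolding X_def Y_def by (auto intro!: derivative_eq_intros)
      show "((\<lambda>s. F (\<sigma> k (s, y))) has_real_derivative r k * f (\<sigma> k (x, y))) (at x)"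
        using DERIV_chain2[OF dF[of "X x" "Y y"] dX] mem by (simp add: \<sigma>_eq mult.commute)
      show "((\<lambda>s. G (\<sigma> k (x, s))) has_real_derivative r k * g (\<sigma> k (x, y))) (at y)"
        using DERIV_chain2[OF dG[of "X x" "Y y"] dY] mem by (simp add: \<sigma>_eq mult.commute)
    qed (use F G f g in \<open>auto intro!: comp continuous_intros\<close>)
    finally show ?thesis .
  qed
  have "(\<lambda>k. LINT p|square_measure b. indicator (lower_triangle b) p * (r k * H (\<sigma> k p))) \<longlonglongrightarrow>
      (LINT p|square_measure b. indicator (lower_triangle b) p * H p)"
  proof -
    obtain K where K: "K \<ge> 0" "\<And>p. p \<in> lower_triangle b \<Longrightarrow> \<bar>H p\<bar> \<le> K"
      using continuous_bounded_on_triangle[OF H] by blast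
    show ?thesis
    proof (rule integral_dominated_convergence[where w="\<lambda>_. K"])
      show "(\<lambda>p. indicator (lower_triangle b) p * H p) \<in> borel_measurable (square_measure b)"
        by (rule triangle_indicator_measurable[OF H])
      show "(\<lambda>p. indicator (lower_triangle b) p * (r k * H (\<sigma> k p))) \<in> borel_measurable (square_measure b)" for k
        using H by (intro triangle_indicator_measurable continuous_intros comp) auto
      show "AE p in square_measure b. (\<lambda>k. indicator (lower_triangle b) p * (r k * H (\<sigma> k p))) \<longlonglongrightarrow> indicator (lower_triangle b) p * H p"
      proof (rule AE_I2)
        fix p
        show "(\<lambda>k. indicator (lower_triangle b) p * (r k * H (\<sigma> k p))) \<longlonglongrightarrow> indicator (lower_triangle b) p * H p"
        proof (cases "p \<in> lower_triangle b")
          case True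
          from tendsto_mult[OF r_lim lim[OF H True]] True show ?thesis by simp
        qed simp
      qed
      show "AE p in square_measure b. norm (indicator (lower_triangle b) p * (r k * H (\<sigma> k p))) \<le> K" for k
      proof (rule AE_I2)
        fix p
        have "\<bar>r k * H (\<sigma> k p)\<bar> \<le> 1 * K" if "p \<in> lower_triangle b"
          unfolding abs_mult using r01[of k] K \<sigma>_mem(2)[OF that] by (intro mult_mono) auto
        then show "norm (indicator (lower_triangle b) p * (r k * H (\<sigma> k p))) \<le> K"
          using K by (auto simp: indicator_def)
      qed
    qed simp
  qed
  moreover have edge: "(\<lambda>k. LINT y|interval_measure b. h (\<sigma> k (a y)) - h (\<sigma> k (c y))) \<longlonglongrightarrow>
      (LINT y|interval_measure b. h (a y) - h (c y))"
    if h: "continuous_on (lower_triangle b) h" and a: "continuous_on {0..b} a" "\<And>y. y \<in> {0..b} \<Longrightarrow> a y \<in> lower_triangle b"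
      and c: "continuous_on {0..b} c" "\<And>y. y \<in> {0..b} \<Longrightarrow> c y \<in> lower_triangle b"
    for h :: "real \<times> real \<Rightarrow> real" and a c
  proof -
    obtain K where K: "K \<ge> 0" "\<And>p. p \<in> lower_triangle b \<Longrightarrow> \<bar>h p\<bar> \<le> K"
      using continuous_bounded_on_triangle[OF h] by blast
    have cont: "continuous_on {0..b} (\<lambda>y. j (a y) - j (c y))" if "continuous_on (lower_triangle b) j" for j :: "real \<times> real \<Rightarrow> real"
      using a c by (intro continuous_intros continuous_on_compose2[OF that]) auto
    show ?thesis
    proof (rule integral_dominated_convergence[where w="\<lambda>_. 2 * K"])
      show "(\<lambda>y. h (a y) - h (c y)) \<in> borel_measurable (interval_measure b)"
        by (intro borel_measurable_interval_continuous cont h)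
      show "(\<lambda>y. h (\<sigma> k (a y)) - h (\<sigma> k (c y))) \<in> borel_measurable (interval_measure b)" for k
        by (intro borel_measurable_interval_continuous cont comp disjI1 h)
      show "AE y in interval_measure b. (\<lambda>k. h (\<sigma> k (a y)) - h (\<sigma> k (c y))) \<longlonglongrightarrow> h (a y) - h (c y)"
        by (rule AE_I2) (auto intro!: tendsto_diff lim h a c)
      show "AE y in interval_measure b. norm (h (\<sigma> k (a y)) - h (\<sigma> k (c y))) \<le> 2 * K" for k
      proof (rule AE_I2)
        fix y assume "y \<in> space (interval_measure b)"
        then have "\<bar>h (\<sigma> k (a y))\<bar> \<le> K" "\<bar>h (\<sigma> k (c y))\<bar> \<le> K"
          by (auto intro!: K \<sigma>_mem a c)
        then show "norm (h (\<sigma> k (a y)) - h (\<sigma> k (c y))) \<le> 2 * K" by simp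
      qed
    qed simp
  qed
  have "(\<lambda>k. (LINT y|interval_measure b. F (\<sigma> k (b, y)) - F (\<sigma> k (y, y))) + (LINT x|interval_measure b. G (\<sigma> k (x, x)) - G (\<sigma> k (x, 0))))
    \<longlonglongrightarrow> (LINT y|interval_measure b. F (b, y) - F (y, y)) + (LINT x|interval_measure b. G (x, x) - G (x, 0))"
    by (intro tendsto_add edge F G)
       (auto intro!: continuous_intros simp: lower_triangle_def)
  ultimately show ?thesis
    unfolding smooth using LIMSEQ_unique by blast
qed

section \<open>The Lyapunov form\<close>

text \<open>The symmetric bilinear form on the state space with kernel \<open>(P, Q, T)\<close>.\<close>

definition lyapunov_form ::
  "real \<Rightarrow> real^'n^'n \<Rightarrow> (real \<Rightarrow> real^'n) \<Rightarrow> (real \<times> real \<Rightarrow> real) \<Rightarrow> ('n::finite) state \<Rightarrow> 'n state \<Rightarrow> real" where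
  "lyapunov_form b P Q T h g =
     fst h \<bullet> (P *v fst g) + (LINT \<theta>|interval_measure b. (fst h \<bullet> Q \<theta>) * snd g \<theta>)
     + (LINT \<theta>|interval_measure b. (fst g \<bullet> Q \<theta>) * snd h \<theta>)
     + (LINT \<theta>1|interval_measure b. LINT \<theta>2|interval_measure b. snd h \<theta>1 * T (\<theta>1, \<theta>2) * snd g \<theta>2)"

text \<open>What makes \<open>V\<close> a bounded symmetric bilinear form on the state space: continuity of \<open>Q\<close> and of
  \<open>T\<close> on the closed square, and symmetry of \<open>P\<close> and \<open>T\<close>.\<close>

locale lyapunov_kernel =
  fixes b :: real and P :: "real^'n^'n" and Q :: "real \<Rightarrow> real^'n" and T :: "real \<times> real \<Rightarrow> real"
  assumes b_pos: "0 < b" and P_sym: "transpose P = P"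
    and Q_cont: "continuous_on {0..b} Q"
    and T_cont: "continuous_on ({0..b} \<times> {0..b}) T"
    and T_sym: "\<forall>\<theta>1\<in>{0..b}. \<forall>\<theta>2\<in>{0..b}. T (\<theta>1, \<theta>2) = T (\<theta>2, \<theta>1)"
begin

abbreviation V :: "('n::finite) state \<Rightarrow> 'n state \<Rightarrow> real" where
  "V \<equiv> lyapunov_form b P Q T"

lemma T_measurable: "T \<in> borel_measurable (square_measure b)"
proof -
  have "closed ({0..b} \<times> {0..b})" by (intro closed_Times) auto
  then have "(\<lambda>p. indicator ({0..b} \<times> {0..b}) p * T p) \<in> borel_measurable (square_measure b)"
    by (intro borel_measurable_square_continuous T_cont) auto
  then show ?thesis
    by (rule measurable_cong[THEN iffD1, rotated]) (auto simp: space_pair_measure indicator_def)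
qed

lemma T_bounded: "\<exists>K\<ge>0. \<forall>x\<in>{0..b}. \<forall>y\<in>{0..b}. \<bar>T (x, y)\<bar> \<le> K"
proof -
  have "bounded (T ` ({0..b} \<times> {0..b}))"
    by (intro compact_imp_bounded compact_continuous_image T_cont compact_Times) auto
  then obtain K where K: "\<And>p. p \<in> {0..b} \<times> {0..b} \<Longrightarrow> norm (T p) \<le> K"
    by (auto simp: bounded_iff)
  have "\<bar>T (x, y)\<bar> \<le> max K 0" if "x \<in> {0..b}" "y \<in> {0..b}" for x y
    using K[of "(x, y)"] that by (auto simp: max_def)
  then show ?thesis by (intro exI[of _ "max K 0"]) auto
qed

lemma kernel_integrable:
  assumes "z \<in> L2 b" "y \<in> L2 b"
  shows "integrable (square_measure b) (\<lambda>p. z (fst p) * T p * y (snd p))"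
proof -
  obtain K where "K \<ge> 0" and "\<And>x y. x \<in> {0..b} \<Longrightarrow> y \<in> {0..b} \<Longrightarrow> \<bar>T (x, y)\<bar> \<le> K"
    using T_bounded by blast
  then show ?thesis
    by (intro integrable_square_kernel[where K=K] L2_integrable assms T_measurable) auto
qed

lemma Q_integrable:
  assumes "z \<in> L2 b"
  shows "integrable (interval_measure b) (\<lambda>\<theta>. (x \<bullet> Q \<theta>) * z \<theta>)"
  by (intro L2_mult_integrable assms L2_continuous continuous_intros Q_cont)

lemma lyapunov_form_lin_comb_left:
  assumes "h \<in> state_space b" "g \<in> state_space b" "k \<in> state_space b"
  shows "V (lin_comb r h s g) k = r * V h k + s * V g k"
proof -
  note L2 = assms[THEN state_spaceD]
  note i1 = kernel_integrable[OF L2(1,3)] and i2 = kernel_integrable[OF L2(2,3)]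
  have i3: "integrable (square_measure b) (\<lambda>p. (r * snd h (fst p) + s * snd g (fst p)) * T p * snd k (snd p))"
    by (rule kernel_integrable[OF L2_lin_comb[OF L2(1,2)] L2(3)])
  have "(LINT \<theta>|interval_measure b. ((r *\<^sub>R fst h + s *\<^sub>R fst g) \<bullet> Q \<theta>) * snd k \<theta>) =
    (LINT \<theta>|interval_measure b. r * ((fst h \<bullet> Q \<theta>) * snd k \<theta>) + s * ((fst g \<bullet> Q \<theta>) * snd k \<theta>))"
    by (simp add: inner_add_left algebra_simps)
  also have "\<dots> = r * (LINT \<theta>|interval_measure b. (fst h \<bullet> Q \<theta>) * snd k \<theta>) + s * (LINT \<theta>|interval_measure b. (fst g \<bullet> Q \<theta>) * snd k \<theta>)"
    using Q_integrable[OF L2(3)] by simp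
  finally have 1: "(LINT \<theta>|interval_measure b. ((r *\<^sub>R fst h + s *\<^sub>R fst g) \<bullet> Q \<theta>) * snd k \<theta>) = \<dots>" .
  have "(LINT \<theta>|interval_measure b. (fst k \<bullet> Q \<theta>) * (r * snd h \<theta> + s * snd g \<theta>)) =
    (LINT \<theta>|interval_measure b. r * ((fst k \<bullet> Q \<theta>) * snd h \<theta>) + s * ((fst k \<bullet> Q \<theta>) * snd g \<theta>))"
    by (simp add: algebra_simps)
  also have "\<dots> = r * (LINT \<theta>|interval_measure b. (fst k \<bullet> Q \<theta>) * snd h \<theta>) + s * (LINT \<theta>|interval_measure b. (fst k \<bullet> Q \<theta>) * snd g \<theta>)"
    using Q_integrable[OF L2(1)] Q_integrable[OF L2(2)] by simp
  finally have 2: "(LINT \<theta>|interval_measure b. (fst k \<bullet> Q \<theta>) * (r * snd h \<theta> + s * snd g \<theta>)) = \<dots>" .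
  have "(LINT p|square_measure b. (r * snd h (fst p) + s * snd g (fst p)) * T p * snd k (snd p)) =
    (LINT p|square_measure b. r * (snd h (fst p) * T p * snd k (snd p)) + s * (snd g (fst p) * T p * snd k (snd p)))"
    by (simp add: algebra_simps)
  also have "\<dots> = r * (LINT p|square_measure b. snd h (fst p) * T p * snd k (snd p)) + s * (LINT p|square_measure b. snd g (fst p) * T p * snd k (snd p))"
    using i1 i2 by simp
  finally have 3: "(LINT \<theta>1|interval_measure b. LINT \<theta>2|interval_measure b. (r * snd h \<theta>1 + s * snd g \<theta>1) * T (\<theta>1, \<theta>2) * snd k \<theta>2) =
    r * (LINT \<theta>1|interval_measure b. LINT \<theta>2|interval_measure b. snd h \<theta>1 * T (\<theta>1, \<theta>2) * snd k \<theta>2) +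
    s * (LINT \<theta>1|interval_measure b. LINT \<theta>2|interval_measure b. snd g \<theta>1 * T (\<theta>1, \<theta>2) * snd k \<theta>2)"
    using integral_square_fst[OF i1] integral_square_fst[OF i2] integral_square_fst[OF i3] by simp
  show ?thesis
    unfolding lyapunov_form_def lin_comb_def fst_conv snd_conv 1 2 3
    by (simp add: inner_add_left algebra_simps)
qed

lemma lyapunov_form_commute:
  assumes "h \<in> state_space b" "g \<in> state_space b"
  shows "V h g = V g h"
proof -
  note L2 = assms[THEN state_spaceD]
  note i1 = kernel_integrable[OF L2] and i2 = kernel_integrable[OF L2(2,1)]
  have "(LINT p|square_measure b. snd g (fst p) * T p * snd h (snd p)) =
    (LINT p|square_measure b. snd g (snd p) * T (prod.swap p) * snd h (fst p))"
    using integral_square_swap[OF borel_measurable_integrable[OF i2]] by simp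
  also have "\<dots> = (LINT p|square_measure b. snd h (fst p) * T p * snd g (snd p))"
    by (rule Bochner_Integration.integral_cong) (use T_sym in \<open>auto simp: space_pair_measure\<close>)
  finally have "(LINT \<theta>1|interval_measure b. LINT \<theta>2|interval_measure b. snd g \<theta>1 * T (\<theta>1, \<theta>2) * snd h \<theta>2) =
    (LINT \<theta>1|interval_measure b. LINT \<theta>2|interval_measure b. snd h \<theta>1 * T (\<theta>1, \<theta>2) * snd g \<theta>2)"
    using integral_square_fst[OF i1] integral_square_fst[OF i2] by simp
  moreover have "fst h \<bullet> (P *v fst g) = fst g \<bullet> (P *v fst h)"
    by (metis P_sym dot_lmul_matrix inner_commute matrix_vector_mul_assoc transpose_matrix_vector)
  ultimately show ?thesis by (simp add: lyapunov_form_def)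
qed

lemma lyapunov_form_bounded:
  "\<exists>K\<ge>0. \<forall>h\<in>state_space b. \<forall>g\<in>state_space b. \<bar>V h g\<bar> \<le> K * (state_norm b h * state_norm b g)"
proof -
  obtain KP where KP: "0 < KP" "\<And>x. norm (P *v x) \<le> norm x * KP"
    using bounded_linear.pos_bounded[OF matrix_vector_mul_bounded_linear[of P]] by blast
  obtain KQ where KQ: "KQ \<ge> 0" "\<And>\<theta>. \<theta> \<in> {0..b} \<Longrightarrow> norm (Q \<theta>) \<le> KQ"
    using continuous_bounded_on_interval[OF Q_cont] by blast
  obtain KT where KT: "KT \<ge> 0" "\<And>x y. x \<in> {0..b} \<Longrightarrow> y \<in> {0..b} \<Longrightarrow> \<bar>T (x, y)\<bar> \<le> KT"
    using T_bounded by blast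
  have norm_fst: "norm (fst h) \<le> state_norm b h" for h :: "'n state"
  proof (rule power2_le_imp_le)
    show "(norm (fst h))\<^sup>2 \<le> (state_norm b h)\<^sup>2"
      by (simp add: state_norm_power2 state_inner_def power2_norm_eq_inner)
  qed simp
  have L1: "(LINT \<theta>|interval_measure b. \<bar>snd h \<theta>\<bar>) \<le> sqrt b * state_norm b h" if "h \<in> state_space b" for h :: "'n state"
    using L1_le_state_norm[OF state_spaceD[OF that], of "fst h"] b_pos by simp
  have Q_bound: "\<bar>LINT \<theta>|interval_measure b. (fst h \<bullet> Q \<theta>) * snd g \<theta>\<bar> \<le> KQ * sqrt b * (state_norm b h * state_norm b g)"
    if "g \<in> state_space b" for h g :: "'n state"
  proof -
    have "\<bar>LINT \<theta>|interval_measure b. (fst h \<bullet> Q \<theta>) * snd g \<theta>\<bar> \<le> (LINT \<theta>|interval_measure b. \<bar>(fst h \<bullet> Q \<theta>) * snd g \<theta>\<bar>)"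
      by (rule integral_abs_bound)
    also have "\<dots> \<le> (LINT \<theta>|interval_measure b. (norm (fst h) * KQ) * \<bar>snd g \<theta>\<bar>)"
    proof (rule integral_mono)
      fix \<theta> assume "\<theta> \<in> space (interval_measure b)"
      then have "\<bar>fst h \<bullet> Q \<theta>\<bar> \<le> norm (fst h) * KQ"
        by (intro order_trans[OF Cauchy_Schwarz_ineq2] mult_left_mono KQ) auto
      then show "\<bar>(fst h \<bullet> Q \<theta>) * snd g \<theta>\<bar> \<le> (norm (fst h) * KQ) * \<bar>snd g \<theta>\<bar>"
        unfolding abs_mult by (rule mult_right_mono) simp
    next
      show "integrable (interval_measure b) (\<lambda>\<theta>. \<bar>(fst h \<bullet> Q \<theta>) * snd g \<theta>\<bar>)"
        by (intro integrable_abs Q_integrable state_spaceD that)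
      show "integrable (interval_measure b) (\<lambda>\<theta>. norm (fst h) * KQ * \<bar>snd g \<theta>\<bar>)"
        by (intro integrable_mult_right integrable_abs L2_integrable state_spaceD that)
    qed
    also have "\<dots> = (norm (fst h) * KQ) * (LINT \<theta>|interval_measure b. \<bar>snd g \<theta>\<bar>)"
      by simp
    also have "\<dots> \<le> (state_norm b h * KQ) * (sqrt b * state_norm b g)"
      by (intro mult_mono norm_fst L1 that) (auto simp: KQ)
    finally show ?thesis by (simp add: algebra_simps)
  qed
  have T_bound: "\<bar>LINT \<theta>1|interval_measure b. LINT \<theta>2|interval_measure b. snd h \<theta>1 * T (\<theta>1, \<theta>2) * snd g \<theta>2\<bar>
      \<le> KT * b * (state_norm b h * state_norm b g)"
    if "h \<in> state_space b" "g \<in> state_space b" for h g :: "'n state"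
  proof -
    note L2 = that[THEN state_spaceD]
    note i = kernel_integrable[OF L2]
    note j = integrable_square_tensor[OF integrable_abs[OF L2_integrable[OF L2(1)]] integrable_abs[OF L2_integrable[OF L2(2)]]]
    have "\<bar>LINT \<theta>1|interval_measure b. LINT \<theta>2|interval_measure b. snd h \<theta>1 * T (\<theta>1, \<theta>2) * snd g \<theta>2\<bar>
        = \<bar>LINT p|square_measure b. snd h (fst p) * T p * snd g (snd p)\<bar>"
      using integral_square_fst[OF i] by simp
    also have "\<dots> \<le> (LINT p|square_measure b. \<bar>snd h (fst p) * T p * snd g (snd p)\<bar>)"
      by (rule integral_abs_bound)
    also have "\<dots> \<le> (LINT p|square_measure b. KT * (\<bar>snd h (fst p)\<bar> * \<bar>snd g (snd p)\<bar>))"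
    proof (rule integral_mono)
      fix p assume "p \<in> space (square_measure b)"
      then have "\<bar>T p\<bar> \<le> KT"
        using KT(2)[of "fst p" "snd p"] by (auto simp: space_pair_measure)
      then have "\<bar>T p\<bar> * (\<bar>snd h (fst p)\<bar> * \<bar>snd g (snd p)\<bar>) \<le> KT * (\<bar>snd h (fst p)\<bar> * \<bar>snd g (snd p)\<bar>)"
        by (rule mult_right_mono) simp
      then show "\<bar>snd h (fst p) * T p * snd g (snd p)\<bar> \<le> KT * (\<bar>snd h (fst p)\<bar> * \<bar>snd g (snd p)\<bar>)"
        by (simp add: abs_mult algebra_simps)
    qed (use i j in auto)
    also have "\<dots> = KT * (LINT x|interval_measure b. LINT y|interval_measure b. \<bar>snd h x\<bar> * \<bar>snd g y\<bar>)"
      using integral_square_fst[OF j] by simp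
    also have "\<dots> = KT * ((LINT x|interval_measure b. \<bar>snd h x\<bar>) * (LINT y|interval_measure b. \<bar>snd g y\<bar>))"
      by simp
    also have "\<dots> \<le> KT * ((sqrt b * state_norm b h) * (sqrt b * state_norm b g))"
      using b_pos by (intro mult_left_mono mult_mono L1 that KT) auto
    also have "\<dots> = KT * b * (state_norm b h * state_norm b g)"
    proof -
      have "sqrt b * sqrt b = b" using b_pos by simp
      then show ?thesis by (simp add: mult_ac)
    qed
    finally show ?thesis .
  qed
  show ?thesis
  proof (intro exI[of _ "KP + 2 * (KQ * sqrt b) + KT * b"] conjI ballI)
    show "KP + 2 * (KQ * sqrt b) + KT * b \<ge> 0" using KP KQ KT b_pos by simp
    fix h g :: "'n state" assume hg: "h \<in> state_space b" "g \<in> state_space b"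
    have "\<bar>fst h \<bullet> (P *v fst g)\<bar> \<le> norm (fst h) * (norm (fst g) * KP)"
      by (rule order_trans[OF Cauchy_Schwarz_ineq2]) (intro mult_left_mono KP, simp)
    also have "\<dots> \<le> state_norm b h * (state_norm b g * KP)"
      using KP by (intro mult_mono norm_fst) auto
    finally have "\<bar>fst h \<bullet> (P *v fst g)\<bar> \<le> KP * (state_norm b h * state_norm b g)"
      by (simp add: mult_ac)
    moreover note Q_bound[OF hg(2), of h] T_bound[OF hg]
    moreover have "\<bar>LINT \<theta>|interval_measure b. (fst g \<bullet> Q \<theta>) * snd h \<theta>\<bar> \<le> KQ * sqrt b * (state_norm b h * state_norm b g)"
      using Q_bound[OF hg(1), of g] by (simp add: mult.commute)
    moreover have "(KP + 2 * (KQ * sqrt b) + KT * b) * n = KP * n + KQ * sqrt b * n + KQ * sqrt b * n + KT * b * n" for n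
      by (simp add: algebra_simps)
    note this[of "state_norm b h * state_norm b g"]
    ultimately show "\<bar>V h g\<bar> \<le> (KP + 2 * (KQ * sqrt b) + KT * b) * (state_norm b h * state_norm b g)"
      unfolding lyapunov_form_def by linarith
  qed
qed

lemma lyapunov_form_cong_left:
  assumes "state_eq b h h'" "h \<in> state_space b" "h' \<in> state_space b" "g \<in> state_space b"
  shows "V h g = V h' g"
proof -
  obtain K where "K \<ge> 0"
    and K: "\<And>h g. h \<in> state_space b \<Longrightarrow> g \<in> state_space b \<Longrightarrow> \<bar>V h g\<bar> \<le> K * (state_norm b h * state_norm b g)"
    using lyapunov_form_bounded by blast
  have "state_norm b (lin_comb 1 h (-1) h') = state_norm b (lin_comb 1 h' (-1) h')"
    using assms by (intro state_norm_cong_eq state_eq_lin_comb lin_comb_state_space) auto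
  also have "(state_norm b (lin_comb 1 h' (-1) h'))\<^sup>2 = 0"
    using state_norm_lin_comb_power2[OF assms(3,3), of 1 "-1"] by (simp add: state_norm_power2)
  then have "state_norm b (lin_comb 1 h' (-1) h') = 0" by simp
  finally have "\<bar>V (lin_comb 1 h (-1) h') g\<bar> \<le> 0"
    using K[of "lin_comb 1 h (-1) h'" g] assms by auto
  then show ?thesis
    using lyapunov_form_lin_comb_left[OF assms(2,3,4), of 1 "-1"] by simp
qed

lemma lyapunov_form_cong:
  assumes "state_eq b h h'" "state_eq b g g'"
    "h \<in> state_space b" "h' \<in> state_space b" "g \<in> state_space b" "g' \<in> state_space b"
  shows "V h g = V h' g'"
proof -
  have "V h g = V h' g" by (rule lyapunov_form_cong_left) fact+
  also have "\<dots> = V g h'" by (rule lyapunov_form_commute) fact+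
  also have "\<dots> = V g' h'" by (rule lyapunov_form_cong_left) fact+
  also have "\<dots> = V h' g'" by (rule lyapunov_form_commute) fact+
  finally show ?thesis .
qed

end

section \<open>Derivatives in the domain of the operator and on the triangle\<close>

lemma primitive_on_continuous:
  assumes "primitive_on b u u'"
  shows "continuous_on {0..b} u"
proof -
  have int: "set_integrable lborel {0<..<b} u'"
    using assms by (simp add: primitive_on_def integrable_interval_measure)
  then have "u' integrable_on {0<..<b}"
    by (rule set_borel_integral_eq_integral)
  then have "u' integrable_on {0..b}"
    by (simp add: integrable_on_open_interval_real)
  then have "continuous_on {0..b} (\<lambda>y. u 0 + integral {0..y} u')"
    by (intro continuous_intros indefinite_integral_continuous_1)
  moreover have "u 0 + integral {0..y} u' = u y" if "y \<in> {0..b}" for y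
  proof -
    have "set_integrable lborel {0<..<y} u'"
      by (rule set_integrable_subset[OF int]) (use that in auto)
    then have "(LINT s:{0<..<y}|lborel. u' s) = integral {0<..<y} u'"
      by (rule set_borel_integral_eq_integral)
    moreover have "u y = u 0 + (LINT s:{0<..<y}|lborel. u' s)"
      using assms that by (simp only: primitive_on_def)
    ultimately show ?thesis by (simp add: integral_open_interval_real)
  qed
  ultimately show ?thesis
    by (rule continuous_on_eq)
qed

lemma H2_primitives:
  assumes "H2_with_derivs b z z1 z2"
  shows "primitive_on b z1 z2" "continuous_on {0..b} z1" "primitive_on b z z1" "continuous_on {0..b} z"
    "\<And>x. 0 < x \<Longrightarrow> x < b \<Longrightarrow> (z has_real_derivative z1 x) (at x)"
proof -
  show 1: "primitive_on b z1 z2"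
    using assms L2_integrable unfolding H2_with_derivs_def primitive_on_def by blast
  then show 2: "continuous_on {0..b} z1" by (rule primitive_on_continuous)
  have der: "(z has_real_derivative z1 x) (at x within {0..b})" if "x \<in> {0..b}" for x
    using assms that unfolding H2_with_derivs_def by blast
  then show 3: "continuous_on {0..b} z"
    unfolding continuous_on_eq_continuous_within by (blast intro: DERIV_continuous)
  show 4: "(z has_real_derivative z1 x) (at x)" if "0 < x" "x < b" for x
    using der[of x] that by (simp add: at_within_Icc_at)
  show "primitive_on b z z1"
    by (rule primitive_onI[of "{}", OF _ 3 4 integrable_interval_continuous[OF 2]]) auto
qed

lemma partial1_slice:
  assumes "f differentiable (at (x, y) within S)" "(x, y) \<in> interior S"
  shows "((\<lambda>s. f (s, y)) has_real_derivative partial1 S f (x, y)) (at x)"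
proof -
  let ?D = "frechet_derivative f (at (x, y) within S)"
  have D: "(f has_derivative ?D) (at (x, y))"
    using assms frechet_derivative_works at_within_interior by metis
  have "((\<lambda>s. (s, y)) has_derivative (\<lambda>h. (h, 0))) (at x)"
    by (auto intro!: derivative_eq_intros)
  from has_derivative_compose[OF this D] have "((\<lambda>s. f (s, y)) has_derivative (\<lambda>h. ?D (h, 0))) (at x)" .
  moreover have "(\<lambda>h. ?D (h, 0)) = (\<lambda>h. partial1 S f (x, y) * h)"
  proof
    fix h :: real
    have "?D (h *\<^sub>R (1, 0)) = h *\<^sub>R ?D (1, 0)"
      by (rule linear_scale[OF has_derivative_linear[OF D]])
    then show "?D (h, 0) = partial1 S f (x, y) * h" by (simp add: partial1_def)
  qed
  ultimately show ?thesis by (simp add: has_field_derivative_def)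
qed

lemma partial2_slice:
  assumes "f differentiable (at (x, y) within S)" "(x, y) \<in> interior S"
  shows "((\<lambda>s. f (x, s)) has_real_derivative partial2 S f (x, y)) (at y)"
proof -
  let ?D = "frechet_derivative f (at (x, y) within S)"
  have D: "(f has_derivative ?D) (at (x, y))"
    using assms frechet_derivative_works at_within_interior by metis
  have "((\<lambda>s. (x, s)) has_derivative (\<lambda>h. (0, h))) (at y)"
    by (auto intro!: derivative_eq_intros)
  from has_derivative_compose[OF this D] have "((\<lambda>s. f (x, s)) has_derivative (\<lambda>h. ?D (0, h))) (at y)" .
  moreover have "(\<lambda>h. ?D (0, h)) = (\<lambda>h. partial2 S f (x, y) * h)"
  proof
    fix h :: real
    have "?D (h *\<^sub>R (0, 1)) = h *\<^sub>R ?D (0, 1)"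
      by (rule linear_scale[OF has_derivative_linear[OF D]])
    then show "?D (0, h) = partial2 S f (x, y) * h" by (simp add: partial2_def)
  qed
  ultimately show ?thesis by (simp add: has_field_derivative_def)
qed

lemma partial_on_interior:
  assumes "p \<in> interior S"
  shows "partial1 (interior S) f p = partial1 S f p" "partial2 (interior S) f p = partial2 S f p"
  using at_within_interior[OF assms] at_within_interior[of p "interior S"] assms
  by (simp_all add: partial1_def partial2_def)

lemma columnvector_vec: "(columnvector q :: real^1^'n) *v vec c = c *\<^sub>R q"
  by (simp add: vec_eq_iff matrix_vector_mult_def columnvector_def sum_1)

lemma single_column_mult: "B *v vec c = c *\<^sub>R column 1 B" for B :: "real^1^'n"
  by (simp add: vec_eq_iff matrix_vector_mult_def column_def sum_1)

lemma transpose_single_column_mult: "transpose B *v q = vec (column 1 B \<bullet> q)" for B :: "real^1^'n"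
  by (simp add: vec_eq_iff matrix_vector_mult_def column_def transpose_def inner_vec_def)

section \<open>Dissipation along the system operator\<close>

lemma continuous_on_union_triangles:
  assumes "continuous_on (lower_triangle b) T" "continuous_on (upper_triangle b) T"
  shows "continuous_on ({0..b} \<times> {0..b}) T"
proof -
  have sq: "{0..b} \<times> {0..b} = lower_triangle b \<union> upper_triangle b"
    by (auto simp: lower_triangle_def upper_triangle_def)
  have "upper_triangle b = ({0..b} \<times> {0..b}) \<inter> {p. fst p \<le> snd p}"
    by (auto simp: upper_triangle_def)
  moreover have "closed {p::real\<times>real. fst p \<le> snd p}"
    by (intro closed_Collect_le continuous_intros)
  ultimately have "closed (upper_triangle b)"
    by (auto intro!: closed_Int closed_Times)
  then show ?thesis
    unfolding sq using assms compact_imp_closed[OF compact_lower_triangle]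
    by (intro continuous_on_closed_Un) auto
qed

text \<open>A solution \<open>(P, Q, T)\<close> of the Lyapunov equations, with the regularity under which they are
  posed.\<close>

locale lyapunov_solution =
  fixes A P :: "real^'n^'n" and B :: "real^1^'n" and C :: "real^'n^1"
    and lam nu b w :: real
    and Q :: "real \<Rightarrow> real^'n" and T :: "real \<times> real \<Rightarrow> real"
  assumes nu: "nu > 0" and b: "b > 0" and w: "w > 0"
    and P_symmetric: "transpose P = P"
    and T_symmetric: "\<forall>\<theta>1\<in>{0..b}. \<forall>\<theta>2\<in>{0..b}. T (\<theta>1, \<theta>2) = T (\<theta>2, \<theta>1)"
    and Q_differentiable: "Q differentiable_on {0..b}"
    and Q'_differentiable: "deriv_on b Q differentiable_on {0..b}"
    and T_regular: "piecewise_regular b T"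
    and equations: "lyapunov_equations A B C lam nu b w P Q T"
begin

sublocale lyapunov_kernel b P Q T
proof
  show "continuous_on {0..b} Q"
    by (rule differentiable_imp_continuous_on[OF Q_differentiable])
  have "T differentiable_on lower_triangle b" "T differentiable_on upper_triangle b"
    using T_regular by (auto simp: piecewise_regular_def C1_on_def)
  then show "continuous_on ({0..b} \<times> {0..b}) T"
    by (intro continuous_on_union_triangles differentiable_imp_continuous_on)
qed (use b P_symmetric T_symmetric in auto)

abbreviation L :: "(real \<times> real) set" where "L \<equiv> lower_triangle b"

text \<open>The partial derivatives of \<open>T\<close> from within the triangle below the diagonal.\<close>

abbreviation p :: "real \<times> real \<Rightarrow> real" where "p \<equiv> partial1 L T"
abbreviation q :: "real \<times> real \<Rightarrow> real" where "q \<equiv> partial2 L T"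

lemma L_regular:
  "T differentiable_on L" "continuous_on L T" "continuous_on L p" "continuous_on L q"
  "p differentiable_on interior L" "q differentiable_on interior L"
  "continuous_on (interior L) (partial1 L p)" "continuous_on (interior L) (partial2 L q)"
proof -
  have *: "C1_on L T" "C1_on (interior L) p" "C1_on (interior L) q"
    using T_regular by (auto simp: piecewise_regular_def)
  then show "T differentiable_on L" "continuous_on L p" "continuous_on L q"
    "p differentiable_on interior L" "q differentiable_on interior L"
    by (auto simp: C1_on_def)
  then show "continuous_on L T" by (auto intro: differentiable_imp_continuous_on)
  show "continuous_on (interior L) (partial1 L p)"
    using *(2) unfolding C1_on_def by (auto intro: continuous_on_eq[where f="partial1 (interior L) p"] simp: partial_on_interior)
  show "continuous_on (interior L) (partial2 L q)"
    using *(3) unfolding C1_on_def by (auto intro: continuous_on_eq[where f="partial2 (interior L) q"] simp: partial_on_interior)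
qed

lemma Lyapunov_equation: "He (P ** A + nu *\<^sub>R (columnvector (deriv_on b Q 0) ** C)) = - mat 1"
  and Q_equation: "\<And>\<theta>. \<theta> \<in> {0..b} \<Longrightarrow>
     nu *\<^sub>R deriv_on b (deriv_on b Q) \<theta> + (transpose A + lam *\<^sub>R mat 1) *v Q \<theta>
        + nu *\<^sub>R (transpose C *v vec (partial1 (upper_triangle b) T (0, \<theta>))) = 0"
  and Q_boundary: "Q 0 = 0" "P ** B + nu *\<^sub>R columnvector (Q b) = 0"
  and T_Helmholtz_interior: "\<And>s. s \<in> interior L \<Longrightarrow> nu * partial1 L p s + nu * partial2 L q s + 2 * lam * T s = 0"
  and T_boundary: "\<And>\<theta>. \<theta> \<in> {0..b} \<Longrightarrow> T (\<theta>, 0) = 0"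
    "\<And>\<theta>. \<theta> \<in> {0..b} \<Longrightarrow> vec (nu * T (b, \<theta>)) + transpose B *v Q \<theta> = 0"
  and T_diagonal: "\<And>\<theta>. \<theta> \<in> {0..b} \<Longrightarrow> p (\<theta>, \<theta>) - q (\<theta>, \<theta>) = - (w / 2)"
  using equations unfolding lyapunov_equations_def by blast+

lemma T_slices:
  assumes "(x, y) \<in> open_triangle b"
  shows "((\<lambda>s. T (s, y)) has_real_derivative p (x, y)) (at x)"
    and "((\<lambda>s. T (x, s)) has_real_derivative q (x, y)) (at y)"
    and "((\<lambda>s. p (s, y)) has_real_derivative partial1 L p (x, y)) (at x)"
    and "((\<lambda>s. q (x, s)) has_real_derivative partial2 L q (x, y)) (at y)"
proof -
  have int: "(x, y) \<in> interior L" using assms open_triangle_subset by auto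
  then have "(x, y) \<in> L" using interior_subset by blast
  then have dT: "T differentiable (at (x, y) within L)"
    using L_regular(1) by (auto simp: differentiable_on_def)
  have dp: "p differentiable (at (x, y) within L)" and dq: "q differentiable (at (x, y) within L)"
    using L_regular(5,6) int at_within_interior[of "(x, y)" L] at_within_interior[of "(x, y)" "interior L"]
    by (auto simp: differentiable_on_def)
  show "((\<lambda>s. T (s, y)) has_real_derivative p (x, y)) (at x)" by (rule partial1_slice[OF dT int])
  show "((\<lambda>s. T (x, s)) has_real_derivative q (x, y)) (at y)" by (rule partial2_slice[OF dT int])
  show "((\<lambda>s. p (s, y)) has_real_derivative partial1 L p (x, y)) (at x)" by (rule partial1_slice[OF dp int])
  show "((\<lambda>s. q (x, s)) has_real_derivative partial2 L q (x, y)) (at y)" by (rule partial2_slice[OF dq int])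
qed

lemma T_Helmholtz:
  assumes "s \<in> open_triangle b"
  shows "nu * partial1 L p s + nu * partial2 L q s + 2 * lam * T s = 0"
  using T_Helmholtz_interior assms open_triangle_subset by blast

text \<open>The derivative that enters the equation for \<open>Q\<close> is the derivative of \<open>T\<close> in the second
  variable along the bottom edge of the lower triangle, by symmetry of \<open>T\<close>.\<close>

lemma partial1_upper_eq:
  assumes "0 < \<theta>" "\<theta> < b"
  shows "partial1 (upper_triangle b) T (0, \<theta>) = q (\<theta>, 0)"
proof -
  let ?U = "upper_triangle b"
  have U: "(0, \<theta>) \<in> ?U" and Lm: "(\<theta>, 0) \<in> L"
    using assms by (auto simp: upper_triangle_def lower_triangle_def)
  let ?DU = "frechet_derivative T (at (0, \<theta>) within ?U)"
  let ?DL = "frechet_derivative T (at (\<theta>, 0) within L)"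
  have "T differentiable_on ?U" using T_regular by (auto simp: piecewise_regular_def C1_on_def)
  then have DU: "(T has_derivative ?DU) (at (0, \<theta>) within ?U)"
    using U frechet_derivative_works by (auto simp: differentiable_on_def)
  have DL: "(T has_derivative ?DL) (at (\<theta>, 0) within L)"
    using L_regular(1) Lm frechet_derivative_works by (auto simp: differentiable_on_def)
  have "((\<lambda>s. (s, \<theta>)) has_derivative (\<lambda>h. (h, 0))) (at 0 within {0..\<theta>})"
    by (auto intro!: derivative_eq_intros)
  moreover have "(\<lambda>s. (s, \<theta>)) ` {0..\<theta>} \<subseteq> ?U" using assms by (auto simp: upper_triangle_def)
  ultimately have 1: "((\<lambda>s. T (s, \<theta>)) has_derivative (\<lambda>h. ?DU (h, 0))) (at 0 within {0..\<theta>})"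
    using DU by (intro has_derivative_in_compose[where g=T and f="\<lambda>s. (s, \<theta>)"]) (auto intro: has_derivative_subset)
  have "((\<lambda>s. (\<theta>, s)) has_derivative (\<lambda>h. (0, h))) (at 0 within {0..\<theta>})"
    by (auto intro!: derivative_eq_intros)
  moreover have "(\<lambda>s. (\<theta>, s)) ` {0..\<theta>} \<subseteq> L" using assms by (auto simp: lower_triangle_def)
  ultimately have 2: "((\<lambda>s. T (\<theta>, s)) has_derivative (\<lambda>h. ?DL (0, h))) (at 0 within {0..\<theta>})"
    using DL by (intro has_derivative_in_compose[where g=T and f="\<lambda>s. (\<theta>, s)"]) (auto intro: has_derivative_subset)
  have 3: "((\<lambda>s. T (s, \<theta>)) has_derivative (\<lambda>h. ?DL (0, h))) (at 0 within {0..\<theta>})"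
    by (rule has_derivative_transform[OF _ _ 2]) (use assms T_sym in auto)
  have lin1: "?DU (h, 0) = h *\<^sub>R ?DU (1, 0)" and lin2: "?DL (0, h) = h *\<^sub>R ?DL (0, 1)" for h :: real
    using linear_scale[OF has_derivative_linear[OF DU], of h "(1, 0)"]
      linear_scale[OF has_derivative_linear[OF DL], of h "(0, 1)"] by auto
  have lin: "(\<lambda>h. ?DU (h, 0)) = (\<lambda>h. h *\<^sub>R ?DU (1, 0))" "(\<lambda>h. ?DL (0, h)) = (\<lambda>h. h *\<^sub>R ?DL (0, 1))"
    by (rule ext, rule lin1) (rule ext, rule lin2)
  have "?DU (1, 0) = ?DL (0, 1)"
  proof (rule vector_derivative_unique_within_closed_interval[of 0 \<theta> 0 "\<lambda>s. T (s, \<theta>)"])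
    show "((\<lambda>s. T (s, \<theta>)) has_vector_derivative ?DU (1, 0)) (at 0 within cbox 0 \<theta>)"
      using 1 unfolding has_vector_derivative_def cbox_interval lin(1) .
    show "((\<lambda>s. T (s, \<theta>)) has_vector_derivative ?DL (0, 1)) (at 0 within cbox 0 \<theta>)"
      using 3 unfolding has_vector_derivative_def cbox_interval lin(2) .
  qed (use assms in auto)
  then show ?thesis by (simp add: partial1_def partial2_def)
qed

text \<open>The component of \<open>Q\<close> along \<open>x\<close> and its first two derivatives. The second derivative is
  expressed through the equation for \<open>Q\<close>, which shows that it is continuous although it is only
  assumed to exist.\<close>

lemma Q_primitives:
  fixes x :: "real^'n"
  defines "u'' \<equiv> \<lambda>\<theta>. - (x \<bullet> (transpose A *v Q \<theta>) + lam * (x \<bullet> Q \<theta>) + nu * (C *v x) $ 1 * q (\<theta>, 0)) / nu"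
  shows "primitive_on b (\<lambda>\<theta>. x \<bullet> Q \<theta>) (\<lambda>\<theta>. x \<bullet> deriv_on b Q \<theta>)"
    and "primitive_on b (\<lambda>\<theta>. x \<bullet> deriv_on b Q \<theta>) u''"
proof -
  have D1: "(Q has_vector_derivative deriv_on b Q \<theta>) (at \<theta>)" if "0 < \<theta>" "\<theta> < b" for \<theta>
  proof -
    have "Q differentiable (at \<theta> within {0..b})"
      using Q_differentiable that by (auto simp: differentiable_on_def)
    then show ?thesis
      using that at_within_Icc_at[of 0 \<theta> b] unfolding deriv_on_def by (metis vector_derivative_works)
  qed
  have D2: "(deriv_on b Q has_vector_derivative deriv_on b (deriv_on b Q) \<theta>) (at \<theta>)" if "0 < \<theta>" "\<theta> < b" for \<theta>
  proof -
    have "deriv_on b Q differentiable (at \<theta> within {0..b})"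
      using Q'_differentiable that by (auto simp: differentiable_on_def)
    then show ?thesis
      using that at_within_Icc_at[of 0 \<theta> b] unfolding deriv_on_def[of b "deriv_on b Q"] by (metis vector_derivative_works)
  qed
  have inner: "((\<lambda>\<theta>. x \<bullet> f \<theta>) has_real_derivative x \<bullet> f') (at \<theta>)"
    if "(f has_vector_derivative f') (at \<theta>)" for f :: "real \<Rightarrow> real^'n" and f' \<theta>
    unfolding has_real_derivative_iff_has_vector_derivative
    by (rule bounded_linear.has_vector_derivative[OF bounded_linear_inner_right that])
  have Q'_cont: "continuous_on {0..b} (deriv_on b Q)"
    by (rule differentiable_imp_continuous_on[OF Q'_differentiable])
  show "primitive_on b (\<lambda>\<theta>. x \<bullet> Q \<theta>) (\<lambda>\<theta>. x \<bullet> deriv_on b Q \<theta>)"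
    by (rule primitive_onI[of "{}"])
       (auto intro!: inner D1 integrable_interval_continuous continuous_intros Q_cont Q'_cont)
  have q_cont: "continuous_on {0..b} (\<lambda>\<theta>. q (\<theta>, 0))"
    by (rule continuous_on_compose2[OF L_regular(4)])
       (auto intro!: continuous_intros simp: lower_triangle_def)
  have u''_eq: "x \<bullet> deriv_on b (deriv_on b Q) \<theta> = u'' \<theta>" if "0 < \<theta>" "\<theta> < b" for \<theta>
  proof -
    have "nu *\<^sub>R deriv_on b (deriv_on b Q) \<theta> + (transpose A + lam *\<^sub>R mat 1) *v Q \<theta>
        + nu *\<^sub>R (transpose C *v vec (q (\<theta>, 0))) = 0"
      using Q_equation[of \<theta>] partial1_upper_eq[OF that] that by auto
    then have "x \<bullet> (nu *\<^sub>R deriv_on b (deriv_on b Q) \<theta> + (transpose A + lam *\<^sub>R mat 1) *v Q \<theta>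
        + nu *\<^sub>R (transpose C *v vec (q (\<theta>, 0)))) = 0" by simp
    moreover have "x \<bullet> (transpose C *v vec (q (\<theta>, 0))) = (C *v x) $ 1 * q (\<theta>, 0)"
      by (simp add: inner_commute[of x] dot_lmul_matrix) (simp add: inner_vec_def sum_1 mult.commute)
    moreover have "(transpose A + lam *\<^sub>R mat 1) *v Q \<theta> = transpose A *v Q \<theta> + lam *\<^sub>R Q \<theta>"
      by (simp add: matrix_vector_mult_add_rdistrib scaleR_matrix_vector_assoc[symmetric])
    ultimately have "nu * (x \<bullet> deriv_on b (deriv_on b Q) \<theta>) =
        - (x \<bullet> (transpose A *v Q \<theta>) + lam * (x \<bullet> Q \<theta>) + nu * (C *v x) $ 1 * q (\<theta>, 0))"
      by (simp add: inner_add_right)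
    then show ?thesis using nu by (simp add: u''_def field_simps)
  qed
  show "primitive_on b (\<lambda>\<theta>. x \<bullet> deriv_on b Q \<theta>) u''"
  proof (rule primitive_onI[of "{}"])
    show "integrable (interval_measure b) u''"
      unfolding u''_def
      by (intro integrable_interval_continuous continuous_intros Q_cont q_cont
          linear_continuous_on_compose[OF Q_cont matrix_vector_mul_linear]) (use nu in auto)
  qed (use inner[OF D2] u''_eq in \<open>auto intro!: continuous_intros Q'_cont\<close>)
qed

text \<open>The divergence theorem for the field \<open>z(\<theta>1) z(\<theta>2) \<nabla>T\<close> on the lower triangle. The flux
  through the diagonal is where the jump condition on \<open>T\<close> enters: it produces the term with \<open>w\<close>.
  The flux through the side \<open>\<theta>1 = b\<close> vanishes because \<open>z b = 0\<close>.\<close>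

lemma Dirichlet_pairing:
  assumes z1: "continuous_on {0..b} z1" and z: "continuous_on {0..b} z"
    and dz: "\<And>x. 0 < x \<Longrightarrow> x < b \<Longrightarrow> (z has_real_derivative z1 x) (at x)"
    and zb: "z b = 0"
  shows "(LINT s|square_measure b. indicator L s * (z1 (fst s) * z (snd s) * p s + z (fst s) * z1 (snd s) * q s)) =
    w / 2 * (LINT x|interval_measure b. (z x)\<^sup>2) - z 0 * (LINT x|interval_measure b. z x * q (x, 0))
    + 2 * lam / nu * (LINT s|square_measure b. indicator L s * (z (fst s) * T s * z (snd s)))"
proof -
  have cfst: "continuous_on L (\<lambda>s. f (fst s))" and csnd: "continuous_on L (\<lambda>s. f (snd s))"
    if "continuous_on {0..b} f" for f :: "real \<Rightarrow> real"
    by (auto intro!: continuous_on_compose2[OF that] continuous_intros simp: lower_triangle_def)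
  note O_sub = order_trans[OF open_triangle_subset interior_subset, of b]
  have cO: "continuous_on (open_triangle b) f" if "continuous_on L f" for f :: "real \<times> real \<Rightarrow> real"
    by (rule continuous_on_subset[OF that O_sub])
  note cp = L_regular(3) and cq = L_regular(4) and cT = L_regular(2)
  have cpp: "continuous_on (open_triangle b) (partial1 L p)" and cqq: "continuous_on (open_triangle b) (partial2 L q)"
    by (rule continuous_on_subset[OF _ open_triangle_subset], fact L_regular)+
  define E where "E s = z1 (fst s) * z (snd s) * p s + z (fst s) * z1 (snd s) * q s" for s
  define H where "H s = E s - 2 * lam / nu * (z (fst s) * T s * z (snd s))" for s
  have cE: "continuous_on L E" unfolding E_def
    by (intro continuous_intros cfst csnd z z1 cp cq)
  have czTz: "continuous_on L (\<lambda>s. z (fst s) * T s * z (snd s))"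
    by (intro continuous_intros cfst csnd z cT)
  define F G where "F s = z (fst s) * z (snd s) * p s" and "G s = z (fst s) * z (snd s) * q s" for s
  define f where "f s = z1 (fst s) * z (snd s) * p s + z (fst s) * z (snd s) * partial1 L p s" for s
  define g where "g s = z (fst s) * z1 (snd s) * q s + z (fst s) * z (snd s) * partial2 L q s" for s
  have "(LINT s|square_measure b. indicator L s * H s) =
    (LINT y|interval_measure b. F (b, y) - F (y, y)) + (LINT x|interval_measure b. G (x, x) - G (x, 0))"
  proof (rule divergence_triangle[OF b, where f=f and g=g])
    show "continuous_on L F" "continuous_on L G"
      unfolding F_def G_def by (intro continuous_intros cfst csnd z cp cq)+
    show "continuous_on L H" unfolding H_def
      by (intro continuous_on_diff cE continuous_on_mult_left czTz)
    show "continuous_on (open_triangle b) f" "continuous_on (open_triangle b) g"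
      unfolding f_def g_def
      by (intro continuous_on_add continuous_on_mult cO[OF cfst] cO[OF csnd] z z1 cO[OF cp] cO[OF cq] cpp cqq)+
  next
    fix x y assume O: "(x, y) \<in> open_triangle b"
    then have xy: "0 < x" "x < b" "0 < y" "y < b" by (auto simp: open_triangle_def)
    show "((\<lambda>s. F (s, y)) has_real_derivative f (x, y)) (at x)"
      unfolding F_def f_def fst_conv snd_conv
      by (rule derivative_eq_intros dz xy T_slices O refl)+ (simp add: algebra_simps)
    show "((\<lambda>s. G (x, s)) has_real_derivative g (x, y)) (at y)"
      unfolding G_def g_def fst_conv snd_conv
      by (rule derivative_eq_intros dz xy T_slices O refl)+ (simp add: algebra_simps)
  next
    fix s assume "s \<in> open_triangle b"
    then obtain x y where s: "s = (x, y)" "(x, y) \<in> open_triangle b" by (cases s) auto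
    from T_Helmholtz[OF s(2)] have "partial1 L p (x, y) + partial2 L q (x, y) = - (2 * lam / nu * T (x, y))"
      using nu by (simp add: field_simps)
    then have "z x * z y * (partial1 L p (x, y) + partial2 L q (x, y)) = z x * z y * - (2 * lam / nu * T (x, y))"
      by simp
    then show "f s + g s = H s"
      by (simp add: s(1) f_def g_def H_def E_def algebra_simps)
  qed
  also have "\<dots> = (LINT y|interval_measure b. z b * z y * p (b, y) - z y * z y * p (y, y)) +
    (LINT x|interval_measure b. z x * z x * q (x, x) - z x * z 0 * q (x, 0))"
    by (simp add: F_def G_def)
  finally have 0: "(LINT s|square_measure b. indicator L s * H s) = \<dots>" .
  have "(LINT s|square_measure b. indicator L s * H s) =
      (LINT s|square_measure b. indicator L s * E s - 2 * lam / nu * (indicator L s * (z (fst s) * T s * z (snd s))))"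
    by (simp add: H_def algebra_simps)
  also have "\<dots> = (LINT s|square_measure b. indicator L s * E s)
      - 2 * lam / nu * (LINT s|square_measure b. indicator L s * (z (fst s) * T s * z (snd s)))"
    using triangle_indicator_integrable[OF cE] triangle_indicator_integrable[OF czTz] by simp
  finally have 1: "(LINT s|square_measure b. indicator L s * H s) = \<dots>" .
  have cdiag: "continuous_on {0..b} (\<lambda>x. f (x, x))" and cbot: "continuous_on {0..b} (\<lambda>x. f (x, 0))"
    if "continuous_on L f" for f :: "real \<times> real \<Rightarrow> real"
    by (auto intro!: continuous_on_compose2[OF that] continuous_intros simp: lower_triangle_def)
  have i1: "integrable (interval_measure b) (\<lambda>y. z y * z y * p (y, y))"
    and i2: "integrable (interval_measure b) (\<lambda>y. z y * z y * q (y, y))"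
    and i3: "integrable (interval_measure b) (\<lambda>x. z x * q (x, 0))"
    by (intro integrable_interval_continuous continuous_intros z cdiag cbot cp cq)+
  have "(LINT y|interval_measure b. z b * z y * p (b, y) - z y * z y * p (y, y)) = - (LINT y|interval_measure b. z y * z y * p (y, y))"
    by (simp add: zb)
  moreover have "(LINT x|interval_measure b. z x * z x * q (x, x) - z x * z 0 * q (x, 0)) =
      (LINT x|interval_measure b. z x * z x * q (x, x) - z 0 * (z x * q (x, 0)))"
    by (simp add: mult_ac)
  moreover have "\<dots> = (LINT x|interval_measure b. z x * z x * q (x, x)) - z 0 * (LINT x|interval_measure b. z x * q (x, 0))"
    using i2 i3 by simp
  moreover have "(LINT x|interval_measure b. z x * z x * q (x, x)) - (LINT y|interval_measure b. z y * z y * p (y, y)) =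
      (LINT x|interval_measure b. z x * z x * q (x, x) - z x * z x * p (x, x))"
    using i1 i2 by simp
  moreover have "\<dots> = (LINT x|interval_measure b. w / 2 * (z x)\<^sup>2)"
  proof (rule Bochner_Integration.integral_cong)
    fix x assume "x \<in> space (interval_measure b)"
    then have "p (x, x) - q (x, x) = - (w / 2)"
      by (intro T_diagonal) auto
    then have "q (x, x) - p (x, x) = w / 2" by simp
    then have "z x * z x * (q (x, x) - p (x, x)) = z x * z x * (w / 2)" by simp
    then show "z x * z x * q (x, x) - z x * z x * p (x, x) = w / 2 * (z x)\<^sup>2"
      by (simp add: power2_eq_square algebra_simps)
  qed simp
  moreover have "\<dots> = w / 2 * (LINT x|interval_measure b. (z x)\<^sup>2)" by simp
  ultimately show ?thesis using 0 1 unfolding E_def by linarith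
qed

end

lemma system_operator_state_space:
  assumes "(h, g) \<in> system_operator A B C lam nu b c"
  shows "h \<in> state_space b" "g \<in> state_space b"
proof -
  from assms obtain x z z1 z2 where *: "H2_with_derivs b z z1 z2"
    "h = (x, z)" "g = (A *v x + B *v vec (z1 c), \<lambda>\<theta>. nu * z2 \<theta> + lam * z \<theta>)"
    by (auto simp: system_operator_def)
  have "z \<in> L2 b" "z2 \<in> L2 b"
    using L2_continuous H2_primitives(4)[OF *(1)] *(1) by (auto simp: H2_with_derivs_def)
  then show "h \<in> state_space b" "g \<in> state_space b"
    using * by (auto intro!: state_spaceI L2_lin_comb)
qed

context lyapunov_solution
begin

lemma integral_kernel_eq_twice_triangle:
  assumes z: "continuous_on {0..b} z"
  shows "(LINT s|square_measure b. z (fst s) * T s * z (snd s)) =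
    2 * (LINT s|square_measure b. indicator L s * (z (fst s) * T s * z (snd s)))"
proof -
  define g where "g s = z (fst s) * T s * z (snd s)" for s
  have int: "integrable (square_measure b) g"
    unfolding g_def by (intro kernel_integrable L2_continuous z)
  have cg: "continuous_on L g"
    unfolding g_def
    by (intro continuous_intros L_regular(2); rule continuous_on_compose2[OF z])
       (auto intro!: continuous_intros simp: lower_triangle_def)
  define gL where "gL s = indicator L s * g s" for s
  have intL: "integrable (square_measure b) gL"
    unfolding gL_def by (rule triangle_indicator_integrable[OF cg])
  then have [measurable]: "gL \<in> borel_measurable (square_measure b)" by auto
  have int_swap: "integrable (square_measure b) (\<lambda>s. gL (prod.swap s))"
    using sq.integrable_product_swap[OF intL] by (simp add: case_prod_unfold prod.swap_def)
  have int2: "integrable (square_measure b) (\<lambda>s. gL s + gL (prod.swap s))"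
    using intL int_swap by simp
  have "(LINT s|square_measure b. g s) = (LINT x|interval_measure b. LINT y|interval_measure b. g (x, y))"
    using integral_square_fst[OF int] by simp
  also have "\<dots> = (LINT x|interval_measure b. LINT y|interval_measure b. gL (x, y) + gL (prod.swap (x, y)))"
  proof (rule Bochner_Integration.integral_cong)
    fix x assume x: "x \<in> space (interval_measure b)"
    show "(LINT y|interval_measure b. g (x, y)) = (LINT y|interval_measure b. gL (x, y) + gL (prod.swap (x, y)))"
    proof (rule integral_cong_AE)
      show "(\<lambda>y. g (x, y)) \<in> borel_measurable (interval_measure b)"
        by (rule measurable_Pair2[OF borel_measurable_integrable[OF int] x])
      show "(\<lambda>y. gL (x, y) + gL (prod.swap (x, y))) \<in> borel_measurable (interval_measure b)"
        by (rule measurable_Pair2[OF borel_measurable_integrable[OF int2] x])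
      show "AE y in interval_measure b. g (x, y) = gL (x, y) + gL (prod.swap (x, y))"
        using AE_interval_neq[of x b] AE_space
      proof eventually_elim
        case (elim y)
        have "g (y, x) = g (x, y)" using T_sym elim x by (simp add: g_def)
        then show ?case using elim x
          by (cases "y < x") (auto simp: gL_def lower_triangle_def)
      qed
    qed
  qed simp
  also have "\<dots> = (LINT s|square_measure b. gL s + gL (prod.swap s))"
    using integral_square_fst[OF int2] by simp
  also have "\<dots> = 2 * (LINT s|square_measure b. gL s)"
    using intL int_swap integral_square_swap[of gL b] by simp
  finally show ?thesis by (simp add: g_def gL_def)
qed

text \<open>Integration by parts in the second variable of \<open>T\<close>. The only derivatives of \<open>T\<close> left are first
  ones; the contribution above the diagonal is reflected to the lower triangle. The exceptional point of
  the slice at \<open>x\<close> is its crossing with the diagonal, where the derivative of \<open>T\<close> jumps but \<open>T\<close>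
  itself is continuous.\<close>

lemma kernel_by_parts:
  assumes z: "continuous_on {0..b} z" and z1: "continuous_on {0..b} z1" and z2: "primitive_on b z1 z2"
  shows "(LINT x|interval_measure b. LINT y|interval_measure b. z x * T (x, y) * z2 y) =
    z1 b * (LINT x|interval_measure b. z x * T (x, b))
    - (LINT s|square_measure b. indicator L s * (z1 (fst s) * z (snd s) * p s + z (fst s) * z1 (snd s) * q s))"
proof -
  define pL qL where "pL s = indicator L s * p s" and "qL s = indicator L s * q s" for s
  \<comment> \<open>the derivative of \<open>T\<close> in the second variable, off the diagonal\<close>
  define D where "D s = qL s + pL (prod.swap s)" for s
  have pL_meas: "pL \<in> borel_measurable (square_measure b)" and qL_meas: "qL \<in> borel_measurable (square_measure b)"
    unfolding pL_def qL_def by (intro triangle_indicator_measurable L_regular)+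
  note pL_swap = measurable_square_swap[OF pL_meas]
  have D_meas: "D \<in> borel_measurable (square_measure b)"
    unfolding D_def using qL_meas pL_swap by simp
  obtain Kp where Kp: "Kp \<ge> 0" "\<And>s. s \<in> L \<Longrightarrow> \<bar>p s\<bar> \<le> Kp"
    using continuous_bounded_on_triangle[OF L_regular(3)] by blast
  obtain Kq where Kq: "Kq \<ge> 0" "\<And>s. s \<in> L \<Longrightarrow> \<bar>q s\<bar> \<le> Kq"
    using continuous_bounded_on_triangle[OF L_regular(4)] by blast
  have pL_bound: "\<bar>pL s\<bar> \<le> Kp" and qL_bound: "\<bar>qL s\<bar> \<le> Kq" for s
    using Kp Kq by (auto simp: pL_def qL_def indicator_def)
  have D_bound: "\<bar>D s\<bar> \<le> Kp + Kq" for s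
    unfolding D_def using pL_bound[of "prod.swap s"] qL_bound[of s] by linarith
  have iz: "integrable (interval_measure b) z" and iz1: "integrable (interval_measure b) z1"
    by (intro integrable_interval_continuous z z1)+
  have T_cont_y: "continuous_on {0..b} (\<lambda>y. T (x, y))" if "x \<in> {0..b}" for x
    by (rule continuous_on_compose2[OF T_cont]) (use that in \<open>auto intro!: continuous_intros\<close>)
  have slice: "(LINT y|interval_measure b. T (x, y) * z2 y) =
      T (x, b) * z1 b - (LINT y|interval_measure b. D (x, y) * z1 y)" if x: "0 < x" "x < b" for x
  proof -
    have "primitive_on b (\<lambda>y. T (x, y)) (\<lambda>y. D (x, y))"
    proof (rule primitive_onI[of "{x}"])
      show "continuous_on {0..b} (\<lambda>y. T (x, y))" using x by (intro T_cont_y) auto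
      show "integrable (interval_measure b) (\<lambda>y. D (x, y))"
        by (rule integrable_interval_bounded[where K="Kp + Kq"])
           (use measurable_Pair2[OF D_meas] x D_bound in auto)
      fix y assume y: "0 < y" "y < b" "y \<notin> {x}"
      show "((\<lambda>y. T (x, y)) has_real_derivative D (x, y)) (at y)"
      proof (cases "y < x")
        case True
        then have "(x, y) \<in> open_triangle b" using x y by (auto simp: open_triangle_def)
        from T_slices(2)[OF this] show ?thesis
          using True x y by (simp add: D_def pL_def qL_def lower_triangle_def)
      next
        case False
        then have xy: "x < y" "(y, x) \<in> open_triangle b" using x y by (auto simp: open_triangle_def)
        have "((\<lambda>s. T (x, s)) has_real_derivative p (y, x)) (at y)"
          by (rule has_field_derivative_transform_within_open[OF T_slices(1)[OF xy(2)], of "{x<..<b}"])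
             (use x y xy T_sym in auto)
        then show ?thesis
          using xy x y by (simp add: D_def pL_def qL_def lower_triangle_def)
      qed
    qed simp
    from primitive_by_parts[OF _ this z2] b show ?thesis
      using T_boundary(1)[of x] x by simp
  qed
  have intD: "integrable (square_measure b) (\<lambda>s. z (fst s) * D s * z1 (snd s))"
    by (intro integrable_square_kernel[where K="Kp + Kq"] iz iz1 D_meas D_bound)
  have intq: "integrable (square_measure b) (\<lambda>s. z (fst s) * qL s * z1 (snd s))"
    by (intro integrable_square_kernel[where K="Kq"] iz iz1 qL_meas qL_bound)
  have intp_swap: "integrable (square_measure b) (\<lambda>s. z (fst s) * pL (prod.swap s) * z1 (snd s))"
    by (intro integrable_square_kernel[where K="Kp"] iz iz1 pL_swap pL_bound)
  have intp: "integrable (square_measure b) (\<lambda>s. z1 (fst s) * pL s * z (snd s))"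
    by (intro integrable_square_kernel[where K="Kp"] iz iz1 pL_meas pL_bound)
  have T_cont_x: "continuous_on {0..b} (\<lambda>x. T (x, b))"
    by (rule continuous_on_compose2[OF T_cont]) (use b in \<open>auto intro!: continuous_intros\<close>)
  have intb: "integrable (interval_measure b) (\<lambda>x. z x * T (x, b))"
    by (intro integrable_interval_continuous continuous_intros z T_cont_x)
  have "(LINT x|interval_measure b. LINT y|interval_measure b. z x * T (x, y) * z2 y) =
    (LINT x|interval_measure b. z1 b * (z x * T (x, b)) - (LINT y|interval_measure b. z x * D (x, y) * z1 y))"
  proof (rule Bochner_Integration.integral_cong)
    fix x assume "x \<in> space (interval_measure b)"
    then have x: "0 < x" "x < b" by auto
    have "(LINT y|interval_measure b. z x * T (x, y) * z2 y) = z x * (LINT y|interval_measure b. T (x, y) * z2 y)"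
      by (simp add: mult.assoc)
    also have "\<dots> = z x * (T (x, b) * z1 b) - z x * (LINT y|interval_measure b. D (x, y) * z1 y)"
      by (simp add: slice[OF x] right_diff_distrib)
    also have "z x * (LINT y|interval_measure b. D (x, y) * z1 y) = (LINT y|interval_measure b. z x * D (x, y) * z1 y)"
      by (simp add: mult.assoc)
    finally show "(LINT y|interval_measure b. z x * T (x, y) * z2 y) =
      z1 b * (z x * T (x, b)) - (LINT y|interval_measure b. z x * D (x, y) * z1 y)"
      by (simp add: mult_ac)
  qed simp
  also have "\<dots> = z1 b * (LINT x|interval_measure b. z x * T (x, b)) - (LINT s|square_measure b. z (fst s) * D s * z1 (snd s))"
    using intb sq.integrable_fst'[OF intD] integral_square_fst[OF intD] by simp
  also have "(LINT s|square_measure b. z (fst s) * D s * z1 (snd s)) =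
      (LINT s|square_measure b. z (fst s) * qL s * z1 (snd s) + z (fst s) * pL (prod.swap s) * z1 (snd s))"
    by (simp add: D_def algebra_simps)
  also have "\<dots> = (LINT s|square_measure b. z (fst s) * qL s * z1 (snd s)) + (LINT s|square_measure b. z (fst s) * pL (prod.swap s) * z1 (snd s))"
    using intq intp_swap by simp
  also have "(LINT s|square_measure b. z (fst s) * pL (prod.swap s) * z1 (snd s)) = (LINT s|square_measure b. z1 (fst s) * pL s * z (snd s))"
    using integral_square_swap[OF borel_measurable_integrable[OF intp]] by (simp add: mult_ac)
  also have "(LINT s|square_measure b. z (fst s) * qL s * z1 (snd s)) + \<dots> =
      (LINT s|square_measure b. z (fst s) * qL s * z1 (snd s) + z1 (fst s) * pL s * z (snd s))"
    using intq intp by simp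
  also have "\<dots> = (LINT s|square_measure b. indicator L s * (z1 (fst s) * z (snd s) * p s + z (fst s) * z1 (snd s) * q s))"
    by (simp add: pL_def qL_def algebra_simps)
  finally show ?thesis .
qed

text \<open>The dissipation identity: along the system operator the equations for \<open>(P, Q, T)\<close> cancel every
  term except the two negative definite ones.\<close>

lemma lyapunov_form_dissipation:
  assumes "(h, g) \<in> system_operator A B C lam nu b b"
  shows "2 * V h g = - (norm (fst h))\<^sup>2 - nu * w * (LINT \<theta>|interval_measure b. (snd h \<theta>)\<^sup>2)"
proof -
  from assms obtain x z z1 z2 where H2: "H2_with_derivs b z z1 z2"
    and hg: "h = (x, z)" "g = (A *v x + B *v vec (z1 b), \<lambda>\<theta>. nu * z2 \<theta> + lam * z \<theta>)"
    and bc: "vec (z 0) = C *v x" "z b = 0"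
    by (auto simp: system_operator_def)
  note prim = H2_primitives[OF H2]
  note z = prim(4) and z1 = prim(2)
  have z2L: "z2 \<in> L2 b" and zL: "z \<in> L2 b"
    using H2 L2_continuous[OF z] by (auto simp: H2_with_derivs_def)
  define Bv where "Bv = column 1 B"
  define \<beta> c where "\<beta> = z1 b" and "c = z 0"
  have Cx: "C *v x = vec c" by (simp add: bc c_def)
  define u where "u v = (LINT \<theta>|interval_measure b. (v \<bullet> Q \<theta>) * z \<theta>)" for v
  define q0 where "q0 = (LINT \<theta>|interval_measure b. z \<theta> * q (\<theta>, 0))"
  define N2 where "N2 = (LINT \<theta>|interval_measure b. (z \<theta>)\<^sup>2)"
  define KT where "KT = (LINT s|square_measure b. z (fst s) * T s * z (snd s))"
  have u_add: "u (v + r *\<^sub>R v') = u v + r * u v'" for v v' r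
  proof -
    have "u (v + r *\<^sub>R v') = (LINT \<theta>|interval_measure b. (v \<bullet> Q \<theta>) * z \<theta> + r * ((v' \<bullet> Q \<theta>) * z \<theta>))"
      by (simp add: u_def inner_add_left algebra_simps)
    then show ?thesis using Q_integrable[OF zL] by (simp add: u_def)
  qed
  \<comment> \<open>the pairing of \<open>Q\<close> with the second derivative\<close>
  define u'' where "u'' \<theta> = - (x \<bullet> (transpose A *v Q \<theta>) + lam * (x \<bullet> Q \<theta>) + nu * (C *v x) $ 1 * q (\<theta>, 0)) / nu" for \<theta>
  note Qp = Q_primitives[of x, folded u''_def]
  have ibp1: "(LINT \<theta>|interval_measure b. (x \<bullet> Q \<theta>) * z2 \<theta>) =
      (x \<bullet> Q b) * z1 b - (x \<bullet> Q 0) * z1 0 - (LINT \<theta>|interval_measure b. (x \<bullet> deriv_on b Q \<theta>) * z1 \<theta>)"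
    by (rule primitive_by_parts[OF _ Qp(1) prim(1)]) (use b in simp)
  have ibp2: "(LINT \<theta>|interval_measure b. (x \<bullet> deriv_on b Q \<theta>) * z1 \<theta>) =
      (x \<bullet> deriv_on b Q b) * z b - (x \<bullet> deriv_on b Q 0) * z 0 - (LINT \<theta>|interval_measure b. u'' \<theta> * z \<theta>)"
    by (rule primitive_by_parts[OF _ Qp(2) prim(3)]) (use b in simp)
  have ibp3: "nu * (LINT \<theta>|interval_measure b. u'' \<theta> * z \<theta>) = - u (A *v x) - lam * u x - nu * c * q0"
  proof -
    have qz: "integrable (interval_measure b) (\<lambda>\<theta>. z \<theta> * q (\<theta>, 0))"
    proof (intro integrable_interval_continuous continuous_on_mult z)
      show "continuous_on {0..b} (\<lambda>\<theta>. q (\<theta>, 0))"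
        by (rule continuous_on_compose2[OF L_regular(4)]) (auto intro!: continuous_intros simp: lower_triangle_def)
    qed
    have "nu * (LINT \<theta>|interval_measure b. u'' \<theta> * z \<theta>) = (LINT \<theta>|interval_measure b. nu * (u'' \<theta> * z \<theta>))"
      by simp
    also have "\<dots> = (LINT \<theta>|interval_measure b. - ((A *v x) \<bullet> Q \<theta> * z \<theta>) - lam * (x \<bullet> Q \<theta> * z \<theta>) - nu * c * (z \<theta> * q (\<theta>, 0)))"
    proof (rule Bochner_Integration.integral_cong)
      fix \<theta>
      have "x \<bullet> (transpose A *v Q \<theta>) = (A *v x) \<bullet> Q \<theta>"
        by (simp add: inner_commute[of x] dot_lmul_matrix inner_commute[of "Q \<theta>"])
      then have "nu * u'' \<theta> = - ((A *v x) \<bullet> Q \<theta>) - lam * (x \<bullet> Q \<theta>) - nu * c * q (\<theta>, 0)"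
        using nu by (simp add: u''_def Cx)
      then have "nu * (u'' \<theta> * z \<theta>) = (- ((A *v x) \<bullet> Q \<theta>) - lam * (x \<bullet> Q \<theta>) - nu * c * q (\<theta>, 0)) * z \<theta>"
        by simp
      then show "nu * (u'' \<theta> * z \<theta>) = - ((A *v x) \<bullet> Q \<theta> * z \<theta>) - lam * (x \<bullet> Q \<theta> * z \<theta>) - nu * c * (z \<theta> * q (\<theta>, 0))"
        by (simp add: algebra_simps)
    qed simp
    also have "\<dots> = - u (A *v x) - lam * u x - nu * c * q0"
      using Q_integrable[OF zL] qz by (simp add: u_def q0_def)
    finally show ?thesis .
  qed
  have Qz2: "nu * (LINT \<theta>|interval_measure b. (x \<bullet> Q \<theta>) * z2 \<theta>) =
      nu * (x \<bullet> Q b) * \<beta> + nu * (x \<bullet> deriv_on b Q 0) * c - u (A *v x) - lam * u x - nu * c * q0"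
    unfolding ibp1 ibp2 using ibp3 by (simp add: Q_boundary bc \<beta>_def c_def algebra_simps)
  \<comment> \<open>the pairing of \<open>T\<close> with the second derivative\<close>
  have TB: "nu * (LINT \<theta>|interval_measure b. z \<theta> * T (\<theta>, b)) = - u Bv"
  proof -
    have "nu * (LINT \<theta>|interval_measure b. z \<theta> * T (\<theta>, b)) = (LINT \<theta>|interval_measure b. nu * (z \<theta> * T (\<theta>, b)))"
      by simp
    also have "\<dots> = (LINT \<theta>|interval_measure b. - ((Bv \<bullet> Q \<theta>) * z \<theta>))"
    proof (rule Bochner_Integration.integral_cong)
      fix \<theta> assume "\<theta> \<in> space (interval_measure b)"
      then have \<theta>: "\<theta> \<in> {0..b}" by auto
      have "vec (nu * T (b, \<theta>)) + vec (Bv \<bullet> Q \<theta>) = (0 :: real^1)"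
        using T_boundary(2)[OF \<theta>] unfolding transpose_single_column_mult Bv_def .
      then have "nu * T (b, \<theta>) + Bv \<bullet> Q \<theta> = 0"
        by (simp add: vec_eq_iff)
      moreover have "T (\<theta>, b) = T (b, \<theta>)" using T_sym \<theta> b by auto
      ultimately have "nu * T (\<theta>, b) = - (Bv \<bullet> Q \<theta>)" by simp
      then have "z \<theta> * (nu * T (\<theta>, b)) = z \<theta> * - (Bv \<bullet> Q \<theta>)" by simp
      then show "nu * (z \<theta> * T (\<theta>, b)) = - ((Bv \<bullet> Q \<theta>) * z \<theta>)" by (simp add: mult_ac)
    qed simp
    finally show ?thesis by (simp add: u_def)
  qed
  have "(LINT x|interval_measure b. LINT y|interval_measure b. z x * T (x, y) * z2 y) =
      \<beta> * (LINT x|interval_measure b. z x * T (x, b)) - (w / 2 * N2 - c * q0 + lam / nu * KT)"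
    unfolding kernel_by_parts[OF z z1 prim(1)]
    using integral_kernel_eq_twice_triangle[OF z] Dirichlet_pairing[OF z1 z _ bc(2)] prim(5)
    by (simp add: \<beta>_def N2_def c_def q0_def KT_def)
  then have "nu * (LINT x|interval_measure b. LINT y|interval_measure b. z x * T (x, y) * z2 y) =
      \<beta> * (nu * (LINT x|interval_measure b. z x * T (x, b))) - nu * (w / 2) * N2 + nu * c * q0 - nu * (lam / nu) * KT"
    by (simp only:) (simp add: algebra_simps)
  then have Tz2: "nu * (LINT x|interval_measure b. LINT y|interval_measure b. z x * T (x, y) * z2 y) =
      - \<beta> * u Bv - nu * w / 2 * N2 + nu * c * q0 - lam * KT"
    unfolding TB using nu by simp
  have "(LINT x|interval_measure b. LINT y|interval_measure b. z x * T (x, y) * (nu * z2 y + lam * z y)) =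
      (LINT s|square_measure b. nu * (z (fst s) * T s * z2 (snd s)) + lam * (z (fst s) * T s * z (snd s)))"
    using integral_square_fst[OF kernel_integrable[OF zL L2_lin_comb[OF z2L zL, of nu lam]]]
    by (simp add: algebra_simps)
  also have "\<dots> = nu * (LINT x|interval_measure b. LINT y|interval_measure b. z x * T (x, y) * z2 y) + lam * KT"
    using kernel_integrable[OF zL z2L] kernel_integrable[OF zL zL] integral_square_fst[OF kernel_integrable[OF zL z2L]]
    by (simp add: KT_def)
  finally have kernel: "(LINT x|interval_measure b. LINT y|interval_measure b. z x * T (x, y) * (nu * z2 y + lam * z y)) =
      - \<beta> * u Bv - nu * w / 2 * N2 + nu * c * q0"
    unfolding Tz2 by simp
  have "(LINT \<theta>|interval_measure b. (x \<bullet> Q \<theta>) * (nu * z2 \<theta> + lam * z \<theta>)) =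
      (LINT \<theta>|interval_measure b. nu * ((x \<bullet> Q \<theta>) * z2 \<theta>) + lam * ((x \<bullet> Q \<theta>) * z \<theta>))"
    by (simp add: algebra_simps)
  also have "\<dots> = nu * (LINT \<theta>|interval_measure b. (x \<bullet> Q \<theta>) * z2 \<theta>) + lam * u x"
    using Q_integrable[OF zL] Q_integrable[OF z2L] by (simp add: u_def)
  finally have cross: "(LINT \<theta>|interval_measure b. (x \<bullet> Q \<theta>) * (nu * z2 \<theta> + lam * z \<theta>)) =
      nu * (x \<bullet> Q b) * \<beta> + nu * (x \<bullet> deriv_on b Q 0) * c - u (A *v x) - nu * c * q0"
    unfolding Qz2 by simp
  have g1: "fst g = A *v x + \<beta> *\<^sub>R Bv"
    by (simp add: hg single_column_mult \<beta>_def Bv_def)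
  have "P *v Bv + nu *\<^sub>R Q b = 0"
  proof -
    have "(P ** B + nu *\<^sub>R columnvector (Q b)) *v vec 1 = 0" using Q_boundary(2) by simp
    then have "P *v (B *v vec 1) + nu *\<^sub>R (columnvector (Q b) *v (vec 1 :: real^1)) = 0"
      by (simp only: matrix_vector_mult_add_rdistrib matrix_vector_mul_assoc scaleR_matrix_vector_assoc)
    then show ?thesis unfolding columnvector_vec by (simp only: single_column_mult Bv_def scaleR_one)
  qed
  then have "x \<bullet> (P *v Bv + nu *\<^sub>R Q b) = 0" by simp
  then have PB: "x \<bullet> (P *v Bv) = - nu * (x \<bullet> Q b)" by (simp add: inner_add_right)
  have lyap: "2 * (x \<bullet> (P *v (A *v x))) + 2 * nu * c * (x \<bullet> deriv_on b Q 0) = - (norm x)\<^sup>2"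
  proof -
    define M where "M = P ** A + nu *\<^sub>R (columnvector (deriv_on b Q 0) ** C)"
    have "M *v x = P *v (A *v x) + nu *\<^sub>R (columnvector (deriv_on b Q 0) *v (C *v x))"
      by (simp only: M_def matrix_vector_mult_add_rdistrib matrix_vector_mul_assoc scaleR_matrix_vector_assoc)
    then have Mx: "M *v x = P *v (A *v x) + (nu * c) *\<^sub>R deriv_on b Q 0"
      by (simp add: Cx columnvector_vec)
    have "He M *v x = - x"
      using Lyapunov_equation scaleR_matrix_vector_assoc[of "-1" "mat 1 :: real^'n^'n" x]
      unfolding M_def[symmetric] by simp
    moreover have "x \<bullet> (He M *v x) = 2 * (x \<bullet> (M *v x))"
      by (simp add: He_def matrix_vector_mult_add_rdistrib inner_add_right inner_commute[of x "x v* M"] dot_lmul_matrix)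
    ultimately have "2 * (x \<bullet> (M *v x)) = - (norm x)\<^sup>2"
      by (simp add: power2_norm_eq_inner)
    then show ?thesis unfolding Mx by (simp add: inner_add_right algebra_simps)
  qed
  have "V h g = x \<bullet> (P *v (A *v x)) + \<beta> * (x \<bullet> (P *v Bv))
      + (nu * (x \<bullet> Q b) * \<beta> + nu * (x \<bullet> deriv_on b Q 0) * c - u (A *v x) - nu * c * q0)
      + (u (A *v x) + \<beta> * u Bv) + (- \<beta> * u Bv - nu * w / 2 * N2 + nu * c * q0)"
    unfolding lyapunov_form_def g1 unfolding hg fst_conv snd_conv cross kernel
    by (simp add: u_add u_def[symmetric] matrix_vector_right_distrib inner_add_right matrix_vector_mult_scaleR)
  then show ?thesis
    unfolding PB using lyap by (simp add: hg N2_def algebra_simps)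
qed

end

section \<open>Stable semigroups\<close>

text \<open>The difference quotient \<open>(h' - h) / s\<close> minus \<open>g\<close>.\<close>

definition quotient_defect ::
  "real \<Rightarrow> ('n::finite) state \<Rightarrow> 'n state \<Rightarrow> 'n state \<Rightarrow> 'n state" where
  "quotient_defect s h' h g = lin_comb 1 (lin_comb (1/s) h' (-1/s) h) (-1) g"

lemma quotient_defect_expand:
  assumes "s \<noteq> 0"
  shows "h' = lin_comb 1 h s (lin_comb 1 g 1 (quotient_defect s h' h g))"
  using assms by (auto intro!: prod_eqI simp: quotient_defect_def lin_comb_def algebra_simps)

lemma lin_comb_diff_expand: "h = lin_comb 1 k (-1) (lin_comb 1 k (-1) h)"
  by (auto intro!: prod_eqI simp: lin_comb_def)

lemma state_norm_le_add_diff: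
  assumes "h \<in> state_space b" "k \<in> state_space b"
  shows "state_norm b h \<le> state_norm b k + state_norm b (lin_comb 1 k (-1) h)"
  using state_norm_lin_comb_le[of k b "lin_comb 1 k (-1) h" 1 "-1"] assms
    lin_comb_diff_expand[of h k] by auto

text \<open>By linearity, the \<open>\<epsilon>\<close>-\<open>\<delta>\<close> part of stability is a bound on the operator norms that is uniform in
  time.\<close>

lemma semigroup_uniform_bound:
  assumes S: "C0_semigroup b S" and stable: "globally_asymptotically_stable b S"
  shows "\<exists>M\<ge>0. \<forall>t\<ge>0. \<forall>h\<in>state_space b. state_norm b (S t h) \<le> M * state_norm b h"
proof -
  obtain \<delta> where \<delta>: "\<delta> > 0"
    "\<And>h t. h \<in> state_space b \<Longrightarrow> state_norm b h \<le> \<delta> \<Longrightarrow> t \<ge> 0 \<Longrightarrow> state_norm b (S t h) \<le> 1"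
    using stable unfolding globally_asymptotically_stable_def by (meson zero_less_one)
  have "state_norm b (S t h) \<le> 1 / \<delta> * state_norm b h" if t: "t \<ge> 0" and h: "h \<in> state_space b" for t h
  proof (cases "state_norm b h = 0")
    case True
    obtain K where "\<forall>h\<in>state_space b. state_norm b (S t h) \<le> K * state_norm b h"
      using S t unfolding C0_semigroup_def by meson
    with h True show ?thesis by force
  next
    case False
    then have pos: "state_norm b h > 0" by (simp add: less_le)
    define r where "r = \<delta> / state_norm b h"
    have r: "r > 0" using pos \<delta> by (simp add: r_def)
    have St: "S t h \<in> state_space b" "S t (lin_comb r h 0 h) \<in> state_space b"
      using S t h unfolding C0_semigroup_def by auto
    have "state_eq b (S t (lin_comb r h 0 h)) (lin_comb r (S t h) 0 (S t h))"
      using S t h unfolding C0_semigroup_def by blast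
    then have "state_norm b (S t (lin_comb r h 0 h)) = r * state_norm b (S t h)"
      using state_norm_cong_eq St state_norm_scale[OF St(1), of r] r lin_comb_state_space by fastforce
    moreover have "state_norm b (S t (lin_comb r h 0 h)) \<le> 1"
      using h t \<delta>(1) pos state_norm_scale[OF h, of r] by (intro \<delta>) (auto simp: r_def)
    ultimately have "r * state_norm b (S t h) \<le> 1" by simp
    then show ?thesis using r pos \<delta> by (simp add: r_def field_simps)
  qed
  then show ?thesis using \<delta> by (intro exI[of _ "1 / \<delta>"]) auto
qed

text \<open>A bounded semigroup generated by an operator on which the Lyapunov form is dissipative, and all
  of whose orbits tend to the origin.\<close>

locale dissipative_semigroup = lyapunov_kernel b P Q T
  for b :: real and P :: "real^'n^'n" and Q :: "real \<Rightarrow> real^'n" and T :: "real \<times> real \<Rightarrow> real" +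
  fixes G :: "(('n::finite) state \<times> 'n state) set" and S :: "real \<Rightarrow> 'n state \<Rightarrow> 'n state" and M c :: real
  assumes generated: "semigroup_generated_by b G S"
    and G_space: "\<And>h g. (h, g) \<in> G \<Longrightarrow> h \<in> state_space b \<and> g \<in> state_space b"
    and M_nonneg: "M \<ge> 0"
    and S_bound: "\<And>t h. t \<ge> 0 \<Longrightarrow> h \<in> state_space b \<Longrightarrow> state_norm b (S t h) \<le> M * state_norm b h"
    and S_lim: "\<And>h. h \<in> state_space b \<Longrightarrow> ((\<lambda>t. state_norm b (S t h)) \<longlongrightarrow> 0) at_top"
    and c_pos: "c > 0"
    and dissipative: "\<And>h g. (h, g) \<in> G \<Longrightarrow> 2 * V h g \<le> - c * (state_norm b h)\<^sup>2"
begin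

lemma S_space: "t \<ge> 0 \<Longrightarrow> h \<in> state_space b \<Longrightarrow> S t h \<in> state_space b"
  and S_lin: "t \<ge> 0 \<Longrightarrow> h \<in> state_space b \<Longrightarrow> g \<in> state_space b \<Longrightarrow>
    state_eq b (S t (lin_comb r h s g)) (lin_comb r (S t h) s (S t g))"
  and S_0: "h \<in> state_space b \<Longrightarrow> state_eq b (S 0 h) h"
  and S_add: "s \<ge> 0 \<Longrightarrow> t \<ge> 0 \<Longrightarrow> h \<in> state_space b \<Longrightarrow> state_eq b (S (s + t) h) (S s (S t h))"
  and S_cont: "h \<in> state_space b \<Longrightarrow> ((\<lambda>t. state_norm b (lin_comb 1 (S t h) (-1) h)) \<longlongrightarrow> 0) (at_right 0)"
  using generated unfolding semigroup_generated_by_def C0_semigroup_def by blast+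

lemma quotient_defect_space:
  "h' \<in> state_space b \<Longrightarrow> h \<in> state_space b \<Longrightarrow> g \<in> state_space b \<Longrightarrow> quotient_defect s h' h g \<in> state_space b"
  unfolding quotient_defect_def by auto

text \<open>\<open>(h, g)\<close> belongs to the generator, up to equality in the state space.\<close>

definition generator :: "'n state \<Rightarrow> 'n state \<Rightarrow> bool" where
  "generator h g \<longleftrightarrow> h \<in> state_space b \<and> g \<in> state_space b \<and>
     ((\<lambda>t. state_norm b (quotient_defect t (S t h) h g)) \<longlongrightarrow> 0) (at_right 0)"

lemma generator_iff:
  assumes "h \<in> state_space b" "g \<in> state_space b"
  shows "generator h g \<longleftrightarrow> (\<exists>h0 g0. (h0, g0) \<in> G \<and> state_eq b h h0 \<and> state_eq b g g0)"
  using generated assms unfolding semigroup_generated_by_def generator_def quotient_defect_def by blast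

lemma generator_dissipative:
  assumes "generator h g"
  shows "2 * V h g \<le> - c * (state_norm b h)\<^sup>2"
proof -
  have hg: "h \<in> state_space b" "g \<in> state_space b" using assms by (auto simp: generator_def)
  obtain h0 g0 where 0: "(h0, g0) \<in> G" "state_eq b h h0" "state_eq b g g0"
    using assms generator_iff[OF hg] by blast
  have "V h g = V h0 g0"
    using G_space[OF 0(1)] by (intro lyapunov_form_cong 0 hg) auto
  moreover have "state_norm b h = state_norm b h0"
    using G_space[OF 0(1)] by (intro state_norm_cong_eq 0 hg) auto
  ultimately show ?thesis using dissipative[OF 0(1)] by simp
qed

text \<open>The defect of the difference quotient of an orbit is controlled by the one at time \<open>0\<close>,
  uniformly in time.\<close>

lemma orbit_defect:
  assumes "t \<ge> 0" "s > 0" "h \<in> state_space b" "g \<in> state_space b"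
    and h': "state_eq b h' (S (t + s) h)" "h' \<in> state_space b"
  shows "state_norm b (quotient_defect s h' (S t h) (S t g)) \<le> M * state_norm b (quotient_defect s (S s h) h g)"
proof -
  have sp: "S s h \<in> state_space b" "S t h \<in> state_space b" "S t g \<in> state_space b" "S t (S s h) \<in> state_space b"
    using assms by (simp_all add: S_space)
  let ?q = "quotient_defect s (S s h) h g"
  have q: "?q \<in> state_space b" using assms sp by (intro quotient_defect_space)
  have "state_eq b h' (S t (S s h))"
    using h'(1) S_add[of t s h] assms by (auto intro: state_eq_trans)
  then have "state_eq b (quotient_defect s h' (S t h) (S t g)) (quotient_defect s (S t (S s h)) (S t h) (S t g))"
    unfolding quotient_defect_def by (intro state_eq_lin_comb state_eq_refl)
  also have "state_eq b \<dots> (lin_comb 1 (S t (lin_comb (1/s) (S s h) (-1/s) h)) (-1) (S t g))"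
    unfolding quotient_defect_def
    by (intro state_eq_lin_comb state_eq_refl state_eq_sym[OF S_lin] assms sp)
  also have "state_eq b \<dots> (S t ?q)"
    unfolding quotient_defect_def
    by (intro state_eq_sym[OF S_lin] assms sp lin_comb_state_space)
  finally have "state_norm b (quotient_defect s h' (S t h) (S t g)) = state_norm b (S t ?q)"
    by (rule state_norm_cong_eq) (use q sp h' assms in \<open>auto intro: S_space quotient_defect_space\<close>)
  also have "\<dots> \<le> M * state_norm b ?q" using assms q by (intro S_bound)
  finally show ?thesis .
qed

text \<open>Orbits that start in the domain of the generator stay there.\<close>

lemma generator_invariant:
  assumes hg: "generator h g" and t: "t \<ge> 0"
  shows "generator (S t h) (S t g)"
proof -
  have sp: "h \<in> state_space b" "g \<in> state_space b"
    and lim: "((\<lambda>s. state_norm b (quotient_defect s (S s h) h g)) \<longlongrightarrow> 0) (at_right 0)"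
    using hg by (auto simp: generator_def)
  have "((\<lambda>s. state_norm b (quotient_defect s (S s (S t h)) (S t h) (S t g))) \<longlongrightarrow> 0) (at_right 0)"
  proof (rule tendsto_sandwich[OF _ _ tendsto_const])
    show "((\<lambda>s. M * state_norm b (quotient_defect s (S s h) h g)) \<longlongrightarrow> 0) (at_right 0)"
      using tendsto_mult_right_zero[OF lim] .
    have "state_norm b (quotient_defect s (S s (S t h)) (S t h) (S t g)) \<le> M * state_norm b (quotient_defect s (S s h) h g)"
      if "s > 0" for s
      using that t sp S_add[of s t h]
      by (intro orbit_defect) (auto intro: S_space state_eq_sym simp: add.commute)
    then show "eventually (\<lambda>s. state_norm b (quotient_defect s (S s (S t h)) (S t h) (S t g))
        \<le> M * state_norm b (quotient_defect s (S s h) h g)) (at_right 0)"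
      using eventually_at_right_less[of 0] by (auto elim: eventually_mono)
  qed simp
  then show ?thesis using sp t by (simp add: generator_def S_space)
qed

lemma lyapunov_form_expand:
  assumes "h \<in> state_space b" "g \<in> state_space b"
  shows "V (lin_comb 1 h s g) (lin_comb 1 h s g) = V h h + 2 * s * V h g + s\<^sup>2 * V g g"
proof -
  have "lin_comb 1 h s g \<in> state_space b" using assms by auto
  then have "V (lin_comb 1 h s g) (lin_comb 1 h s g) = V (lin_comb 1 h s g) h + s * V (lin_comb 1 h s g) g"
    using assms lyapunov_form_lin_comb_left[OF assms, of "lin_comb 1 h s g" 1 s]
      lyapunov_form_commute[of h "lin_comb 1 h s g"] lyapunov_form_commute[of g "lin_comb 1 h s g"] by simp
  also have "\<dots> = V h h + s * V g h + s * (V h g + s * V g g)"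
    using assms by (simp add: lyapunov_form_lin_comb_left)
  also have "V g h = V h g" by (rule lyapunov_form_commute[OF assms(2,1)])
  finally show ?thesis by (simp add: power2_eq_square algebra_simps)
qed

text \<open>Since the defect of the difference quotient is small uniformly in time, the decay of \<open>V\<close> along an
  orbit follows by summing over a fine partition of the time interval. Neither an integral nor a
  derivative in time is needed.\<close>

lemma lyapunov_form_decreasing:
  assumes hg: "generator h g" and t0: "t0 \<ge> 0" and \<tau>: "\<tau> \<ge> 0" and \<rho>: "\<rho> \<ge> 0"
    and away: "\<And>t. t0 \<le> t \<Longrightarrow> t \<le> t0 + \<tau> \<Longrightarrow> \<rho> \<le> state_norm b (S t h)"
  shows "V (S (t0 + \<tau>) h) (S (t0 + \<tau>) h) \<le> V (S t0 h) (S t0 h) - \<tau> * (c * \<rho>\<^sup>2)"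
proof (cases "\<tau> = 0")
  case False
  then have \<tau>_pos: "\<tau> > 0" using \<tau> by simp
  have sp: "h \<in> state_space b" "g \<in> state_space b"
    and lim: "((\<lambda>s. state_norm b (quotient_defect s (S s h) h g)) \<longlongrightarrow> 0) (at_right 0)"
    using hg by (auto simp: generator_def)
  obtain K where K: "K \<ge> 0"
    "\<And>h g. h \<in> state_space b \<Longrightarrow> g \<in> state_space b \<Longrightarrow> \<bar>V h g\<bar> \<le> K * (state_norm b h * state_norm b g)"
    using lyapunov_form_bounded by blast
  define \<eta> where "\<eta> s = state_norm b (quotient_defect s (S s h) h g)" for s
  have \<eta>: "\<eta> s \<ge> 0" for s by (simp add: \<eta>_def)
  \<comment> \<open>bound for the error, relative to the step size \<open>s\<close>, of the first-order expansion of \<open>V\<close> along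
    the orbit\<close>
  define \<omega> where "\<omega> s = 2 * (K * ((M * state_norm b h) * (M * \<eta> s))) + s * (K * (M * state_norm b g + M * \<eta> s)\<^sup>2)" for s
  have step: "V (S (t + s) h) (S (t + s) h) \<le> V (S t h) (S t h) - s * (c * (state_norm b (S t h))\<^sup>2 - \<omega> s)"
    if t: "t \<ge> 0" and s: "s > 0" for t s
  proof -
    define u a r where "u = S t h" and "a = S t g" and "r = quotient_defect s (S (t + s) h) u a"
    define v where "v = lin_comb 1 a 1 r"
    have u: "u \<in> state_space b" "a \<in> state_space b" and u': "S (t + s) h \<in> state_space b"
      using t s sp by (auto simp: u_def a_def S_space)
    then have r: "r \<in> state_space b" "v \<in> state_space b"
      by (auto simp: r_def v_def intro: quotient_defect_space)
    have Nr: "state_norm b r \<le> M * \<eta> s"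
      unfolding r_def u_def a_def \<eta>_def using t s sp u' by (intro orbit_defect) auto
    have Nu: "state_norm b u \<le> M * state_norm b h" and Na: "state_norm b a \<le> M * state_norm b g"
      unfolding u_def a_def using t sp by (auto intro: S_bound)
    have Nv: "state_norm b v \<le> M * state_norm b g + M * \<eta> s"
      using state_norm_lin_comb_le[OF u(2) r(1), of 1 1] Na Nr by (simp add: v_def)
    have "generator u a" unfolding u_def a_def by (rule generator_invariant[OF hg t])
    then have ua: "2 * V u a \<le> - c * (state_norm b u)\<^sup>2" by (rule generator_dissipative)
    have "V u r \<le> K * (state_norm b u * state_norm b r)" using K(2)[OF u(1) r(1)] by simp
    also have "\<dots> \<le> K * ((M * state_norm b h) * (M * \<eta> s))"
      using M_nonneg by (intro mult_left_mono mult_mono Nu Nr K) auto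
    finally have ur: "V u r \<le> K * ((M * state_norm b h) * (M * \<eta> s))" .
    have "V v v \<le> K * (state_norm b v * state_norm b v)" using K(2)[OF r(2) r(2)] by simp
    also have "\<dots> \<le> K * (M * state_norm b g + M * \<eta> s)\<^sup>2"
      unfolding power2_eq_square using M_nonneg \<eta>
      by (intro mult_left_mono mult_mono Nv K) auto
    finally have vv: "V v v \<le> K * (M * state_norm b g + M * \<eta> s)\<^sup>2" .
    have uv: "V u v = V u a + V u r"
      using lyapunov_form_lin_comb_left[OF u(2) r(1) u(1), of 1 1] lyapunov_form_commute u r by (simp add: v_def)
    have "S (t + s) h = lin_comb 1 u s v"
      unfolding v_def r_def by (rule quotient_defect_expand) (use s in simp)
    then have "V (S (t + s) h) (S (t + s) h) = V u u + s * (2 * V u v + s * V v v)"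
      using lyapunov_form_expand[OF u(1) r(2), of s] by (simp add: power2_eq_square algebra_simps)
    also have "2 * V u v + s * V v v \<le> - (c * (state_norm b u)\<^sup>2 - \<omega> s)"
    proof -
      have "s * V v v \<le> s * (K * (M * state_norm b g + M * \<eta> s)\<^sup>2)" using vv s by simp
      then show ?thesis using ua ur unfolding uv \<omega>_def by simp
    qed
    then have "V u u + s * (2 * V u v + s * V v v) \<le> V u u + s * (- (c * (state_norm b u)\<^sup>2 - \<omega> s))"
      using s by (intro add_left_mono mult_left_mono) auto
    finally show ?thesis unfolding u_def by (simp only: mult_minus_right add_uminus_conv_diff)
  qed
  have steps: "V (S (t0 + real k * s) h) (S (t0 + real k * s) h) \<le> V (S t0 h) (S t0 h) - real k * s * (c * \<rho>\<^sup>2 - \<omega> s)"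
    if s: "s > 0" and "real k * s \<le> \<tau>" for k s
    using that(2)
  proof (induction k)
    case (Suc k)
    let ?t = "t0 + real k * s"
    have ks: "real k * s \<le> \<tau>" "?t \<ge> 0" using Suc.prems s t0 by (auto simp: algebra_simps)
    have "\<rho> \<le> state_norm b (S ?t h)" using ks s by (intro away) auto
    then have "c * \<rho>\<^sup>2 \<le> c * (state_norm b (S ?t h))\<^sup>2"
      using \<rho> c_pos by (intro mult_left_mono power_mono) auto
    then have "s * (c * \<rho>\<^sup>2 - \<omega> s) \<le> s * (c * (state_norm b (S ?t h))\<^sup>2 - \<omega> s)"
      using s by (intro mult_left_mono) auto
    moreover have "V (S (?t + s) h) (S (?t + s) h) \<le> V (S ?t h) (S ?t h) - s * (c * (state_norm b (S ?t h))\<^sup>2 - \<omega> s)"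
      by (rule step[OF ks(2) s])
    moreover have "V (S ?t h) (S ?t h) \<le> V (S t0 h) (S t0 h) - real k * s * (c * \<rho>\<^sup>2 - \<omega> s)"
      by (rule Suc.IH[OF ks(1)])
    moreover have "?t + s = t0 + real (Suc k) * s" by (simp add: algebra_simps)
    moreover have "real (Suc k) * s * (c * \<rho>\<^sup>2 - \<omega> s) = real k * s * (c * \<rho>\<^sup>2 - \<omega> s) + s * (c * \<rho>\<^sup>2 - \<omega> s)"
      by (simp add: algebra_simps)
    ultimately show ?case by (simp only:)
  qed simp
  define \<sigma> where "\<sigma> k = \<tau> * inverse (real (Suc k))" for k
  have \<sigma>_pos: "\<sigma> k > 0" and k\<sigma>: "real (Suc k) * \<sigma> k = \<tau>" for k
    using \<tau>_pos by (auto simp: \<sigma>_def)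
  have \<sigma>_lim: "\<sigma> \<longlonglongrightarrow> 0"
    unfolding \<sigma>_def using tendsto_mult_right_zero[OF LIMSEQ_inverse_real_of_nat] .
  have "filterlim \<sigma> (at_right 0) sequentially"
    using \<sigma>_lim \<sigma>_pos by (simp add: filterlim_at less_imp_neq[THEN not_sym])
  then have "(\<lambda>k. \<eta> (\<sigma> k)) \<longlonglongrightarrow> 0"
    using filterlim_compose[OF lim] by (simp add: \<eta>_def)
  then have "(\<lambda>k. \<omega> (\<sigma> k)) \<longlonglongrightarrow> 2 * (K * ((M * state_norm b h) * (M * 0))) + 0 * (K * (M * state_norm b g + M * 0)\<^sup>2)"
    unfolding \<omega>_def by (intro tendsto_intros \<sigma>_lim)
  then have "(\<lambda>k. \<omega> (\<sigma> k)) \<longlonglongrightarrow> 0" by simp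
  then have "(\<lambda>k. V (S t0 h) (S t0 h) - \<tau> * (c * \<rho>\<^sup>2 - \<omega> (\<sigma> k))) \<longlonglongrightarrow> V (S t0 h) (S t0 h) - \<tau> * (c * \<rho>\<^sup>2 - 0)"
    by (intro tendsto_intros)
  moreover have "V (S (t0 + \<tau>) h) (S (t0 + \<tau>) h) \<le> V (S t0 h) (S t0 h) - \<tau> * (c * \<rho>\<^sup>2 - \<omega> (\<sigma> k))" for k
    using steps[OF \<sigma>_pos[of k], of "Suc k"] unfolding k\<sigma> by simp
  ultimately have "V (S (t0 + \<tau>) h) (S (t0 + \<tau>) h) \<le> V (S t0 h) (S t0 h) - \<tau> * (c * \<rho>\<^sup>2 - 0)"
    using LIMSEQ_le_const by blast
  then show ?thesis by simp
qed simp

text \<open>A nonincreasing function of time that tends to \<open>0\<close> is nonnegative.\<close>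

lemma lyapunov_form_orbit_nonneg:
  assumes hg: "generator h g" and t0: "t0 \<ge> 0"
  shows "0 \<le> V (S t0 h) (S t0 h)"
proof -
  have h: "h \<in> state_space b" using hg by (simp add: generator_def)
  obtain K where K: "K \<ge> 0"
    "\<And>h g. h \<in> state_space b \<Longrightarrow> g \<in> state_space b \<Longrightarrow> \<bar>V h g\<bar> \<le> K * (state_norm b h * state_norm b g)"
    using lyapunov_form_bounded by blast
  have "((\<lambda>t. - (K * (state_norm b (S t h) * state_norm b (S t h)))) \<longlongrightarrow> - (K * (0 * 0))) at_top"
    by (intro tendsto_intros S_lim h)
  moreover have "eventually (\<lambda>t. - (K * (state_norm b (S t h) * state_norm b (S t h))) \<le> V (S t0 h) (S t0 h)) at_top"
    using eventually_ge_at_top[of t0]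
  proof eventually_elim
    case (elim t)
    have "S t h \<in> state_space b" using elim t0 h by (intro S_space) auto
    then have "- (K * (state_norm b (S t h) * state_norm b (S t h))) \<le> V (S t h) (S t h)"
      using K(2)[of "S t h" "S t h"] by linarith
    also have "\<dots> \<le> V (S t0 h) (S t0 h)"
      using lyapunov_form_decreasing[OF hg t0, of "t - t0" 0] elim by simp
    finally show ?case .
  qed
  ultimately have "- (K * (0 * 0)) \<le> V (S t0 h) (S t0 h)"
    by (rule tendsto_upperbound) simp
  then show ?thesis by simp
qed

text \<open>Strict positivity at a nonzero limit \<open>h\<close> of elements \<open>k m\<close> of the domain. On a short time interval
  all orbits in question stay away from the origin, so \<open>V\<close> loses at least a fixed amount along them, and
  what is left at the end is nonnegative.\<close>

lemma lyapunov_form_positive: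
  assumes h: "h \<in> state_space b" and pos: "state_norm b h > 0"
    and k: "\<And>m. \<exists>g. generator (k m) g"
    and lim: "(\<lambda>m. state_norm b (lin_comb 1 (k m) (-1) h)) \<longlonglongrightarrow> 0"
  shows "V h h > 0"
proof -
  define N where "N = state_norm b h"
  have N: "N > 0" using pos by (simp add: N_def)
  have ks: "k m \<in> state_space b" for m using k[of m] by (auto simp: generator_def)
  have "eventually (\<lambda>t. state_norm b (lin_comb 1 (S t h) (-1) h) < N / 2) (at_right 0)"
    using order_tendstoD(2)[OF S_cont[OF h], of "N / 2"] N by simp
  then obtain d where d: "d > 0" "\<And>t. 0 < t \<Longrightarrow> t < d \<Longrightarrow> state_norm b (lin_comb 1 (S t h) (-1) h) < N / 2"
    unfolding eventually_at_right_field by auto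
  define \<tau> where "\<tau> = d / 2"
  have \<tau>: "\<tau> > 0" using d by (simp add: \<tau>_def)
  have away: "N / 2 \<le> state_norm b (S t h)" if "0 \<le> t" "t \<le> \<tau>" for t
  proof (cases "t = 0")
    case True
    have "state_norm b (S 0 h) = N" unfolding N_def
      by (intro state_norm_cong_eq S_0 h S_space) simp
    then show ?thesis using True N by simp
  next
    case False
    then have "state_norm b (lin_comb 1 (S t h) (-1) h) < N / 2" using d that by (simp add: \<tau>_def)
    then show ?thesis
      using state_norm_le_add_diff[OF h S_space[OF that(1) h]] by (simp add: N_def)
  qed
  define D where "D m = lin_comb 1 (k m) (-1) h" for m
  have D: "D m \<in> state_space b" for m using ks h by (auto simp: D_def)
  have D_lim: "(\<lambda>m. state_norm b (D m)) \<longlonglongrightarrow> 0" using lim by (simp add: D_def)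
  have orbit: "N / 2 - M * state_norm b (D m) \<le> state_norm b (S t (k m))" if t: "0 \<le> t" "t \<le> \<tau>" for t m
  proof -
    have "h = lin_comb 1 (k m) (-1) (D m)" unfolding D_def by (rule lin_comb_diff_expand)
    then have "state_eq b (S t h) (lin_comb 1 (S t (k m)) (-1) (S t (D m)))"
      using S_lin[OF t(1) ks[of m] D[of m], of 1 "-1"] by simp
    then have "state_norm b (S t h) = state_norm b (lin_comb 1 (S t (k m)) (-1) (S t (D m)))"
      by (rule state_norm_cong_eq) (use t h ks D in \<open>auto intro!: S_space lin_comb_state_space\<close>)
    also have "\<dots> \<le> state_norm b (S t (k m)) + state_norm b (S t (D m))"
      using state_norm_lin_comb_le[OF S_space[OF t(1) ks[of m]] S_space[OF t(1) D[of m]], of 1 "-1"] by simp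
    also have "\<dots> \<le> state_norm b (S t (k m)) + M * state_norm b (D m)"
      using S_bound[OF t(1) D[of m]] by simp
    finally show ?thesis using away[OF t] by simp
  qed
  have "(\<lambda>m. M * state_norm b (D m)) \<longlonglongrightarrow> 0"
    using tendsto_mult_right_zero[OF D_lim] .
  then have "eventually (\<lambda>m. M * state_norm b (D m) < N / 4) sequentially"
    using order_tendstoD(2) N by (metis divide_pos_pos zero_less_numeral)
  then have "eventually (\<lambda>m. \<tau> * (c * (N / 4)\<^sup>2) \<le> V (k m) (k m)) sequentially"
  proof eventually_elim
    case (elim m)
    obtain g where g: "generator (k m) g" using k by blast
    have "V (S (0 + \<tau>) (k m)) (S (0 + \<tau>) (k m)) \<le> V (S 0 (k m)) (S 0 (k m)) - \<tau> * (c * (N / 4)\<^sup>2)"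
    proof (rule lyapunov_form_decreasing[OF g])
      show "N / 4 \<le> state_norm b (S t (k m))" if "0 \<le> t" "t \<le> 0 + \<tau>" for t
        using orbit[of t m] that elim by simp
    qed (use \<tau> N in auto)
    moreover have "0 \<le> V (S (0 + \<tau>) (k m)) (S (0 + \<tau>) (k m))"
      using \<tau> by (intro lyapunov_form_orbit_nonneg[OF g]) simp
    moreover have "V (S 0 (k m)) (S 0 (k m)) = V (k m) (k m)"
      by (intro lyapunov_form_cong S_0 ks S_space) auto
    ultimately show ?case by simp
  qed
  moreover have "(\<lambda>m. V (k m) (k m)) \<longlonglongrightarrow> V h h"
  proof -
    obtain K where K: "K \<ge> 0"
      "\<And>h g. h \<in> state_space b \<Longrightarrow> g \<in> state_space b \<Longrightarrow> \<bar>V h g\<bar> \<le> K * (state_norm b h * state_norm b g)"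
      using lyapunov_form_bounded by blast
    have km: "k m = lin_comb 1 h 1 (D m)" for m
      by (auto intro!: prod_eqI simp: D_def lin_comb_def)
    have "(\<lambda>m. V h (D m)) \<longlonglongrightarrow> 0"
    proof (rule Lim_null_comparison)
      show "(\<lambda>m. K * (state_norm b h * state_norm b (D m))) \<longlonglongrightarrow> 0"
        using tendsto_mult[OF tendsto_const[of K] tendsto_mult[OF tendsto_const[of "state_norm b h"] D_lim]] by simp
    qed (use K(2)[OF h D] in \<open>auto simp: eventually_sequentially\<close>)
    moreover have "(\<lambda>m. V (D m) (D m)) \<longlonglongrightarrow> 0"
    proof (rule Lim_null_comparison)
      show "(\<lambda>m. K * (state_norm b (D m) * state_norm b (D m))) \<longlonglongrightarrow> 0"
        using tendsto_mult[OF tendsto_const[of K] tendsto_mult[OF D_lim D_lim]] by simp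
    qed (use K(2)[OF D D] in \<open>auto simp: eventually_sequentially\<close>)
    ultimately have "(\<lambda>m. V h h + 2 * 1 * V h (D m) + 1\<^sup>2 * V (D m) (D m)) \<longlonglongrightarrow> V h h + 2 * 1 * 0 + 1\<^sup>2 * 0"
      by (intro tendsto_intros)
    then show ?thesis unfolding km using lyapunov_form_expand[OF h D, of 1] by simp
  qed
  ultimately have "\<tau> * (c * (N / 4)\<^sup>2) \<le> V h h"
    by (intro tendsto_lowerbound[where F=sequentially]) auto
  moreover have "0 < \<tau> * (c * (N / 4)\<^sup>2)" using \<tau> c_pos N by simp
  ultimately show ?thesis by linarith
qed

end

section \<open>The matrix as a restriction of the Lyapunov form\<close>

text \<open>The linear combination of the first \<open>n\<close> basis functions with coefficients \<open>c\<close>.\<close>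

definition combination :: "nat \<Rightarrow> (nat \<Rightarrow> real \<Rightarrow> real) \<Rightarrow> (nat \<Rightarrow> real) \<Rightarrow> real \<Rightarrow> real" where
  "combination n \<phi> c \<theta> = (\<Sum>k<n. c k * \<phi> k \<theta>)"

text \<open>The state with coordinates \<open>v\<close>, in the indexing of \<^const>\<open>Psi_plus\<close>.\<close>

definition coordinate_state :: "nat \<Rightarrow> (nat \<Rightarrow> real \<Rightarrow> real) \<Rightarrow> ('n::finite + nat \<Rightarrow> real) \<Rightarrow> 'n state" where
  "coordinate_state n \<phi> v = ((\<chi> i. v (Inl i)), combination n \<phi> (\<lambda>k. v (Inr k)))"

lemma combination_L2:
  assumes "\<forall>k<n. \<phi> k \<in> L2 b"
  shows "combination n \<phi> c \<in> L2 b"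
proof -
  have "combination m \<phi> c \<in> L2 b" if "m \<le> n" for m
    using that
  proof (induction m)
    case 0
    then show ?case using L2_continuous[of b "\<lambda>_. 0"] by (simp add: combination_def[abs_def])
  next
    case (Suc m)
    then have "(\<lambda>\<theta>. 1 * combination m \<phi> c \<theta> + c m * \<phi> m \<theta>) \<in> L2 b"
      using assms by (intro L2_lin_comb) auto
    then show ?case by (simp add: combination_def[abs_def])
  qed
  then show ?thesis by simp
qed

text \<open>The quadratic form of the matrix is the restriction of \<open>V\<close> to the states whose second component
  is a combination of the basis functions.\<close>

lemma (in lyapunov_kernel) Psi_plus_eq_lyapunov_form:
  fixes \<phi> :: "nat \<Rightarrow> real \<Rightarrow> real" and v :: "('n::finite) + nat \<Rightarrow> real"
  assumes \<phi>: "\<forall>k<n. \<phi> k \<in> L2 b"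
  defines "h \<equiv> coordinate_state n \<phi> v"
  shows "V h h = (\<Sum>i\<in>UNIV <+> {..<n}. \<Sum>j\<in>UNIV <+> {..<n}. v i * Psi_plus b P Q T \<phi> i j * v j)"
proof -
  define x \<xi> where "x = (\<chi> i. v (Inl i))" and "\<xi> k = v (Inr k)" for k
  have h: "h = (x, combination n \<phi> \<xi>)"
    by (simp add: h_def coordinate_state_def x_def \<xi>_def[abs_def])
  have Q_entry: "integrable (interval_measure b) (\<lambda>\<theta>. Q \<theta> $ i * \<phi> k \<theta>)" if "k < n" for i k
    using Q_integrable[of "\<phi> k" "axis i 1"] \<phi> that by (simp add: inner_axis')
  have "(x \<bullet> Q \<theta>) * combination n \<phi> \<xi> \<theta> = (\<Sum>i\<in>UNIV. \<Sum>k<n. x $ i * \<xi> k * (Q \<theta> $ i * \<phi> k \<theta>))" for \<theta>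
    unfolding inner_vec_def combination_def sum_product inner_real_def by (intro sum.cong refl) simp
  then have "(LINT \<theta>|interval_measure b. (x \<bullet> Q \<theta>) * combination n \<phi> \<xi> \<theta>) =
      (LINT \<theta>|interval_measure b. (\<Sum>i\<in>UNIV. \<Sum>k<n. x $ i * \<xi> k * (Q \<theta> $ i * \<phi> k \<theta>)))"
    by simp
  also have "\<dots> = (\<Sum>i\<in>UNIV. LINT \<theta>|interval_measure b. (\<Sum>k<n. x $ i * \<xi> k * (Q \<theta> $ i * \<phi> k \<theta>)))"
    by (intro Bochner_Integration.integral_sum Bochner_Integration.integrable_sum integrable_mult_right Q_entry) auto
  also have "\<dots> = (\<Sum>i\<in>UNIV. \<Sum>k<n. LINT \<theta>|interval_measure b. x $ i * \<xi> k * (Q \<theta> $ i * \<phi> k \<theta>))"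
    by (intro sum.cong refl Bochner_Integration.integral_sum integrable_mult_right Q_entry) auto
  also have "\<dots> = (\<Sum>i\<in>UNIV. \<Sum>k<n. x $ i * \<xi> k * Q_coeff b Q \<phi> i k)"
    by (simp add: Q_coeff_def)
  finally have cross: "(LINT \<theta>|interval_measure b. (x \<bullet> Q \<theta>) * combination n \<phi> \<xi> \<theta>) = \<dots>" .
  have T_entry: "integrable (square_measure b) (\<lambda>s. \<phi> k (fst s) * T s * \<phi> l (snd s))" if "k < n" "l < n" for k l
    using \<phi> that by (intro kernel_integrable) auto
  have z: "combination n \<phi> \<xi> \<in> L2 b" by (rule combination_L2[OF \<phi>])
  have "(LINT \<theta>1|interval_measure b. LINT \<theta>2|interval_measure b. combination n \<phi> \<xi> \<theta>1 * T (\<theta>1, \<theta>2) * combination n \<phi> \<xi> \<theta>2) =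
      (LINT s|square_measure b. combination n \<phi> \<xi> (fst s) * T s * combination n \<phi> \<xi> (snd s))"
    using integral_square_fst[OF kernel_integrable[OF z z]] by simp
  also have "\<dots> = (LINT s|square_measure b. (\<Sum>k<n. \<Sum>l<n. \<xi> k * \<xi> l * (\<phi> k (fst s) * T s * \<phi> l (snd s))))"
  proof -
    have "combination n \<phi> \<xi> (fst s) * T s * combination n \<phi> \<xi> (snd s) =
        (\<Sum>k<n. \<Sum>l<n. \<xi> k * \<xi> l * (\<phi> k (fst s) * T s * \<phi> l (snd s)))" for s
      unfolding combination_def sum_distrib_right[of _ _ "T s"] sum_product by (intro sum.cong refl) simp
    then show ?thesis by simp
  qed
  also have "\<dots> = (\<Sum>k<n. LINT s|square_measure b. (\<Sum>l<n. \<xi> k * \<xi> l * (\<phi> k (fst s) * T s * \<phi> l (snd s))))"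
    by (intro Bochner_Integration.integral_sum Bochner_Integration.integrable_sum integrable_mult_right T_entry) auto
  also have "\<dots> = (\<Sum>k<n. \<Sum>l<n. LINT s|square_measure b. \<xi> k * \<xi> l * (\<phi> k (fst s) * T s * \<phi> l (snd s)))"
    by (intro sum.cong refl Bochner_Integration.integral_sum integrable_mult_right T_entry) auto
  also have "\<dots> = (\<Sum>k<n. \<Sum>l<n. \<xi> k * \<xi> l * (LINT s|square_measure b. \<phi> k (fst s) * T s * \<phi> l (snd s)))"
    by simp
  also have "\<dots> = (\<Sum>k<n. \<Sum>l<n. \<xi> k * \<xi> l * T_coeff b T \<phi> k l)"
    using integral_square_fst[OF T_entry] by (simp add: T_coeff_def)
  finally have kernel: "(LINT \<theta>1|interval_measure b. LINT \<theta>2|interval_measure b.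
      combination n \<phi> \<xi> \<theta>1 * T (\<theta>1, \<theta>2) * combination n \<phi> \<xi> \<theta>2) = \<dots>" .
  have P: "x \<bullet> (P *v x) = (\<Sum>i\<in>UNIV. \<Sum>j\<in>UNIV. x $ i * P $ i $ j * x $ j)"
    by (simp add: inner_vec_def matrix_vector_mult_def sum_distrib_left mult_ac)
  have swap: "(\<Sum>k<n. \<Sum>j\<in>UNIV. \<xi> k * Q_coeff b Q \<phi> j k * x $ j) = (\<Sum>i\<in>UNIV. \<Sum>k<n. x $ i * \<xi> k * Q_coeff b Q \<phi> i k)"
    by (subst sum.swap) (simp add: mult_ac)
  have "V h h = (\<Sum>i\<in>UNIV. \<Sum>j\<in>UNIV. x $ i * P $ i $ j * x $ j) + 2 * (\<Sum>i\<in>UNIV. \<Sum>k<n. x $ i * \<xi> k * Q_coeff b Q \<phi> i k)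
      + (\<Sum>k<n. \<Sum>l<n. \<xi> k * \<xi> l * T_coeff b T \<phi> k l)"
    unfolding lyapunov_form_def h fst_conv snd_conv cross kernel P by simp
  also have "\<dots> = (\<Sum>i\<in>UNIV <+> {..<n}. \<Sum>j\<in>UNIV <+> {..<n}. v i * Psi_plus b P Q T \<phi> i j * v j)"
    using swap by (simp add: sum.Plus sum.distrib x_def \<xi>_def mult_ac)
  finally show ?thesis .
qed

lemma coordinate_state_norm_pos:
  assumes \<phi>: "\<forall>k<n. \<phi> k \<in> L2 b" and indep: "lin_indep_L2 b n \<phi>"
    and v: "\<exists>i\<in>UNIV <+> {..<n}. v i \<noteq> 0"
  shows "state_norm b (coordinate_state n \<phi> v :: ('n::finite) state) > 0"
proof (rule ccontr)
  let ?h = "coordinate_state n \<phi> v :: 'n state"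
  assume "\<not> state_norm b ?h > 0"
  then have "state_norm b ?h = 0" using state_norm_nonneg[of b ?h] by linarith
  moreover have nonneg: "0 \<le> (LINT \<theta>|interval_measure b. (snd ?h \<theta>)\<^sup>2)"
    by (intro integral_nonneg_AE) auto
  ultimately have x: "(norm (fst ?h))\<^sup>2 = 0" and z: "(LINT \<theta>|interval_measure b. (snd ?h \<theta>)\<^sup>2) = 0"
    by (auto simp: state_norm_def add_nonneg_eq_0_iff)
  have "v (Inl i) = 0" for i
    using x by (simp add: coordinate_state_def vec_eq_iff)
  moreover have "AE \<theta> in interval_measure b. combination n \<phi> (\<lambda>k. v (Inr k)) \<theta> = 0"
  proof -
    have "integrable (interval_measure b) (\<lambda>\<theta>. (combination n \<phi> (\<lambda>k. v (Inr k)) \<theta>)\<^sup>2)"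
      using combination_L2[OF \<phi>] by (simp add: L2_def)
    from integral_nonneg_eq_0_iff_AE[OF this] show ?thesis
      using z by (simp add: coordinate_state_def)
  qed
  then have "v (Inr k) = 0" if "k < n" for k
    using indep[unfolded lin_indep_L2_def, rule_format, of "\<lambda>k. v (Inr k)"] that by (simp add: combination_def)
  ultimately show False using v by auto
qed

section \<open>Approximation by elements of the domain\<close>

lemma H2_with_derivsI:
  assumes "\<And>\<theta>. \<theta> \<in> {0..b} \<Longrightarrow> (z has_real_derivative z1 \<theta>) (at \<theta> within {0..b})"
    and z1: "\<And>\<theta>. \<theta> \<in> {0..b} \<Longrightarrow> (z1 has_real_derivative z2 \<theta>) (at \<theta> within {0..b})"
    and z2: "continuous_on {0..b} z2"
  shows "H2_with_derivs b z z1 z2"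
proof -
  have cont: "continuous_on {0..b} z1"
    unfolding continuous_on_eq_continuous_within using z1 by (blast intro: DERIV_continuous)
  have der: "(z1 has_real_derivative z2 x) (at x)" if "0 < x" "x < b" for x
    using z1[of x] that by (simp add: at_within_Icc_at)
  have "primitive_on b z1 z2"
    by (rule primitive_onI[of "{}", OF _ cont der integrable_interval_continuous[OF z2]]) auto
  then show ?thesis
    using assms(1) L2_continuous[OF z2] unfolding H2_with_derivs_def primitive_on_def by blast
qed

lemma combination_derivative:
  assumes "closed_under_differentiation b n \<phi>"
  obtains D where "\<And>c \<theta>. \<theta> \<in> {0..b} \<Longrightarrow>
    (combination n \<phi> c has_real_derivative combination n \<phi> (D c) \<theta>) (at \<theta> within {0..b})"
proof -
  obtain \<Delta> where \<Delta>: "\<And>k \<theta>. k < n \<Longrightarrow> \<theta> \<in> {0..b} \<Longrightarrow>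
      (\<phi> k has_real_derivative (\<Sum>l<n. \<Delta> k l * \<phi> l \<theta>)) (at \<theta> within {0..b})"
    using assms unfolding closed_under_differentiation_def by blast
  define D where "D c l = (\<Sum>k<n. c k * \<Delta> k l)" for c l
  show ?thesis
  proof (rule that)
    fix c \<theta> assume \<theta>: "\<theta> \<in> {0..b}"
    have "(combination n \<phi> c has_real_derivative (\<Sum>k<n. c k * (\<Sum>l<n. \<Delta> k l * \<phi> l \<theta>))) (at \<theta> within {0..b})"
      unfolding combination_def[abs_def]
      by (intro DERIV_sum DERIV_cmult \<Delta> \<theta>) auto
    also have "(\<Sum>k<n. c k * (\<Sum>l<n. \<Delta> k l * \<phi> l \<theta>)) = (\<Sum>k<n. \<Sum>l<n. c k * \<Delta> k l * \<phi> l \<theta>)"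
      by (simp add: sum_distrib_left mult.assoc)
    also have "\<dots> = (\<Sum>l<n. \<Sum>k<n. c k * \<Delta> k l * \<phi> l \<theta>)" by (rule sum.swap)
    also have "\<dots> = combination n \<phi> (D c) \<theta>"
      by (simp add: combination_def D_def sum_distrib_right)
    finally show "(combination n \<phi> c has_real_derivative combination n \<phi> (D c) \<theta>) (at \<theta> within {0..b})" .
  qed
qed

lemma boundary_layer_L2_limit:
  fixes \<alpha> \<beta> b :: real
  assumes b: "b > 0"
  shows "(\<lambda>m. LINT \<theta>|interval_measure b. (\<alpha> * (1 - \<theta> / b) ^ Suc m + \<beta> * (\<theta> / b) ^ Suc m)\<^sup>2) \<longlonglongrightarrow> 0"
proof -
  have "(\<lambda>m. LINT \<theta>|interval_measure b. (\<alpha> * (1 - \<theta> / b) ^ Suc m + \<beta> * (\<theta> / b) ^ Suc m)\<^sup>2) \<longlonglongrightarrow>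
      (LINT \<theta>|interval_measure b. 0)"
  proof (rule integral_dominated_convergence[where w="\<lambda>_. (\<bar>\<alpha>\<bar> + \<bar>\<beta>\<bar>)\<^sup>2"])
    show "(\<lambda>\<theta>. (\<alpha> * (1 - \<theta> / b) ^ Suc m + \<beta> * (\<theta> / b) ^ Suc m)\<^sup>2) \<in> borel_measurable (interval_measure b)" for m
      using b by (intro borel_measurable_interval_continuous continuous_intros) auto
    show "AE \<theta> in interval_measure b. (\<lambda>m. (\<alpha> * (1 - \<theta> / b) ^ Suc m + \<beta> * (\<theta> / b) ^ Suc m)\<^sup>2) \<longlonglongrightarrow> 0"
    proof (rule AE_I2)
      fix \<theta> assume "\<theta> \<in> space (interval_measure b)"
      then have "(\<lambda>m. (1 - \<theta> / b) ^ Suc m) \<longlonglongrightarrow> 0" "(\<lambda>m. (\<theta> / b) ^ Suc m) \<longlonglongrightarrow> 0"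
        by (intro LIMSEQ_Suc LIMSEQ_realpow_zero; simp)+
      then have "(\<lambda>m. (\<alpha> * (1 - \<theta> / b) ^ Suc m + \<beta> * (\<theta> / b) ^ Suc m)\<^sup>2) \<longlonglongrightarrow> (\<alpha> * 0 + \<beta> * 0)\<^sup>2"
        by (intro tendsto_intros)
      then show "(\<lambda>m. (\<alpha> * (1 - \<theta> / b) ^ Suc m + \<beta> * (\<theta> / b) ^ Suc m)\<^sup>2) \<longlonglongrightarrow> 0" by simp
    qed
    show "AE \<theta> in interval_measure b. norm ((\<alpha> * (1 - \<theta> / b) ^ Suc m + \<beta> * (\<theta> / b) ^ Suc m)\<^sup>2) \<le> (\<bar>\<alpha>\<bar> + \<bar>\<beta>\<bar>)\<^sup>2" for m
    proof (rule AE_I2)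
      fix \<theta> assume \<theta>: "\<theta> \<in> space (interval_measure b)"
      have "\<bar>\<alpha> * (1 - \<theta> / b) ^ Suc m + \<beta> * (\<theta> / b) ^ Suc m\<bar> \<le> \<bar>\<alpha>\<bar> * \<bar>(1 - \<theta> / b) ^ Suc m\<bar> + \<bar>\<beta>\<bar> * \<bar>(\<theta> / b) ^ Suc m\<bar>"
        by (metis abs_mult abs_triangle_ineq)
      also have "\<dots> \<le> \<bar>\<alpha>\<bar> * 1 + \<bar>\<beta>\<bar> * 1"
        unfolding power_abs using \<theta> by (intro add_mono mult_left_mono power_le_one) auto
      finally show "norm ((\<alpha> * (1 - \<theta> / b) ^ Suc m + \<beta> * (\<theta> / b) ^ Suc m)\<^sup>2) \<le> (\<bar>\<alpha>\<bar> + \<bar>\<beta>\<bar>)\<^sup>2"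
        by (simp add: abs_le_square_iff[symmetric])
    qed
  qed auto
  then show ?thesis by simp
qed

text \<open>Polynomials concentrated near the two end points repair the boundary values of a smooth
  profile at a small cost in \<open>L\<^sup>2\<close>.\<close>

lemma domain_approximation:
  fixes A :: "real^'n^'n" and B :: "real^1^'n" and C :: "real^('n::finite)^1"
    and x :: "real^'n" and \<xi> :: "nat \<Rightarrow> real"
  assumes b: "b > 0" and closed: "closed_under_differentiation b n \<phi>"
  defines "h \<equiv> (x, combination n \<phi> \<xi>)"
  obtains k where "\<And>m. \<exists>g. (k m, g) \<in> system_operator A B C lam nu b b"
    "(\<lambda>m. state_norm b (lin_comb 1 (k m) (-1) h)) \<longlonglongrightarrow> 0"
proof -
  obtain D where D: "\<And>c \<theta>. \<theta> \<in> {0..b} \<Longrightarrow>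
    (combination n \<phi> c has_real_derivative combination n \<phi> (D c) \<theta>) (at \<theta> within {0..b})"
    using combination_derivative[OF closed] by blast
  have cont: "continuous_on {0..b} (combination n \<phi> c)" for c
    unfolding continuous_on_eq_continuous_within using D by (blast intro: DERIV_continuous)
  \<comment> \<open>the corrections that the profile needs at the two end points\<close>
  define \<alpha> \<beta> where "\<alpha> = (C *v x) $ 1 - combination n \<phi> \<xi> 0" and "\<beta> = - combination n \<phi> \<xi> b"
  define z where "z m \<theta> = combination n \<phi> \<xi> \<theta> + (\<alpha> * (1 - \<theta> / b) ^ Suc m + \<beta> * (\<theta> / b) ^ Suc m)" for m \<theta>
  define z1 where "z1 m \<theta> = combination n \<phi> (D \<xi>) \<theta> +
    real (Suc m) / b * (\<beta> * (\<theta> / b) ^ m - \<alpha> * (1 - \<theta> / b) ^ m)" for m \<theta>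
  \<comment> \<open>for \<open>m = 0\<close> the exponent is truncated, but the factor \<open>real m\<close> vanishes\<close>
  define z2 where "z2 m \<theta> = combination n \<phi> (D (D \<xi>)) \<theta> +
    real (Suc m) / b * (real m / b) * (\<beta> * (\<theta> / b) ^ (m - 1) + \<alpha> * (1 - \<theta> / b) ^ (m - 1))" for m \<theta>
  have d1: "((\<lambda>\<theta>. (1 - \<theta> / b) ^ j) has_real_derivative - (real j / b) * (1 - \<theta> / b) ^ (j - 1)) (at \<theta> within X)" for j \<theta> X
  proof -
    have "((\<lambda>\<theta>. 1 - \<theta> / b) has_real_derivative - (1 / b)) (at \<theta> within X)"
      using b by (auto intro!: derivative_eq_intros)
    from DERIV_power[OF this, of j] show ?thesis by (rule DERIV_cong) simp
  qed
  have d2: "((\<lambda>\<theta>. (\<theta> / b) ^ j) has_real_derivative (real j / b) * (\<theta> / b) ^ (j - 1)) (at \<theta> within X)" for j \<theta> X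
  proof -
    have "((\<lambda>\<theta>. \<theta> / b) has_real_derivative 1 / b) (at \<theta> within X)"
      using b by (auto intro!: derivative_eq_intros)
    from DERIV_power[OF this, of j] show ?thesis by (rule DERIV_cong) simp
  qed
  have H2: "H2_with_derivs b (z m) (z1 m) (z2 m)" for m
  proof (rule H2_with_derivsI)
    show "(z m has_real_derivative z1 m \<theta>) (at \<theta> within {0..b})" if "\<theta> \<in> {0..b}" for \<theta>
      unfolding z_def z1_def
      by (rule DERIV_cong[OF DERIV_add[OF D[OF that] DERIV_add[OF DERIV_cmult[OF d1] DERIV_cmult[OF d2]]]])
         (simp add: algebra_simps)
    show "(z1 m has_real_derivative z2 m \<theta>) (at \<theta> within {0..b})" if "\<theta> \<in> {0..b}" for \<theta>
      unfolding z1_def z2_def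
      by (rule DERIV_cong[OF DERIV_add[OF D[OF that]
            DERIV_cmult[OF DERIV_diff[OF DERIV_cmult[OF d2] DERIV_cmult[OF d1]]]]])
         (simp add: algebra_simps)
    show "continuous_on {0..b} (z2 m)"
      unfolding z2_def using b by (intro continuous_intros cont) auto
  qed
  have "vec (z m 0) = C *v x" "z m b = 0" for m
    using b by (simp_all add: z_def \<alpha>_def \<beta>_def vec_eq_iff forall_1)
  then have "\<exists>g. ((x, z m), g) \<in> system_operator A B C lam nu b b" for m
    using H2[of m] unfolding system_operator_def by blast
  moreover have "(\<lambda>m. state_norm b (lin_comb 1 (x, z m) (-1) h)) \<longlonglongrightarrow> 0"
  proof -
    have "state_norm b (lin_comb 1 (x, z m) (-1) h) =
        sqrt (LINT \<theta>|interval_measure b. (\<alpha> * (1 - \<theta> / b) ^ Suc m + \<beta> * (\<theta> / b) ^ Suc m)\<^sup>2)" for m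
      by (simp add: state_norm_def lin_comb_def h_def z_def)
    then show ?thesis
      using tendsto_real_sqrt[OF boundary_layer_L2_limit[OF b, of \<alpha> \<beta>]] by simp
  qed
  ultimately show ?thesis by (rule that)
qed

section \<open>The instability criterion\<close>

theorem corollary2:
  fixes A P :: "real^'n^'n" and B :: "real^1^'n" and C :: "real^'n^1"
    and lam nu theta_i theta_o w :: real
    and Q :: "real \<Rightarrow> real^'n" and T :: "real \<times> real \<Rightarrow> real"
    and n :: nat and \<phi> :: "nat \<Rightarrow> real \<Rightarrow> real"
    and S :: "real \<Rightarrow> ('n::finite) state \<Rightarrow> 'n state"
  assumes "nu > 0" and "theta_i > 0" and "theta_o = theta_i"
    and "semigroup_generated_by theta_i (system_operator A B C lam nu theta_i theta_o) S"
    and "w > 0"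
    and "transpose P = P"
    and "bounded (Q ` {0..theta_i})"
    and "bounded (T ` ({0..theta_i} \<times> {0..theta_i}))"
    and "\<forall>\<theta>1\<in>{0..theta_i}. \<forall>\<theta>2\<in>{0..theta_i}. T (\<theta>1, \<theta>2) = T (\<theta>2, \<theta>1)"
    and "Q differentiable_on {0..theta_i}"
    and "deriv_on theta_i Q differentiable_on {0..theta_i}"
    and "piecewise_regular theta_i T"
    and "lyapunov_equations A B C lam nu theta_i w P Q T"
    and "\<forall>k<n. \<phi> k \<in> L2 theta_i"
    and "lin_indep_L2 theta_i n \<phi>"
    and "orthonormal_L2 theta_i n \<phi>"
    and "closed_under_differentiation theta_i n \<phi>"
    and "\<not> positive_definite_on (UNIV <+> {..<n}) (Psi_plus theta_i P Q T \<phi>)"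
  shows "unstable theta_i S"
  unfolding unstable_def
proof
  assume stable: "globally_asymptotically_stable theta_i S"
  interpret lyapunov_solution A P B C lam nu theta_i w Q T
    by (rule lyapunov_solution.intro) (fact assms)+
  let ?G = "system_operator A B C lam nu theta_i theta_i"
  have gen: "semigroup_generated_by theta_i ?G S"
    using assms(4) unfolding \<open>theta_o = theta_i\<close> .
  then have "C0_semigroup theta_i S"
    unfolding semigroup_generated_by_def by (rule conjunct1)
  then obtain M where M: "M \<ge> 0"
    "\<And>t h. t \<ge> 0 \<Longrightarrow> h \<in> state_space theta_i \<Longrightarrow> state_norm theta_i (S t h) \<le> M * state_norm theta_i h"
    using semigroup_uniform_bound[OF _ stable] by blast
  \<comment> \<open>the two terms of the dissipation identity are both at least \<open>c\<close> times their share of the squared norm\<close>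
  define c where "c = min 1 (nu * w)"
  have diss: "2 * V h g \<le> - c * (state_norm theta_i h)\<^sup>2" if "(h, g) \<in> ?G" for h g
  proof -
    let ?N = "LINT \<theta>|interval_measure theta_i. (snd h \<theta>)\<^sup>2"
    have "0 \<le> ?N" by (intro integral_nonneg_AE) auto
    then have "c * ?N \<le> nu * w * ?N" "c * (norm (fst h))\<^sup>2 \<le> 1 * (norm (fst h))\<^sup>2"
      unfolding c_def by (intro mult_right_mono; simp)+
    moreover have "(state_norm theta_i h)\<^sup>2 = (norm (fst h))\<^sup>2 + ?N"
      using \<open>0 \<le> ?N\<close> by (simp add: state_norm_def)
    ultimately show ?thesis
      using lyapunov_form_dissipation[OF that] by (simp add: distrib_left)
  qed
  interpret dissipative_semigroup theta_i P Q T ?G S M c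
  proof unfold_locales
    show "h \<in> state_space theta_i \<and> g \<in> state_space theta_i" if "(h, g) \<in> ?G" for h g
      using system_operator_state_space[OF that] by blast
    show "((\<lambda>t. state_norm theta_i (S t h)) \<longlongrightarrow> 0) at_top" if "h \<in> state_space theta_i" for h
      using stable that unfolding globally_asymptotically_stable_def by blast
    show "c > 0" using assms(1,5) by (simp add: c_def)
  qed (fact gen M diss)+
  obtain v where v: "\<exists>i\<in>UNIV <+> {..<n}. v i \<noteq> 0"
    "(\<Sum>i\<in>UNIV <+> {..<n}. \<Sum>j\<in>UNIV <+> {..<n}. v i * Psi_plus theta_i P Q T \<phi> i j * v j) \<le> 0"
    using assms(18) unfolding positive_definite_on_def by (auto simp: not_less)
  define h where "h = coordinate_state n \<phi> v"
  have h: "h \<in> state_space theta_i"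
    unfolding h_def coordinate_state_def by (intro state_spaceI) (simp add: combination_L2[OF assms(14)])
  obtain k where k: "\<And>m. \<exists>g. (k m, g) \<in> ?G"
    "(\<lambda>m. state_norm theta_i (lin_comb 1 (k m) (-1) h)) \<longlonglongrightarrow> 0"
    using domain_approximation[OF assms(2,17)] unfolding h_def coordinate_state_def by blast
  have "\<exists>g. generator (k m) g" for m
    using k(1)[of m] G_space generator_iff state_eq_refl by meson
  then have "V h h > 0"
    using coordinate_state_norm_pos[OF assms(14,15) v(1)] k(2)
    by (intro lyapunov_form_positive[OF h]) (auto simp: h_def)
  moreover have "V h h \<le> 0"
    unfolding h_def Psi_plus_eq_lyapunov_form[OF assms(14)] by (rule v(2))
  ultimately show False by simp
qed

end
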